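(* Let $p$ be a nonzero integer and let $\phi$ be a bounded nonzero radial function on $\mathbb{D}$. If $\psi$ is a bounded radial function on $\mathbb{D}$ such that the product $T_{e^{ip\theta}\phi}T_{\psi}$ is a Toeplitz operator on $L^2_h$ (that is, $T_{e^{ip\theta}\phi}T_{\psi}=T_g$ for some bounded function $g$ on $\mathbb{D}$), then $\psi$ is a constant function.
   Context: $\mathbb{D}$ is the open unit disk of the complex plane and $dA=r\,dr\,\frac{d\theta}{\pi}$ is normalized Lebesgue measure on $\mathbb{D}$. The harmonic Bergman space $L^2_h$ is the closed subspace of $L^2(\mathbb{D},dA)$ consisting of all harmonic functions on $\mathbb{D}$, and $Q$ is the orthogonal projection of $L^2(\mathbb{D},dA)$ onto $L^2_h$. For a bounded (measurable) function $f$ on $\mathbb{D}$, the Toeplitz operator $T_f:L^2_h\to L^2_h$ with symbol $f$ is $T_f(u)=Q(fu)$. A function $\phi$ on $\mathbb{D}$ is radial if $\phi(z)$ depends only on $r=|z|$; $e^{ip\theta}\phi$ denotes the function $re^{i\theta}\mapsto e^{ip\theta}\phi(r)$. Equality of symbols is understood almost everywhere; "nonzero" means not almost everywhere zero. *)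

theory Defs
  imports "HOL-Analysis.Analysis"
begin

definition unit_disk :: "complex set" where
  "unit_disk = ball 0 1"

definition dA :: "complex measure" where
  "dA = scale_measure (ennreal (1 / pi)) (lebesgue_on unit_disk)"

definition L2 :: "(complex \<Rightarrow> complex) set" where
  "L2 = {f. f \<in> borel_measurable dA \<and> integrable dA (\<lambda>z. (cmod (f z))\<^sup>2)}"

definition L2_inner :: "(complex \<Rightarrow> complex) \<Rightarrow> (complex \<Rightarrow> complex) \<Rightarrow> complex" where
  "L2_inner f g = (LINT z|dA. f z * cnj (g z))"

text \<open>\<open>ux\<close> and \<open>uy\<close> are the partial derivatives of \<open>u\<close> on \<open>S\<close> in the sense of total
  real differentiability, with \<open>z = x + i y\<close>.\<close>

definition has_partials_on ::
    "(complex \<Rightarrow> complex) \<Rightarrow> (complex \<Rightarrow> complex) \<Rightarrow> (complex \<Rightarrow> complex) \<Rightarrow> complex set \<Rightarrow> bool" where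
  "has_partials_on u ux uy S \<longleftrightarrow>
     (\<forall>z\<in>S. (u has_derivative (\<lambda>h. Re h *\<^sub>R ux z + Im h *\<^sub>R uy z)) (at z))"

text \<open>Complex-valued harmonic functions on an open set: twice continuously differentiable
  (in the real sense) with vanishing Laplacian.\<close>

definition harmonic_on :: "(complex \<Rightarrow> complex) \<Rightarrow> complex set \<Rightarrow> bool" where
  "harmonic_on u S \<longleftrightarrow> open S \<and>
     (\<exists>ux uy uxx uxy uyx uyy.
        has_partials_on u ux uy S \<and> has_partials_on ux uxx uxy S \<and> has_partials_on uy uyx uyy S \<and>
        continuous_on S uxx \<and> continuous_on S uxy \<and> continuous_on S uyx \<and> continuous_on S uyy \<and>
        (\<forall>z\<in>S. uxx z + uyy z = 0))"

text \<open>A function on the disk is represented by its extension by \<open>0\<close> to the plane. As harmonic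
  functions are continuous, equality in \<open>L2h\<close> is then equality of functions, and the definite
  description in \<open>proj_L2h\<close> below denotes a unique object.\<close>

definition L2h :: "(complex \<Rightarrow> complex) set" where
  "L2h = {u \<in> L2. harmonic_on u unit_disk \<and> (\<forall>z. z \<notin> unit_disk \<longrightarrow> u z = 0)}"

definition proj_L2h :: "(complex \<Rightarrow> complex) \<Rightarrow> (complex \<Rightarrow> complex)" where
  "proj_L2h f = (THE u. u \<in> L2h \<and> (\<forall>v\<in>L2h. L2_inner (\<lambda>z. f z - u z) v = 0))"

definition bounded_symbol :: "(complex \<Rightarrow> complex) \<Rightarrow> bool" where
  "bounded_symbol f \<longleftrightarrow> f \<in> borel_measurable dA \<and> bounded (f ` unit_disk)"

definition toeplitz :: "(complex \<Rightarrow> complex) \<Rightarrow> (complex \<Rightarrow> complex) \<Rightarrow> (complex \<Rightarrow> complex)" where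
  "toeplitz f u = proj_L2h (\<lambda>z. f z * u z)"

definition radial :: "(complex \<Rightarrow> complex) \<Rightarrow> bool" where
  "radial \<phi> \<longleftrightarrow> (\<forall>z\<in>unit_disk. \<forall>w\<in>unit_disk. cmod z = cmod w \<longrightarrow> \<phi> z = \<phi> w)"

text \<open>For radial \<open>\<phi>\<close> this is the function \<open>r e\<^sup>i\<^sup>\<theta> \<mapsto> e\<^sup>i\<^sup>p\<^sup>\<theta> \<phi>(r)\<close>; it does not depend
  on the branch of the argument because \<open>p\<close> is an integer.\<close>

definition quasihomogeneous :: "int \<Rightarrow> (complex \<Rightarrow> complex) \<Rightarrow> (complex \<Rightarrow> complex)" where
  "quasihomogeneous p \<phi> = (\<lambda>z. cis (of_int p * Arg z) * \<phi> z)"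

end

theory Submission
  imports Defs "HOL-Complex_Analysis.Complex_Analysis"
begin

text \<open>
  Let \<open>h\<^sub>n\<close> be \<open>z\<^sup>n\<close> for \<open>n \<ge> 0\<close> and \<open>cnj z\<^sup>-\<^sup>n\<close> for \<open>n < 0\<close>. These functions form an orthogonal
  basis of \<open>L\<^sup>2\<^sub>h\<close>, and \<open>T\<^sub>\<psi> h\<^sub>n = \<lambda>\<^sub>n h\<^sub>n\<close> with \<open>\<lambda>\<^sub>n = (\<bar>n\<bar> + 1) \<integral> \<psi> \<bar>z\<bar>\<^sup>2\<^sup>\<bar>\<^sup>n\<^sup>\<bar> dA\<close>. For every bounded \<open>f\<close> the
  matrix entries of \<open>T\<^sub>f\<close> at \<open>(n, n + p)\<close> and at \<open>(- n - p, - n)\<close> coincide, because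
  \<open>h\<^sub>n cnj h\<^sub>n\<^sub>+\<^sub>p = h\<^sub>-\<^sub>n\<^sub>-\<^sub>p cnj h\<^sub>-\<^sub>n\<close>. Comparing these two entries of the product with those of \<open>T\<^sub>g\<close>
  gives, with \<open>q = \<bar>p\<bar>\<close>,
  \<open>(\<integral> \<phi> \<bar>z\<bar>\<^sup>2\<^sup>k\<^sup>+\<^sup>q dA) (\<lambda>\<^sub>k - \<lambda>\<^sub>k\<^sub>+\<^sub>q) = 0\<close> for all \<open>k \<ge> 0\<close>.
  Both factors, suitably normalised, are Mellin transforms of bounded functionals on \<open>C[0,1]\<close>, and so
  is their product; by Weierstrass it vanishes for all complex exponents in the right half plane and
  not only for integers. As the factors are holomorphic there, one of them is identically zero. The
  first one cannot be, since \<open>\<phi> \<noteq> 0\<close>. Hence \<open>\<lambda>\<close> is constant along the positive multiples of \<open>q\<close>, so all moments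
  of \<open>\<psi> - c\<close> of orders \<open>2 q j\<close>, \<open>j > 0\<close>, vanish for a constant \<open>c\<close>, which forces \<open>\<psi> = c\<close>.
\<close>

text \<open>For a single \<open>k\<close> the identity only says that one of the two factors is
  zero, and neither has to vanish at all integers. Working with the product as one function, a
  multiplicative convolution, avoids having to decide which: the split into factors takes place on
  the half plane, where the identity theorem is available. The normalisation is a division of
  \<open>\<lambda>\<^sub>k - \<lambda>\<^sub>k\<^sub>+\<^sub>q\<close> by \<open>k + 1\<close>:
  multiplication by \<open>s + 1\<close> in general destroys boundedness of the functional, whereas
  \<open>1 / (s + 1)\<close> is itself the moment function of the symbol 1. A second obstacle is the
  operator \<open>Q\<close>. As \<open>proj_L2h\<close> is a definite description, nothing can be
  said about it before existence and uniqueness of the projection are known. Both rest on the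
  functions \<open>h\<^sub>n\<close>: the inner products of \<open>f\<close> with them give a
  candidate for \<open>Q f\<close>, and their totality in \<open>L2h\<close> gives uniqueness.
  Totality in turn needs the power series of a harmonic function to converge in norm and not only
  pointwise.\<close>

section \<open>The normalised area measure on the disk\<close>

text \<open>The library describes Lebesgue measure under linear maps only for \<open>real^'n\<close>, hence this detour.\<close>

definition complex_of_vec :: "real^2 \<Rightarrow> complex" where
  "complex_of_vec v = Complex (v $ 1) (v $ 2)"

definition vec_of_complex :: "complex \<Rightarrow> real^2" where
  "vec_of_complex z = vector [Re z, Im z]"

lemma complex_of_vec_inverse [simp]:
  "complex_of_vec (vec_of_complex z) = z" "vec_of_complex (complex_of_vec v) = v"
  by (simp_all add: complex_of_vec_def vec_of_complex_def complex_eq_iff vec_eq_iff forall_2)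

lemma linear_complex_of_vec: "linear complex_of_vec"
  by (rule linearI) (simp_all add: complex_of_vec_def complex_eq_iff)

lemma linear_vec_of_complex: "linear vec_of_complex"
  by (rule linearI) (simp_all add: vec_of_complex_def vec_eq_iff forall_2)

lemma norm_vec_of_complex [simp]: "norm (vec_of_complex z) = cmod z"
  by (simp add: vec_of_complex_def norm_vec_def L2_set_def sum_2 cmod_def)

lemma norm_complex_of_vec [simp]: "cmod (complex_of_vec v) = norm v"
  by (metis complex_of_vec_inverse(2) norm_vec_of_complex)

lemma measurable_complex_of_vec [measurable]: "complex_of_vec \<in> borel_measurable borel"
  by (intro borel_measurable_continuous_onI linear_continuous_on linear_conv_bounded_linear[THEN iffD1]
      linear_complex_of_vec)

text \<open>Lebesgue measure is determined by its values on boxes, and \<open>complex_of_vec\<close>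
  merely renames coordinates: it pulls a box back to a box with the same side lengths.\<close>

lemma lborel_complex_of_vec: "lborel = distr lborel borel complex_of_vec"
proof (rule lborel_eqI)
  fix l u :: complex
  assume le: "\<And>b. b \<in> Basis \<Longrightarrow> l \<bullet> b \<le> u \<bullet> b"
  have pre: "complex_of_vec -` box l u = box (vec_of_complex l) (vec_of_complex u)"
    by (auto simp: complex_of_vec_def vec_of_complex_def in_box_complex_iff mem_box_cart forall_2)
  have "emeasure (distr lborel borel complex_of_vec) (box l u)
      = emeasure lborel (box (vec_of_complex l) (vec_of_complex u))"
    by (subst emeasure_distr) (auto simp: pre)
  also have "\<dots> = (\<Prod>b\<in>Basis. (vec_of_complex u - vec_of_complex l) \<bullet> b)"
  proof (intro emeasure_lborel_box)
    fix b :: "real^2" assume "b \<in> Basis"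
    then obtain i where "b = axis i 1" by (auto simp: Basis_vec_def)
    then show "vec_of_complex l \<bullet> b \<le> vec_of_complex u \<bullet> b"
      using le[of 1] le[of \<i>] exhaust_2[of i]
      by (auto simp: inner_axis vec_of_complex_def Basis_complex_def)
  qed
  also have "(\<Prod>b\<in>Basis. (vec_of_complex u - vec_of_complex l) \<bullet> b) = (\<Prod>b\<in>Basis. (u - l) \<bullet> b)"
  proof -
    have "(\<Prod>b\<in>Basis. (vec_of_complex u - vec_of_complex l) \<bullet> b) =
      (\<Prod>i\<in>UNIV. (vec_of_complex u - vec_of_complex l) \<bullet> axis i 1)"
    proof -
      have B: "(Basis :: (real^2) set) = range (\<lambda>i. axis i 1)"
        by (auto simp: Basis_vec_def)
      have inj: "inj (\<lambda>i::2. axis i (1::real))"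
        by (auto simp: inj_on_def axis_eq_axis)
      show ?thesis unfolding B by (subst prod.reindex[OF inj]) simp
    qed
    also have "\<dots> = (Re u - Re l) * (Im u - Im l)"
      by (simp add: UNIV_2 inner_axis vec_of_complex_def)
    also have "\<dots> = (\<Prod>b\<in>Basis. (u - l) \<bullet> b)"
      by (simp add: Basis_complex_def)
    finally show ?thesis .
  qed
  finally show "emeasure (distr lborel borel complex_of_vec) (box l u) = ennreal (\<Prod>b\<in>Basis. (u - l) \<bullet> b)" .
qed simp

text \<open>In real coordinates multiplication by \<open>cnj w\<close> is an orthogonal map
  \<open>M\<close>, whose determinant has modulus 1. As \<open>cnj w\<close> is the inverse of
  \<open>w\<close>, the preimage of a box under the rotation by \<open>w\<close> is the image of
  that box under \<open>M\<close>.\<close>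

lemma lborel_rotation:
  assumes "cmod w = 1"
  shows "lborel = distr lborel borel ((*) w)"
proof (rule lborel_eqI)
  fix l u :: complex
  assume le: "\<And>b. b \<in> Basis \<Longrightarrow> l \<bullet> b \<le> u \<bullet> b"
  define M where "M = (\<lambda>v. vec_of_complex (cnj w * complex_of_vec v))"
  have ww: "cnj w * w = 1" using assms
    by (metis complex_norm_square mult.commute of_real_1 one_power2)
  have linM: "linear M"
    unfolding M_def using linear_compose[OF linear_compose[OF linear_complex_of_vec linear_times[of "cnj w"]] linear_vec_of_complex]
    by (simp add: o_def)
  have "orthogonal_transformation M"
    unfolding orthogonal_transformation using linM assms by (auto simp: M_def norm_mult)
  then have det: "\<bar>det (matrix M)\<bar> = 1"
    using det_orthogonal_matrix orthogonal_transformation_matrix by force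
  define S where "S = complex_of_vec -` box l u"
  have Sbox: "S = box (vec_of_complex l) (vec_of_complex u)"
    by (auto simp: S_def complex_of_vec_def vec_of_complex_def in_box_complex_iff mem_box_cart forall_2)
  have S: "S \<in> lmeasurable" unfolding Sbox by simp
  have [measurable]: "S \<in> sets borel" unfolding Sbox by simp
  have pre: "complex_of_vec -` ((*) w -` box l u) = M ` S"
  proof (intro set_eqI iffI)
    fix v assume "v \<in> complex_of_vec -` ((*) w -` box l u)"
    then have "w * complex_of_vec v \<in> box l u" by simp
    then have "vec_of_complex (w * complex_of_vec v) \<in> S" by (simp add: S_def)
    moreover have "M (vec_of_complex (w * complex_of_vec v)) = v"
      using ww by (simp add: M_def mult.assoc[symmetric])
    ultimately show "v \<in> M ` S" by force
  next
    fix v assume "v \<in> M ` S"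
    then obtain s where s: "s \<in> S" "v = M s" by auto
    then show "v \<in> complex_of_vec -` ((*) w -` box l u)"
      using ww by (simp add: M_def S_def mult.assoc[symmetric] mult.commute)
  qed
  have MSb: "M ` S \<in> sets borel"
    unfolding pre[symmetric] by (rule measurable_sets_borel[of _ borel, simplified]) 
      (auto intro!: measurable_sets_borel[of "(*) w" borel, simplified])
  have "emeasure (distr lborel borel ((*) w)) (box l u) = emeasure lborel ((*) w -` box l u)"
    by (subst emeasure_distr) auto
  also have "\<dots> = emeasure lborel (M ` S)"
    by (subst lborel_complex_of_vec, subst emeasure_distr) 
      (auto simp: pre intro!: measurable_sets_borel[of "(*) w" borel, simplified])
  also have "\<dots> = emeasure lebesgue (M ` S)" using MSb by simp
  also have "\<dots> = ennreal (measure lebesgue (M ` S))"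
    by (intro emeasure_eq_measure2 measurable_linear_image linM S)
  also have "\<dots> = ennreal (measure lebesgue S)"
    using measure_linear_image[OF linM S] det by simp
  also have "\<dots> = emeasure lebesgue S" by (intro emeasure_eq_measure2[symmetric] S)
  also have "\<dots> = emeasure lborel S" by simp
  also have "\<dots> = emeasure lborel (box l u)"
    by (subst lborel_complex_of_vec, subst emeasure_distr) (auto simp: S_def)
  also have "\<dots> = ennreal (\<Prod>b\<in>Basis. (u - l) \<bullet> b)"
    using le by (rule emeasure_lborel_box)
  finally show "emeasure (distr lborel borel ((*) w)) (box l u) = ennreal (\<Prod>b\<in>Basis. (u - l) \<bullet> b)" .
qed simp

text \<open>For a map into a completion, measurability also requires preimages of null sets to be
  null; the invariance of \<open>lborel\<close> gives this.\<close>

lemma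
  assumes w: "cmod w = 1"
  shows measurable_lebesgue_rotation: "(*) w \<in> lebesgue \<rightarrow>\<^sub>M lebesgue"
    and lebesgue_rotation: "lebesgue = distr lebesgue lebesgue ((*) w)"
proof -
  have m: "(*) w \<in> lebesgue \<rightarrow>\<^sub>M lborel" by (intro measurable_completion) simp
  have d: "distr lebesgue lborel ((*) w) = lborel"
    using lborel_rotation[OF w] by (simp add: distr_completion cong: distr_cong)
  show "(*) w \<in> lebesgue \<rightarrow>\<^sub>M lebesgue"
    by (rule completion.measurable_completion2[OF m]) (simp add: d)
  show "lebesgue = distr lebesgue lebesgue ((*) w)"
    using completion.completion_distr_eq[OF m] d by simp
qed

lemma disk_sets [simp, measurable]: "unit_disk \<in> sets lebesgue"
  by (simp add: unit_disk_def)

lemma in_disk_iff: "z \<in> unit_disk \<longleftrightarrow> cmod z < 1"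
  by (simp add: unit_disk_def)

lemma space_dA [simp]: "space dA = unit_disk"
  by (simp add: dA_def space_scale_measure)

lemma sets_dA: "sets dA = sets (lebesgue_on unit_disk)"
  by (simp add: dA_def)

lemma borel_measurable_dA_iff:
  "f \<in> measurable dA N \<longleftrightarrow> f \<in> measurable (lebesgue_on unit_disk) N"
  by (simp add: measurable_def sets_dA)

lemma emeasure_dA:
  assumes "A \<subseteq> unit_disk" "A \<in> sets lebesgue"
  shows "emeasure dA A = ennreal (1 / pi) * emeasure lebesgue A"
  using assms by (simp add: dA_def emeasure_restrict_space)

lemma sets_dA_iff: "A \<in> sets dA \<longleftrightarrow> A \<subseteq> unit_disk \<and> A \<in> sets lebesgue"
  by (auto simp: sets_dA sets_restrict_space_iff)

lemma emeasure_dA_disk_radius: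
  assumes "0 \<le> r" "r \<le> 1"
  shows "emeasure dA (ball 0 r) = ennreal (r\<^sup>2)"
proof -
  have "emeasure dA (ball 0 r) = ennreal (1 / pi) * ennreal (pi * r\<^sup>2)"
    using assms by (subst emeasure_dA)
      (auto simp: unit_disk_def emeasure_ball unit_ball_vol_2 )
  also have "\<dots> = ennreal (r\<^sup>2)"
    by (subst ennreal_mult[symmetric]) auto
  finally show ?thesis .
qed

lemma cball_subset_disk:
  assumes "x < 1"
  shows "cball (0::complex) (sqrt x) \<subseteq> unit_disk"
proof
  fix z :: complex assume "z \<in> cball 0 (sqrt x)"
  then have "cmod z \<le> sqrt x" by simp
  also have "\<dots> < 1" using assms by simp
  finally show "z \<in> unit_disk" by (simp add: in_disk_iff)
qed

lemma emeasure_dA_disk_cball: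
  assumes "0 \<le> x" "x < 1"
  shows "emeasure dA (cball 0 (sqrt x)) = ennreal x"
proof -
  have "emeasure dA (cball 0 (sqrt x)) = ennreal (1 / pi) * ennreal (pi * x)"
    using assms by (subst emeasure_dA)
      (simp_all add: cball_subset_disk emeasure_cball unit_ball_vol_2)
  also have "\<dots> = ennreal x"
    using assms by (subst ennreal_mult[symmetric]) auto
  finally show ?thesis .
qed

lemma emeasure_dA_disk [simp]: "emeasure dA unit_disk = 1"
  using emeasure_dA_disk_radius[of 1] by (simp add: unit_disk_def)

interpretation dA: finite_measure dA
  by (rule finite_measureI) simp

lemma measure_dA_disk [simp]: "measure dA unit_disk = 1"
  by (simp add: measure_def)

lemma continuous_measurable_dA:
  fixes f :: "complex \<Rightarrow> 'a::euclidean_space"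
  assumes "continuous_on unit_disk f"
  shows "f \<in> borel_measurable dA"
  unfolding borel_measurable_dA_iff
  by (rule continuous_imp_measurable_on_sets_lebesgue[OF assms]) simp

lemma borel_imp_measurable_dA:
  assumes "f \<in> borel_measurable borel"
  shows "f \<in> borel_measurable dA"
  unfolding borel_measurable_dA_iff
  by (rule measurable_restrict_space1, rule measurable_completion) (use assms in simp)

lemma measurable_dA_norm [measurable]: "cmod \<in> borel_measurable dA"
  by (rule borel_imp_measurable_dA) measurable

lemma AE_dA_nonzero: "AE z in dA. z \<noteq> 0"
proof (rule AE_I)
  show "emeasure dA {0} = 0" by (subst emeasure_dA) (auto simp: in_disk_iff)
  show "{0} \<in> sets dA" by (auto simp: sets_dA_iff in_disk_iff)
qed auto

lemma measurable_dA_rotation: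
  assumes w: "cmod w = 1"
  shows "(*) w \<in> measurable dA dA"
proof (rule measurableI)
  fix A assume "A \<in> sets dA"
  then have A: "A \<subseteq> unit_disk" "A \<in> sets lebesgue" by (auto simp: sets_dA_iff)
  have "(*) w -` A \<in> sets lebesgue"
    using measurable_sets[OF measurable_lebesgue_rotation[OF w] A(2)] by simp
  then show "(*) w -` A \<inter> space dA \<in> sets dA"
    by (auto simp: sets_dA_iff)
qed (use w in \<open>auto simp: in_disk_iff norm_mult\<close>)

lemma distr_dA_rotation:
  assumes w: "cmod w = 1"
  shows "distr dA dA ((*) w) = dA"
proof (rule measure_eqI)
  fix A assume "A \<in> sets (distr dA dA ((*) w))"
  then have A: "A \<subseteq> unit_disk" "A \<in> sets lebesgue" and A': "A \<in> sets dA" by (auto simp: sets_dA_iff)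
  have sub: "(*) w -` A \<subseteq> unit_disk" using A w by (force simp: in_disk_iff norm_mult)
  have m: "(*) w -` A \<in> sets lebesgue"
    using measurable_sets[OF measurable_lebesgue_rotation[OF w] A(2)] by simp
  have "emeasure (distr dA dA ((*) w)) A = emeasure dA ((*) w -` A)"
    using sub by (subst emeasure_distr[OF measurable_dA_rotation[OF w] A']) (simp add: Int_absorb2)
  also have "\<dots> = ennreal (1 / pi) * emeasure lebesgue ((*) w -` A)"
    by (rule emeasure_dA[OF sub m])
  also have "emeasure lebesgue ((*) w -` A) = emeasure (distr lebesgue lebesgue ((*) w)) A"
    using A by (subst emeasure_distr[OF measurable_lebesgue_rotation[OF w]]) auto
  also have "\<dots> = emeasure lebesgue A" using lebesgue_rotation[OF w] by simp
  also have "ennreal (1 / pi) * emeasure lebesgue A = emeasure dA A"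
    by (rule emeasure_dA[OF A, symmetric])
  finally show "emeasure (distr dA dA ((*) w)) A = emeasure dA A" .
qed simp

lemma integral_dA_rotation:
  fixes f :: "complex \<Rightarrow> complex"
  assumes "cmod w = 1" "f \<in> borel_measurable dA"
  shows "(LINT z|dA. f (w * z)) = (LINT z|dA. f z)"
  using integral_distr[OF measurable_dA_rotation[OF assms(1)] assms(2)]
  by (simp add: distr_dA_rotation[OF assms(1)])

text \<open>A single rotation suffices: for \<open>w = cis (pi / k)\<close> the factor
  \<open>w powi k\<close> is -1, so the integral equals its own negative. The orthogonality of
  different frequencies comes from here, without polar coordinates.\<close>

lemma integral_dA_eq_0_rotation:
  fixes f :: "complex \<Rightarrow> complex"
  assumes f: "f \<in> borel_measurable dA" and k: "k \<noteq> (0::int)"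
    and rot: "\<And>w z. cmod w = 1 \<Longrightarrow> z \<in> unit_disk \<Longrightarrow> f (w * z) = w powi k * f z"
  shows "(LINT z|dA. f z) = 0"
proof -
  define w where "w = cis (pi / of_int k)"
  have nw: "cmod w = 1" by (simp add: w_def)
  have wk: "w powi k = -1"
    using k by (simp add: w_def cis_power_int)
  have "(LINT z|dA. f z) = (LINT z|dA. f (w * z))"
    by (rule integral_dA_rotation[symmetric]) (simp_all add: f w_def)
  also have "\<dots> = (LINT z|dA. - f z)"
    by (rule Bochner_Integration.integral_cong) (simp_all add: rot[of w] wk nw)
  finally show ?thesis by simp
qed

text \<open>The disk of radius \<open>sqrt x\<close> has normalised area \<open>x\<close>, so
  \<open>|z|^2\<close> is uniformly distributed on [0,1]; it is enough to compare the tails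
  \<open>{x<..}\<close>.\<close>

lemma distr_dA_norm_square:
  "distr dA borel (\<lambda>z. (cmod z)\<^sup>2) = density lborel (indicator {0..1})" (is "?M = ?N")
proof (rule measure_eqI_lessThan)
  have eq: "emeasure ?M {x<..} = emeasure ?N {x<..}" for x :: real
  proof -
    have N: "emeasure ?N {x<..} = emeasure lborel ({0..1} \<inter> {x<..})"
      by (simp add: emeasure_density indicator_inter_arith[symmetric])
    have M: "emeasure ?M {x<..} = emeasure dA {z \<in> unit_disk. x < (cmod z)\<^sup>2}"
      by (subst emeasure_distr) (auto simp: vimage_def Int_def conj_commute intro!: arg_cong[where f="emeasure dA"])
    consider "x < 0" | "0 \<le> x" "x < 1" | "1 \<le> x" by linarith
    then show ?thesis
    proof cases
      case 1
      then have "{z \<in> unit_disk. x < (cmod z)\<^sup>2} = unit_disk" "{0..1} \<inter> {x<..} = {0..1}"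
        by (auto intro: less_le_trans[OF 1])
      then show ?thesis by (simp add: N M)
    next
      case 2
      have *: "x < (cmod z)\<^sup>2 \<longleftrightarrow> sqrt x < cmod z" for z
        using real_sqrt_less_iff[of x "(cmod z)\<^sup>2"] by (simp del: real_sqrt_less_iff)
      have "{z \<in> unit_disk. x < (cmod z)\<^sup>2} = unit_disk - cball 0 (sqrt x)"
        unfolding * by auto
      moreover have "emeasure dA (cball 0 (sqrt x)) = ennreal x"
        using 2 by (intro emeasure_dA_disk_cball) auto
      moreover have "cball 0 (sqrt x) \<subseteq> unit_disk"
        using 2 by (simp add: cball_subset_disk)
      moreover have "{0..1} \<inter> {x<..} = {x<..1}" using 2 by auto
      ultimately show ?thesis
        using 2 by (simp add: N M emeasure_Diff sets_dA_iff ennreal_minus flip: ennreal_1)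
    next
      case 3
      have "(cmod z)\<^sup>2 \<le> x" if "z \<in> unit_disk" for z
        using 3 that power_le_one[of "cmod z" 2] by (simp add: in_disk_iff)
      then have "{z \<in> unit_disk. x < (cmod z)\<^sup>2} = {}" "{0..1} \<inter> {x<..} = {}"
        using 3 by fastforce+
      then show ?thesis unfolding N M by (simp only: emeasure_empty)
    qed
  qed
  show "emeasure ?M {x<..} = emeasure ?N {x<..}" for x by (rule eq)
  show "emeasure ?M {x<..} < \<infinity>" for x
    by (simp add: emeasure_distr less_top[symmetric])
qed auto

lemma integral_norm_power: "(LINT z|dA. (cmod z) ^ (2 * n)) = 1 / (real n + 1)"
proof -
  have "(LINT z|dA. (cmod z) ^ (2 * n)) = (LINT t|distr dA borel (\<lambda>z. (cmod z)\<^sup>2). t ^ n)"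
    by (subst integral_distr) (auto simp: power_mult)
  also have "\<dots> = (LINT t|lborel. indicator {0..1} t *\<^sub>R t ^ n)"
  proof -
    have "density lborel (indicator {0..1}) = density lborel (\<lambda>t::real. ennreal (indicat_real {0..1} t))"
      by (rule density_cong) (auto intro!: borel_measurable_indicator split: split_indicator)
    then show ?thesis
      unfolding distr_dA_norm_square by (simp add: integral_density)
  qed
  also have "\<dots> = 1 / (real n + 1)"
    using integral_power[of 0 1 n] by (simp add: mult.commute)
  finally show ?thesis .
qed

section \<open>Orthogonality of the harmonic monomials\<close>

definition hmono :: "int \<Rightarrow> complex \<Rightarrow> complex" where
  "hmono n z = (if n \<ge> 0 then z ^ nat n else cnj z ^ nat (- n))"

text \<open>The reciprocal of the squared \<open>L2\<close> norm of \<open>hmono n\<close>, hence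
  the factor between an inner product with \<open>hmono n\<close> and the corresponding
  coefficient.\<close>

definition hweight :: "int \<Rightarrow> real" where
  "hweight n = real_of_int \<bar>n\<bar> + 1"

lemma hweight_pos [simp]: "hweight n > 0" "hweight n \<noteq> 0" "hweight n \<ge> 0" "hweight (- n) = hweight n"
  by (simp_all add: hweight_def add_nonneg_eq_0_iff)

text \<open>The index set is left free because differences of symmetric partial sums occur as well
  as the sums themselves.\<close>

definition hpartial :: "(int \<Rightarrow> complex) \<Rightarrow> int set \<Rightarrow> complex \<Rightarrow> complex" where
  "hpartial c I z = (\<Sum>n\<in>I. c n * hmono n z)"

lemma norm_hmono: "cmod (hmono n z) = cmod z ^ nat \<bar>n\<bar>"
  by (simp add: hmono_def norm_power)

lemma norm_hmono_le: "z \<in> unit_disk \<Longrightarrow> cmod (hmono n z) \<le> 1"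
  by (simp add: norm_hmono in_disk_iff power_le_one)

lemma cnj_hmono: "cnj (hmono n z) = hmono (- n) z"
  by (auto simp: hmono_def)

lemma hmono_mult_cnj: "hmono n z * cnj (hmono n z) = of_real (cmod z ^ (2 * nat \<bar>n\<bar>))"
  by (metis complex_norm_square norm_hmono power_even_eq)

lemma hmono_rotate:
  assumes "cmod w = 1"
  shows "hmono n (w * z) = w powi n * hmono n z"
proof -
  have "cnj w = inverse w"
    using assms by (metis complex_norm_square inverse_unique of_real_1 one_power2)
  then show ?thesis
    by (auto simp: hmono_def power_int_def power_mult_distrib)
qed

lemma continuous_on_hmono [continuous_intros]: "continuous_on S (hmono n)"
  unfolding hmono_def by (cases "n \<ge> 0") (auto intro!: continuous_intros)

lemma measurable_hmono [measurable]: "hmono n \<in> borel_measurable dA"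
  by (rule continuous_measurable_dA) (rule continuous_on_hmono)

lemma measurable_hpartial [measurable]: "hpartial c I \<in> borel_measurable dA"
  unfolding hpartial_def by measurable

section \<open>Square-integrable functions on the disk\<close>

lemma integrable_dA_bounded:
  fixes f :: "complex \<Rightarrow> 'a::{banach, second_countable_topology}"
  assumes "f \<in> borel_measurable dA" "\<And>z. z \<in> unit_disk \<Longrightarrow> norm (f z) \<le> C"
  shows "integrable dA f"
  by (rule dA.integrable_const_bound[of _ C]) (use assms in auto)

lemma L2_measurable: "f \<in> L2 \<Longrightarrow> f \<in> borel_measurable dA"
  by (simp add: L2_def)

lemma L2_integrable_square: "f \<in> L2 \<Longrightarrow> integrable dA (\<lambda>z. (cmod (f z))\<^sup>2)"
  by (simp add: L2_def)

lemma L2_bounded: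
  assumes m: "f \<in> borel_measurable dA" and b: "\<And>z. z \<in> unit_disk \<Longrightarrow> cmod (f z) \<le> C"
  shows "f \<in> L2"
proof -
  have "integrable dA (\<lambda>z. (cmod (f z))\<^sup>2)"
    by (rule integrable_dA_bounded[of _ "C\<^sup>2"]) (use m b in \<open>auto intro!: power_mono\<close>)
  with m show ?thesis by (simp add: L2_def)
qed

lemma L2_hmono: "hmono n \<in> L2"
  by (rule L2_bounded[of _ 1]) (auto simp: norm_hmono_le)

lemma cmod_prod_le: "cmod (a * cnj b) \<le> (cmod a)\<^sup>2 + (cmod b)\<^sup>2"
proof -
  have "0 \<le> (cmod a - cmod b)\<^sup>2" by simp
  then have "2 * (cmod a * cmod b) \<le> (cmod a)\<^sup>2 + (cmod b)\<^sup>2"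
    by (simp add: power2_eq_square algebra_simps)
  moreover have "0 \<le> cmod a * cmod b" by simp
  ultimately show ?thesis unfolding norm_mult complex_mod_cnj by linarith
qed

lemma measurable_mult_cnj:
  assumes "f \<in> borel_measurable M" "g \<in> borel_measurable M"
  shows "(\<lambda>z. f z * cnj (g z)) \<in> borel_measurable M"
  using assms by (intro borel_measurable_times measurable_compose[OF assms(2), of cnj borel]
      borel_measurable_continuous_onI continuous_intros)

lemma L2_mult_integrable:
  assumes "f \<in> L2" "g \<in> L2"
  shows "integrable dA (\<lambda>z. f z * cnj (g z))"
proof (rule Bochner_Integration.integrable_bound)
  show "integrable dA (\<lambda>z. (cmod (f z))\<^sup>2 + (cmod (g z))\<^sup>2)"
    by (intro Bochner_Integration.integrable_add L2_integrable_square assms)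
  show "(\<lambda>z. f z * cnj (g z)) \<in> borel_measurable dA"
    by (intro measurable_mult_cnj L2_measurable assms)
  show "AE z in dA. cmod (f z * cnj (g z)) \<le> norm ((cmod (f z))\<^sup>2 + (cmod (g z))\<^sup>2)"
    using cmod_prod_le by (intro AE_I2) (simp add: order_trans[OF _ abs_ge_self])
qed

lemma L2_integrable:
  assumes "f \<in> L2" shows "integrable dA f"
  using L2_mult_integrable[OF assms L2_hmono[of 0]] by (simp add: hmono_def)

lemma L2_add:
  assumes "f \<in> L2" "g \<in> L2"
  shows "(\<lambda>z. f z + g z) \<in> L2"
proof -
  have m: "(\<lambda>z. f z + g z) \<in> borel_measurable dA"
    using L2_measurable[OF assms(1)] L2_measurable[OF assms(2)] by measurable
  have "integrable dA (\<lambda>z. (cmod (f z + g z))\<^sup>2)"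
  proof (rule Bochner_Integration.integrable_bound)
    show "integrable dA (\<lambda>z. 2 * (cmod (f z))\<^sup>2 + 2 * (cmod (g z))\<^sup>2)"
      by (intro Bochner_Integration.integrable_add integrable_mult_right L2_integrable_square assms)
    show "(\<lambda>z. (cmod (f z + g z))\<^sup>2) \<in> borel_measurable dA" using m by measurable
    have "(cmod (a + b))\<^sup>2 \<le> 2 * (cmod a)\<^sup>2 + 2 * (cmod b)\<^sup>2" for a b
    proof -
      have "(cmod (a + b))\<^sup>2 \<le> (cmod a + cmod b)\<^sup>2" by (intro power_mono norm_triangle_ineq) simp
      moreover have "0 \<le> (cmod a - cmod b)\<^sup>2" by simp
      ultimately show ?thesis by (simp add: power2_eq_square algebra_simps)
    qed
    then show "AE z in dA. norm ((cmod (f z + g z))\<^sup>2) \<le> norm (2 * (cmod (f z))\<^sup>2 + 2 * (cmod (g z))\<^sup>2)"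
      by (intro AE_I2) simp
  qed
  with m show ?thesis by (simp add: L2_def)
qed

lemma L2_cmult:
  assumes "f \<in> L2" shows "(\<lambda>z. c * f z) \<in> L2"
  using assms by (auto simp: L2_def norm_mult power_mult_distrib)

lemma L2_diff:
  assumes "f \<in> L2" "g \<in> L2" shows "(\<lambda>z. f z - g z) \<in> L2"
  using L2_add[OF assms(1) L2_cmult[OF assms(2), of "-1"]] by simp

lemma L2_bounded_mult:
  assumes "bounded_symbol f" "u \<in> L2" shows "(\<lambda>z. f z * u z) \<in> L2"
proof -
  obtain C where C: "\<And>z. z \<in> unit_disk \<Longrightarrow> cmod (f z) \<le> C"
    using assms(1) by (auto simp: bounded_symbol_def bounded_iff)
  have m: "(\<lambda>z. f z * u z) \<in> borel_measurable dA"
    using assms(1) L2_measurable[OF assms(2)]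
    by (intro borel_measurable_times) (auto simp: bounded_symbol_def)
  have "integrable dA (\<lambda>z. (cmod (f z * u z))\<^sup>2)"
  proof (rule Bochner_Integration.integrable_bound)
    show "integrable dA (\<lambda>z. C\<^sup>2 * (cmod (u z))\<^sup>2)"
      by (intro integrable_mult_right L2_integrable_square assms)
    show "(\<lambda>z. (cmod (f z * u z))\<^sup>2) \<in> borel_measurable dA" using m by measurable
    show "AE z in dA. norm ((cmod (f z * u z))\<^sup>2) \<le> norm (C\<^sup>2 * (cmod (u z))\<^sup>2)"
      using C by (intro AE_I2) (auto simp: norm_mult power_mult_distrib intro!: mult_right_mono power_mono)
  qed
  with m show ?thesis by (simp add: L2_def)
qed

lemma L2_hpartial: "finite I \<Longrightarrow> hpartial c I \<in> L2"
proof (induction I rule: finite_induct)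
  case empty
  show ?case unfolding hpartial_def by (rule L2_bounded[of _ 0]) auto
next
  case (insert n I)
  have "hpartial c (insert n I) = (\<lambda>z. c n * hmono n z + hpartial c I z)"
    using insert by (auto simp: hpartial_def)
  then show ?case using L2_add[OF L2_cmult[OF L2_hmono] insert.IH] by metis
qed

lemma L2_inner_diff:
  assumes "f \<in> L2" "g \<in> L2" "h \<in> L2"
  shows "L2_inner (\<lambda>z. f z - g z) h = L2_inner f h - L2_inner g h"
  unfolding L2_inner_def using assms by (simp add: L2_mult_integrable algebra_simps)

lemma L2_inner_diff_right:
  assumes "f \<in> L2" "g \<in> L2" "h \<in> L2"
  shows "L2_inner h (\<lambda>z. f z - g z) = L2_inner h f - L2_inner h g"
  unfolding L2_inner_def using assms by (simp add: L2_mult_integrable algebra_simps)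

lemma L2_inner_cmult: "L2_inner (\<lambda>z. c * f z) h = c * L2_inner f h"
  unfolding L2_inner_def by (simp add: mult.assoc)

lemma L2_inner_self: "L2_inner f f = of_real (LINT z|dA. (cmod (f z))\<^sup>2)"
  unfolding L2_inner_def by (simp flip: complex_norm_square integral_complex_of_real)

lemma L2_inner_cnj: "L2_inner g f = cnj (L2_inner f g)"
proof -
  have "cnj (L2_inner f g) = (LINT z|dA. cnj (f z * cnj (g z)))"
    unfolding L2_inner_def by (rule Bochner_Integration.integral_cnj[symmetric])
  then show ?thesis by (simp add: L2_inner_def mult.commute)
qed

lemma L2_inner_cong:
  assumes "\<And>z. z \<in> unit_disk \<Longrightarrow> f z * cnj (g z) = f' z * cnj (g' z)"
  shows "L2_inner f g = L2_inner f' g'"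
  unfolding L2_inner_def by (rule Bochner_Integration.integral_cong) (use assms in auto)

lemma L2_inner_hmono:
  "L2_inner (hmono n) (hmono m) = (if n = m then 1 / of_real (hweight n) else 0)"
proof (cases "n = m")
  case True
  have "L2_inner (hmono n) (hmono n) = of_real (LINT z|dA. cmod z ^ (2 * nat \<bar>n\<bar>))"
    unfolding L2_inner_def hmono_mult_cnj by (rule integral_complex_of_real)
  also have "\<dots> = of_real (1 / (real (nat \<bar>n\<bar>) + 1))"
    by (simp only: integral_norm_power)
  also have "\<dots> = 1 / of_real (hweight n)" by (simp add: hweight_def)
  finally show ?thesis using True by simp
next
  case False
  have "(LINT z|dA. hmono n z * cnj (hmono m z)) = 0"
  proof (rule integral_dA_eq_0_rotation[of _ "n - m"])
    show "(\<lambda>z. hmono n z * cnj (hmono m z)) \<in> borel_measurable dA"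
      by (intro measurable_mult_cnj measurable_hmono)
    show "hmono n (w * z) * cnj (hmono m (w * z)) = w powi (n - m) * (hmono n z * cnj (hmono m z))"
      if "cmod w = 1" for w z
    proof -
      have "w \<noteq> 0" using that by auto
      then have "w powi (n - m) = w powi n * w powi (- m)"
        using power_int_add[of w n "- m"] by simp
      then show ?thesis
        unfolding cnj_hmono by (simp only: hmono_rotate[OF that] mult_ac)
    qed
  qed (use False in simp)
  with False show ?thesis by (simp add: L2_inner_def)
qed

lemma L2_inner_hpartial:
  assumes "f \<in> L2" "finite I"
  shows "L2_inner f (hpartial c I) = (\<Sum>n\<in>I. cnj (c n) * L2_inner f (hmono n))"
proof -
  have "L2_inner f (hpartial c I) = (LINT z|dA. (\<Sum>n\<in>I. cnj (c n) * (f z * cnj (hmono n z))))"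
    unfolding L2_inner_def hpartial_def
    by (rule arg_cong[where f="integral\<^sup>L dA"]) (auto simp: sum_distrib_left mult_ac)
  also have "\<dots> = (\<Sum>n\<in>I. cnj (c n) * L2_inner f (hmono n))"
    unfolding L2_inner_def
    by (subst Bochner_Integration.integral_sum) (auto intro!: L2_mult_integrable assms L2_hmono)
  finally show ?thesis .
qed

lemma L2_inner_hpartial_hmono:
  assumes "finite I"
  shows "L2_inner (hpartial c I) (hmono m) = (if m \<in> I then c m / of_real (hweight m) else 0)"
proof -
  have "L2_inner (hpartial c I) (hmono m) = cnj (\<Sum>n\<in>I. cnj (c n) * L2_inner (hmono m) (hmono n))"
    by (subst L2_inner_cnj) (simp add: L2_inner_hpartial L2_hmono assms)
  also have "\<dots> = (\<Sum>n\<in>I. if n = m then c m / of_real (hweight m) else 0)"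
    unfolding cnj_sum by (rule sum.cong) (auto simp: L2_inner_hmono)
  also have "\<dots> = (if m \<in> I then c m / of_real (hweight m) else 0)"
    using assms by simp
  finally show ?thesis .
qed

lemma mult_cnj_eq: "z * cnj z = (complex_of_real (cmod z))\<^sup>2"
  by (metis complex_norm_square of_real_power)

lemma norm_hpartial:
  assumes "finite I"
  shows "(LINT z|dA. (cmod (hpartial c I z))\<^sup>2) = (\<Sum>n\<in>I. (cmod (c n))\<^sup>2 / hweight n)"
proof -
  have "complex_of_real (LINT z|dA. (cmod (hpartial c I z))\<^sup>2) = L2_inner (hpartial c I) (hpartial c I)"
    by (simp add: L2_inner_self)
  also have "\<dots> = (\<Sum>n\<in>I. cnj (c n) * (c n / of_real (hweight n)))"
    using assms by (simp add: L2_inner_hpartial L2_hpartial L2_inner_hpartial_hmono)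
  also have "\<dots> = of_real (\<Sum>n\<in>I. (cmod (c n))\<^sup>2 / hweight n)"
    by (simp add: mult_cnj_eq mult.commute[of "cnj _"])
  finally show ?thesis by (simp only: of_real_eq_iff)
qed

text \<open>With this normalisation of \<open>c\<close> the inner products of \<open>f\<close> with
  \<open>?S\<close>, of \<open>?S\<close> with \<open>f\<close> and of \<open>?S\<close> with itself
  all equal \<open>?s\<close>, so the squared norm of \<open>f - ?S\<close> is that of
  \<open>f\<close> minus \<open>?s\<close>.\<close>

lemma Bessel_hmono:
  assumes f: "f \<in> L2" and I: "finite I"
    and c: "\<And>n. n \<in> I \<Longrightarrow> L2_inner f (hmono n) = c n / of_real (hweight n)"
  shows "(\<Sum>n\<in>I. (cmod (c n))\<^sup>2 / hweight n) \<le> (LINT z|dA. (cmod (f z))\<^sup>2)"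
proof -
  let ?S = "hpartial c I" and ?s = "\<Sum>n\<in>I. (cmod (c n))\<^sup>2 / hweight n"
  have S: "?S \<in> L2" by (rule L2_hpartial[OF I])
  have fS: "L2_inner f ?S = of_real ?s"
    using I f by (simp add: L2_inner_hpartial c mult_cnj_eq mult.commute[of "cnj _"])
  have Sf: "L2_inner ?S f = of_real ?s"
    by (subst L2_inner_cnj) (simp add: fS)
  have SS: "L2_inner ?S ?S = of_real ?s"
    unfolding L2_inner_self norm_hpartial[OF I] ..
  have d: "(\<lambda>z. f z - ?S z) \<in> L2" by (rule L2_diff[OF f S])
  have "complex_of_real (LINT z|dA. (cmod (f z - ?S z))\<^sup>2) = L2_inner (\<lambda>z. f z - ?S z) (\<lambda>z. f z - ?S z)"
    by (simp add: L2_inner_self)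
  also have "\<dots> = L2_inner f f - of_real ?s"
    using f S d by (simp only: L2_inner_diff L2_inner_diff_right fS Sf SS) simp
  also have "\<dots> = of_real ((LINT z|dA. (cmod (f z))\<^sup>2) - ?s)"
    by (simp add: L2_inner_self)
  finally have "(LINT z|dA. (cmod (f z - ?S z))\<^sup>2) = (LINT z|dA. (cmod (f z))\<^sup>2) - ?s"
    by (simp only: of_real_eq_iff)
  moreover have "0 \<le> (LINT z|dA. (cmod (f z - ?S z))\<^sup>2)" by (rule integral_nonneg_AE) simp
  ultimately show ?thesis by linarith
qed

text \<open>A weak form of Cauchy-Schwarz, with \<open>A + 1\<close> in place of
  \<open>sqrt A\<close>. It serves for fixed \<open>f\<close>: the bound tends to 0 with the norm of
  \<open>g\<close>.\<close>

lemma L2_inner_bound: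
  assumes f: "f \<in> L2" and g: "g \<in> L2"
  shows "cmod (L2_inner f g) \<le> ((LINT z|dA. (cmod (f z))\<^sup>2) + 1) * sqrt (LINT z|dA. (cmod (g z))\<^sup>2)"
proof -
  define A where "A = (LINT z|dA. (cmod (f z))\<^sup>2)"
  define B where "B = (LINT z|dA. (cmod (g z))\<^sup>2)"
  have B0: "0 \<le> B" unfolding B_def by (rule integral_nonneg_AE) simp
  show ?thesis
  proof (cases "B = 0")
    case True
    have "AE z in dA. (cmod (g z))\<^sup>2 = 0"
      using integral_nonneg_eq_0_iff_AE[OF L2_integrable_square[OF g]] True by (simp add: B_def)
    then have "L2_inner f g = (LINT z|dA. 0)"
      unfolding L2_inner_def
      using L2_measurable[OF f] L2_measurable[OF g]
      by (intro integral_cong_AE measurable_mult_cnj) auto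
    then show ?thesis using True by (simp add: B_def)
  next
    case False
    then have t: "sqrt B > 0" using B0 by simp
    \<comment> \<open>The weights \<open>sqrt B\<close> and \<open>1 / sqrt B\<close> make both
      terms multiples of \<open>sqrt B\<close> after integration. They arise as squares of scaling
      factors, hence the fourth root \<open>r\<close> of \<open>B\<close>.\<close>
    have pw: "cmod (x * cnj y) \<le> sqrt B * (cmod x)\<^sup>2 + (cmod y)\<^sup>2 / sqrt B" for x y
    proof -
      define r where "r = sqrt (sqrt B)"
      have r: "r > 0" "r\<^sup>2 = sqrt B" using t B0 by (simp_all add: r_def)
      have "cmod ((of_real r * x) * cnj (y / of_real r)) \<le> (cmod (of_real r * x))\<^sup>2 + (cmod (y / of_real r))\<^sup>2"
        by (rule cmod_prod_le)
      then show ?thesis using r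
        by (simp add: norm_mult norm_divide power_mult_distrib power_divide)
    qed
    have "cmod (L2_inner f g) \<le> (LINT z|dA. cmod (f z * cnj (g z)))"
      unfolding L2_inner_def by (rule integral_norm_bound)
    also have "\<dots> \<le> (LINT z|dA. sqrt B * (cmod (f z))\<^sup>2 + (cmod (g z))\<^sup>2 / sqrt B)"
      by (intro integral_mono integrable_norm L2_mult_integrable f g pw
          Bochner_Integration.integrable_add integrable_mult_right integrable_divide L2_integrable_square)
    also have "\<dots> = sqrt B * A + B / sqrt B"
      unfolding A_def B_def
      by (subst Bochner_Integration.integral_add)
         (auto intro!: integrable_mult_right integrable_divide L2_integrable_square f g)
    also have "\<dots> = (A + 1) * sqrt B"
      using B0 by (simp add: real_div_sqrt algebra_simps)
    finally show ?thesis by (simp add: A_def B_def)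
  qed
qed

text \<open>Fatou's lemma in place of completeness: for \<open>M \<ge> N\<close> the squared
  distance of two partial sums is \<open>s M - s N \<le> L - s N\<close>. Letting \<open>M\<close>
  tend to infinity under the integral bounds the squared distance of \<open>w\<close> from the
  \<open>N\<close>-th sum by \<open>L - s N\<close>, which tends to 0.\<close>

lemma hpartial_limit_L2:
  assumes bound: "\<And>N. (\<Sum>n\<in>{- int N..int N}. (cmod (c n))\<^sup>2 / hweight n) \<le> B"
    and lim: "\<And>z. z \<in> unit_disk \<Longrightarrow> (\<lambda>N. hpartial c {- int N..int N} z) \<longlonglongrightarrow> w z"
  shows "w \<in> L2"
    and "(\<lambda>N. LINT z|dA. (cmod (w z - hpartial c {- int N..int N} z))\<^sup>2) \<longlonglongrightarrow> 0"
proof -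
  let ?J = "\<lambda>N. {- int N..int N}"
  define s where "s = (\<lambda>N. \<Sum>n\<in>?J N. (cmod (c n))\<^sup>2 / hweight n)"
  have mono: "s M \<le> s N" if "M \<le> N" for M N
    unfolding s_def using that by (intro sum_mono2) auto
  obtain L where L: "s \<longlonglongrightarrow> L" and sL: "\<And>N. s N \<le> L"
    using incseq_convergent[of s B] bound mono by (auto simp: incseq_def s_def)
  have w[measurable]: "w \<in> borel_measurable dA"
    by (rule borel_measurable_LIMSEQ_metric[where f="\<lambda>N. hpartial c (?J N)"]) (use lim in auto)
  have key: "(\<integral>\<^sup>+z. ennreal ((cmod (w z - hpartial c (?J N) z))\<^sup>2) \<partial>dA) \<le> ennreal (L - s N)" for N
  proof -
    have diff: "(LINT z|dA. (cmod (hpartial c (?J M) z - hpartial c (?J N) z))\<^sup>2) = s M - s N"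
      and int: "integrable dA (\<lambda>z. (cmod (hpartial c (?J M) z - hpartial c (?J N) z))\<^sup>2)" if "N \<le> M" for M
    proof -
      have sub: "?J N \<subseteq> ?J M" using that by auto
      have "hpartial c (?J M) z - hpartial c (?J N) z = hpartial c (?J M - ?J N) z" for z
        unfolding hpartial_def by (rule sum_diff[symmetric]) (use sub in auto)
      moreover have "s M - s N = (\<Sum>n\<in>?J M - ?J N. (cmod (c n))\<^sup>2 / hweight n)"
        unfolding s_def by (rule sum_diff[symmetric]) (use sub in auto)
      ultimately show "(LINT z|dA. (cmod (hpartial c (?J M) z - hpartial c (?J N) z))\<^sup>2) = s M - s N"
        by (simp add: norm_hpartial)
      show "integrable dA (\<lambda>z. (cmod (hpartial c (?J M) z - hpartial c (?J N) z))\<^sup>2)"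
        by (intro L2_integrable_square L2_diff L2_hpartial) auto
    qed
    have "(\<integral>\<^sup>+z. ennreal ((cmod (w z - hpartial c (?J N) z))\<^sup>2) \<partial>dA)
        = (\<integral>\<^sup>+z. liminf (\<lambda>M. ennreal ((cmod (hpartial c (?J M) z - hpartial c (?J N) z))\<^sup>2)) \<partial>dA)"
    proof (rule nn_integral_cong)
      fix z assume "z \<in> space dA"
      then have "(\<lambda>M. ennreal ((cmod (hpartial c (?J M) z - hpartial c (?J N) z))\<^sup>2))
          \<longlonglongrightarrow> ennreal ((cmod (w z - hpartial c (?J N) z))\<^sup>2)"
        using lim by (intro tendsto_intros tendsto_ennrealI) auto
      then show "ennreal ((cmod (w z - hpartial c (?J N) z))\<^sup>2)
          = liminf (\<lambda>M. ennreal ((cmod (hpartial c (?J M) z - hpartial c (?J N) z))\<^sup>2))"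
        by (intro lim_imp_Liminf[symmetric]) auto
    qed
    also have "\<dots> \<le> liminf (\<lambda>M. \<integral>\<^sup>+z. ennreal ((cmod (hpartial c (?J M) z - hpartial c (?J N) z))\<^sup>2) \<partial>dA)"
      by (rule nn_integral_liminf) measurable
    also have "\<dots> \<le> liminf (\<lambda>M. ennreal (L - s N))"
    proof (rule Liminf_mono, unfold eventually_sequentially, intro exI allI impI)
      fix M assume "N \<le> M"
      then have "(\<integral>\<^sup>+z. ennreal ((cmod (hpartial c (?J M) z - hpartial c (?J N) z))\<^sup>2) \<partial>dA)
          = ennreal (s M - s N)"
        using int diff by (subst nn_integral_eq_integral) auto
      also have "\<dots> \<le> ennreal (L - s N)" using sL[of M] by (intro ennreal_leI) simp
      finally show "(\<integral>\<^sup>+z. ennreal ((cmod (hpartial c (?J M) z - hpartial c (?J N) z))\<^sup>2) \<partial>dA)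
          \<le> ennreal (L - s N)" .
    qed
    also have "\<dots> = ennreal (L - s N)" by (simp add: Liminf_const)
    finally show ?thesis .
  qed
  have diffL2: "(\<lambda>z. w z - hpartial c (?J N) z) \<in> L2" for N
  proof -
    have "integrable dA (\<lambda>z. (cmod (w z - hpartial c (?J N) z))\<^sup>2)"
      using key[of N] by (intro integrableI_bounded) (auto simp: less_top[symmetric] top_unique)
    then show ?thesis by (simp add: L2_def)
  qed
  show "w \<in> L2"
    using L2_add[OF diffL2 L2_hpartial, of "?J 0" 0 c] by simp
  show "(\<lambda>N. LINT z|dA. (cmod (w z - hpartial c (?J N) z))\<^sup>2) \<longlonglongrightarrow> 0"
  proof (rule tendsto_sandwich[of "\<lambda>_. 0" _ _ "\<lambda>N. L - s N"])
    show "\<forall>\<^sub>F N in sequentially. 0 \<le> (LINT z|dA. (cmod (w z - hpartial c (?J N) z))\<^sup>2)"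
      by (intro always_eventually allI integral_nonneg_AE) simp
    show "\<forall>\<^sub>F N in sequentially. (LINT z|dA. (cmod (w z - hpartial c (?J N) z))\<^sup>2) \<le> L - s N"
    proof (intro always_eventually allI)
      fix N
      have "ennreal (LINT z|dA. (cmod (w z - hpartial c (?J N) z))\<^sup>2) \<le> ennreal (L - s N)"
        using key[of N] by (subst nn_integral_eq_integral[symmetric]) (auto intro: L2_integrable_square[OF diffL2])
      then show "(LINT z|dA. (cmod (w z - hpartial c (?J N) z))\<^sup>2) \<le> L - s N"
        using sL[of N] by simp
    qed
    show "(\<lambda>N. L - s N) \<longlonglongrightarrow> 0" using tendsto_diff[OF tendsto_const L, of L] by simp
  qed auto
qed

lemma L2_inner_limit:
  assumes "F \<in> L2" "\<And>N. S N \<in> L2" "w \<in> L2"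
    and "(\<lambda>N. LINT z|dA. (cmod (w z - S N z))\<^sup>2) \<longlonglongrightarrow> 0"
  shows "(\<lambda>N. L2_inner F (S N)) \<longlonglongrightarrow> L2_inner F w"
proof -
  define A where "A = (LINT z|dA. (cmod (F z))\<^sup>2) + 1"
  have "(\<lambda>N. L2_inner F w - L2_inner F (S N)) \<longlonglongrightarrow> 0"
  proof (rule Lim_null_comparison)
    show "\<forall>\<^sub>F N in sequentially. cmod (L2_inner F w - L2_inner F (S N))
        \<le> A * sqrt (LINT z|dA. (cmod (w z - S N z))\<^sup>2)"
      using L2_inner_bound[OF assms(1) L2_diff[OF assms(3) assms(2)]] assms(1-3)
      by (simp add: L2_inner_diff_right A_def)
    show "(\<lambda>N. A * sqrt (LINT z|dA. (cmod (w z - S N z))\<^sup>2)) \<longlonglongrightarrow> 0"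
      using tendsto_mult[OF tendsto_const tendsto_real_sqrt[OF assms(4)], of A] by simp
  qed
  then have "(\<lambda>N. L2_inner F w - (L2_inner F w - L2_inner F (S N))) \<longlonglongrightarrow> L2_inner F w - 0"
    by (intro tendsto_diff tendsto_const)
  then show ?thesis by simp
qed

section \<open>Moment functions\<close>

text \<open>\<open>cpower t s\<close> is \<open>t\<^sup>s\<close> for \<open>t > 0\<close>; as \<open>ln 0 = 0\<close>, the junk value at \<open>t = 0\<close> is \<open>1\<close>.\<close>

definition cpower :: "real \<Rightarrow> complex \<Rightarrow> complex" where
  "cpower t s = exp (s * of_real (ln t))"

lemma norm_cpower: "cmod (cpower t s) = exp (Re s * ln t)"
  by (simp add: cpower_def)

lemma norm_cpower_le: "0 \<le> t \<Longrightarrow> t \<le> 1 \<Longrightarrow> 0 \<le> Re s \<Longrightarrow> cmod (cpower t s) \<le> 1"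
  by (cases "t = 0") (auto simp: norm_cpower mult_nonneg_nonpos)

lemma cpower_of_nat: "t > 0 \<Longrightarrow> cpower t (of_nat k) = of_real t ^ k"
  by (simp add: cpower_def exp_of_nat_mult exp_of_real)

lemma cpower_mult: "t > 0 \<Longrightarrow> u > 0 \<Longrightarrow> cpower (t * u) s = cpower t s * cpower u s"
  by (simp add: cpower_def ln_mult ring_distribs exp_add)

text \<open>A moment function is \<open>s \<mapsto> L (t \<mapsto> t\<^sup>s)\<close> for a bounded linear functional \<open>L\<close> on the span of the
  powers \<open>t\<^sup>s\<close>, \<open>Re s \<ge> 0\<close>, under the supremum norm on \<open>(0, 1]\<close>; only the values of \<open>L\<close> on powers
  are recorded.\<close>

definition moment_function :: "(complex \<Rightarrow> complex) \<Rightarrow> bool" where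
  "moment_function a \<longleftrightarrow>
     (\<exists>C\<ge>0. \<forall>n c s K.
        (\<forall>i<(n::nat). 0 \<le> Re (s i)) \<and>
        (\<forall>t. 0 < t \<and> t \<le> 1 \<longrightarrow> cmod (\<Sum>i<n. c i * cpower t (s i)) \<le> K) \<longrightarrow>
        cmod (\<Sum>i<n. c i * a (s i)) \<le> C * K)"

lemma moment_function_add:
  assumes "moment_function a" "moment_function b"
  shows "moment_function (\<lambda>s. a s + b s)"
proof -
  obtain C where C: "C \<ge> 0" "\<And>n c s K. (\<forall>i<(n::nat). 0 \<le> Re (s i)) \<Longrightarrow>
     (\<forall>t. 0 < t \<and> t \<le> 1 \<longrightarrow> cmod (\<Sum>i<n. c i * cpower t (s i)) \<le> K) \<Longrightarrow> cmod (\<Sum>i<n. c i * a (s i)) \<le> C * K"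
    using assms(1) unfolding moment_function_def by metis
  obtain D where D: "D \<ge> 0" "\<And>n c s K. (\<forall>i<(n::nat). 0 \<le> Re (s i)) \<Longrightarrow>
     (\<forall>t. 0 < t \<and> t \<le> 1 \<longrightarrow> cmod (\<Sum>i<n. c i * cpower t (s i)) \<le> K) \<Longrightarrow> cmod (\<Sum>i<n. c i * b (s i)) \<le> D * K"
    using assms(2) unfolding moment_function_def by metis
  show ?thesis
    unfolding moment_function_def
  proof (intro exI[of _ "C + D"] conjI allI impI; (elim conjE)?)
    fix n c s K
    assume "\<forall>i<(n::nat). 0 \<le> Re (s i)"
      "\<forall>t. 0 < t \<and> t \<le> 1 \<longrightarrow> cmod (\<Sum>i<n. c i * cpower t (s i)) \<le> K"
    then have "cmod (\<Sum>i<n. c i * a (s i)) + cmod (\<Sum>i<n. c i * b (s i)) \<le> C * K + D * K"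
      by (intro add_mono C(2) D(2))
    then show "cmod (\<Sum>i<n. c i * (a (s i) + b (s i))) \<le> (C + D) * K"
      using norm_triangle_ineq[of "\<Sum>i<n. c i * a (s i)" "\<Sum>i<n. c i * b (s i)"]
      by (simp add: algebra_simps sum.distrib)
  qed (use C D in auto)
qed

text \<open>The product corresponds to the multiplicative convolution of functionals:
  apply one of them to \<open>t\<close> and the other to \<open>u\<close> in \<open>(t u)\<^sup>s = t\<^sup>s u\<^sup>s\<close>.\<close>

lemma moment_function_mult:
  assumes "moment_function a" "moment_function b"
  shows "moment_function (\<lambda>s. a s * b s)"
proof -
  obtain C where C: "C \<ge> 0" "\<And>n c s K. (\<forall>i<(n::nat). 0 \<le> Re (s i)) \<Longrightarrow>
     (\<forall>t. 0 < t \<and> t \<le> 1 \<longrightarrow> cmod (\<Sum>i<n. c i * cpower t (s i)) \<le> K) \<Longrightarrow> cmod (\<Sum>i<n. c i * a (s i)) \<le> C * K"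
    using assms(1) unfolding moment_function_def by metis
  obtain D where D: "D \<ge> 0" "\<And>n c s K. (\<forall>i<(n::nat). 0 \<le> Re (s i)) \<Longrightarrow>
     (\<forall>t. 0 < t \<and> t \<le> 1 \<longrightarrow> cmod (\<Sum>i<n. c i * cpower t (s i)) \<le> K) \<Longrightarrow> cmod (\<Sum>i<n. c i * b (s i)) \<le> D * K"
    using assms(2) unfolding moment_function_def by metis
  show ?thesis
    unfolding moment_function_def
  proof (intro exI[of _ "D * C"] conjI allI impI; (elim conjE)?)
    fix n c s K
    assume s: "\<forall>i<(n::nat). 0 \<le> Re (s i)"
      and K: "\<forall>t. 0 < t \<and> t \<le> 1 \<longrightarrow> cmod (\<Sum>i<n. c i * cpower t (s i)) \<le> K"
    have "cmod (\<Sum>i<n. (c i * a (s i)) * b (s i)) \<le> D * (C * K)"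
    proof (rule D(2)[OF s], intro allI impI)
      fix t :: real assume t: "0 < t \<and> t \<le> 1"
      have "cmod (\<Sum>i<n. (c i * cpower t (s i)) * a (s i)) \<le> C * K"
      proof (rule C(2)[OF s], intro allI impI)
        fix u :: real assume u: "0 < u \<and> u \<le> 1"
        have "(\<Sum>i<n. c i * cpower t (s i) * cpower u (s i)) = (\<Sum>i<n. c i * cpower (t * u) (s i))"
          using t u by (simp add: cpower_mult mult.assoc)
        moreover have "0 < t * u \<and> t * u \<le> 1" using t u by (simp add: mult_le_one)
        ultimately show "cmod (\<Sum>i<n. c i * cpower t (s i) * cpower u (s i)) \<le> K"
          using K by simp
      qed
      then show "cmod (\<Sum>i<n. c i * a (s i) * cpower t (s i)) \<le> C * K"
        by (simp add: mult_ac)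
    qed
    then show "cmod (\<Sum>i<n. c i * (a (s i) * b (s i))) \<le> D * C * K"
      by (simp add: mult_ac)
  qed (use C D in auto)
qed

text \<open>The constant \<open>k\<close> is the moment function of \<open>k\<close> times
  evaluation at \<open>t = 1\<close>, so scaling is a special case of the product.\<close>

lemma moment_function_cmult:
  assumes "moment_function a"
  shows "moment_function (\<lambda>s. k * a s)"
proof -
  have "moment_function (\<lambda>s. k)"
    unfolding moment_function_def
  proof (intro exI[of _ "cmod k"] conjI allI impI; (elim conjE)?)
    fix n c s K
    assume "\<forall>t. 0 < t \<and> t \<le> 1 \<longrightarrow> cmod (\<Sum>i<(n::nat). c i * cpower t (s i)) \<le> K"
    from this[rule_format, of 1] have "cmod (\<Sum>i<n. c i) \<le> K" by (simp add: cpower_def)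
    then show "cmod (\<Sum>i<n. c i * k) \<le> cmod k * K"
      unfolding sum_distrib_right[symmetric] norm_mult by (subst mult.commute) (simp add: mult_left_mono)
  qed simp
  from moment_function_mult[OF this assms] show ?thesis .
qed

lemma moment_function_diff:
  "moment_function a \<Longrightarrow> moment_function b \<Longrightarrow> moment_function (\<lambda>s. a s - b s)"
  using moment_function_add[OF _ moment_function_cmult[of b "-1"], of a] by simp

text \<open>The value at 0 overrides the default value of \<open>cpower\<close>. For
  \<open>Re s > 0\<close> it is the limit, so that Weierstrass applies on the compact
  interval.\<close>

lemma continuous_on_cpower:
  assumes "Re s > 0"
  shows "continuous_on {0..1} (\<lambda>t. if t = 0 then 0 else cpower t s)"
  unfolding continuous_on_eq_continuous_within
proof
  fix x :: real assume x: "x \<in> {0..1}"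
  show "continuous (at x within {0..1}) (\<lambda>t. if t = 0 then 0 else cpower t s)"
  proof (cases "x = 0")
    case True
    have "((\<lambda>t::real. t powr Re s) \<longlongrightarrow> 0) (at 0 within {0..1})"
      using assms tendsto_powr'[of "\<lambda>t::real. t" 0 "at 0 within {0..1}" "\<lambda>_. Re s" "Re s"]
      by (auto simp: eventually_at_filter)
    then have "((\<lambda>t. if t = 0 then 0 else cpower t s) \<longlongrightarrow> 0) (at 0 within {0..1})"
      by (rule Lim_null_comparison[rotated])
        (auto simp: eventually_at_filter norm_cpower powr_def)
    then show ?thesis using True by (simp add: continuous_within)
  next
    case False
    then have "x > 0" using x by simp
    have "isCont (\<lambda>t. cpower t s) x"
      unfolding cpower_def using \<open>x > 0\<close> by (auto intro!: continuous_intros)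
    moreover have "eventually (\<lambda>t. cpower t s = (if t = 0 then 0 else cpower t s)) (nhds x)"
      by (rule eventually_mono[OF eventually_nhds_in_open[of "{0<..}" x]]) (use \<open>x > 0\<close> in auto)
    ultimately have "isCont (\<lambda>t. if t = 0 then 0 else cpower t s) x"
      using isCont_cong[of "\<lambda>t. cpower t s" "\<lambda>t. if t = 0 then 0 else cpower t s" x] by simp
    then show ?thesis by (rule continuous_at_imp_continuous_at_within)
  qed
qed

lemma complex_Weierstrass:
  fixes f :: "real \<Rightarrow> complex"
  assumes "continuous_on {0..1} f" "e > 0"
  obtains c n where "\<And>t. t \<in> {0..1} \<Longrightarrow> cmod (f t - (\<Sum>i\<le>(n::nat). c i * of_real t ^ i)) < e"
proof -
  obtain g where g: "real_polynomial_function g" "\<And>t. t \<in> {0..1} \<Longrightarrow> \<bar>Re (f t) - g t\<bar> < e / 2"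
    using Stone_Weierstrass_real_polynomial_function[of "{0..1}" "\<lambda>t. Re (f t)" "e / 2"] assms
    by (auto intro!: continuous_intros)
  obtain h where h: "real_polynomial_function h" "\<And>t. t \<in> {0..1} \<Longrightarrow> \<bar>Im (f t) - h t\<bar> < e / 2"
    using Stone_Weierstrass_real_polynomial_function[of "{0..1}" "\<lambda>t. Im (f t)" "e / 2"] assms
    by (auto intro!: continuous_intros)
  obtain a m where a: "g = (\<lambda>t. \<Sum>i\<le>m. a i * t ^ i)"
    using g(1) real_polynomial_function_iff_sum by auto
  obtain b n where b: "h = (\<lambda>t. \<Sum>i\<le>n. b i * t ^ i)"
    using h(1) real_polynomial_function_iff_sum by auto
  define c where "c = (\<lambda>i. Complex (if i \<le> m then a i else 0) (if i \<le> n then b i else 0))"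
  have "(\<Sum>i\<le>max m n. c i * of_real t ^ i) = Complex (g t) (h t)" for t :: real
  proof -
    have "Re (\<Sum>i\<le>max m n. c i * of_real t ^ i) = (\<Sum>i\<le>max m n. (if i \<le> m then a i * t ^ i else 0))"
      unfolding Re_sum by (rule sum.cong) (auto simp: c_def simp flip: of_real_power)
    also have "\<dots> = g t"
      unfolding a by (rule sum.mono_neutral_cong_right) auto
    finally have 1: "Re (\<Sum>i\<le>max m n. c i * of_real t ^ i) = g t" .
    have "Im (\<Sum>i\<le>max m n. c i * of_real t ^ i) = (\<Sum>i\<le>max m n. (if i \<le> n then b i * t ^ i else 0))"
      unfolding Im_sum by (rule sum.cong) (auto simp: c_def simp flip: of_real_power)
    also have "\<dots> = h t"
      unfolding b by (rule sum.mono_neutral_cong_right) auto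
    finally show ?thesis using 1 by (simp add: complex_eq_iff)
  qed
  moreover have "cmod (f t - Complex (g t) (h t)) < e" if "t \<in> {0..1}" for t
    using cmod_le[of "f t - Complex (g t) (h t)"] g(2)[OF that] h(2)[OF that] by simp
  ultimately show ?thesis using that[of c "max m n"] by simp
qed

text \<open>On the interval \<open>t^s\<close> is within \<open>e\<close> of a polynomial. The
  difference is again a finite combination of powers, so the functional maps it to a number of
  modulus at most \<open>C * e\<close>, to which the polynomial contributes 0 by hypothesis.\<close>

lemma moment_function_zero:
  assumes a: "moment_function a" and z: "\<And>k. a (of_nat k) = 0" and s: "Re s > 0"
  shows "a s = 0"
proof -
  obtain C where C: "C \<ge> 0" "\<And>n c s K. (\<forall>i<(n::nat). 0 \<le> Re (s i)) \<Longrightarrow>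
     (\<forall>t. 0 < t \<and> t \<le> 1 \<longrightarrow> cmod (\<Sum>i<n. c i * cpower t (s i)) \<le> K) \<Longrightarrow> cmod (\<Sum>i<n. c i * a (s i)) \<le> C * K"
    using a unfolding moment_function_def by metis
  have "cmod (a s) \<le> C * e" if e: "e > 0" for e
  proof -
    obtain c n where c: "\<And>t. t \<in> {0..1} \<Longrightarrow>
        cmod ((if t = 0 then 0 else cpower t s) - (\<Sum>i\<le>(n::nat). c i * of_real t ^ i)) < e"
      using complex_Weierstrass[OF continuous_on_cpower[OF s] e] by blast
    \<comment> \<open>The polynomial and the power \<open>t^s\<close> are packed into one family of
      length \<open>n + 2\<close>: exponents 0 to \<open>n\<close> with coefficients
      \<open>- c i\<close>, and the exponent \<open>s\<close> at index \<open>n + 1\<close>.\<close>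
    define d where "d = (\<lambda>i. if i \<le> n then - c i else 1)"
    define \<sigma> where "\<sigma> = (\<lambda>i. if i \<le> n then of_nat i else s)"
    have split: "(\<Sum>i<Suc (Suc n). d i * g (\<sigma> i)) = g s - (\<Sum>i\<le>n. c i * g (of_nat i))" for g :: "complex \<Rightarrow> complex"
    proof -
      have "(\<Sum>i<Suc (Suc n). d i * g (\<sigma> i)) = (\<Sum>i\<le>n. d i * g (\<sigma> i)) + g s"
        by (simp add: lessThan_Suc_atMost d_def \<sigma>_def)
      also have "(\<Sum>i\<le>n. d i * g (\<sigma> i)) = - (\<Sum>i\<le>n. c i * g (of_nat i))"
        by (subst sum_negf[symmetric], rule sum.cong) (auto simp: d_def \<sigma>_def)
      finally show ?thesis by simp
    qed
    have "cmod (\<Sum>i<Suc (Suc n). d i * a (\<sigma> i)) \<le> C * e"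
    proof (rule C(2); intro allI impI)
      show "0 \<le> Re (\<sigma> i)" for i using s by (simp add: \<sigma>_def)
      fix t :: real assume t: "0 < t \<and> t \<le> 1"
      then show "cmod (\<Sum>i<Suc (Suc n). d i * cpower t (\<sigma> i)) \<le> e"
        using c[of t] by (simp only: split) (simp add: cpower_of_nat less_imp_le)
    qed
    then show ?thesis by (simp only: split) (simp add: z)
  qed
  from this[of "1 / (n + 1)" for n :: nat]
  have "cmod (a s) \<le> C * (1 / (real n + 1))" for n :: nat by (simp add: add.commute)
  moreover have "(\<lambda>n. C * (1 / (real n + 1))) \<longlonglongrightarrow> C * 0"
    by (intro tendsto_mult tendsto_const lim_1_over_n[THEN LIMSEQ_Suc, simplified, THEN tendsto_cong[THEN iffD1, rotated]])
      (simp add: add.commute)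
  ultimately have "cmod (a s) \<le> 0"
    using LIMSEQ_le_const[of "\<lambda>n. C * (1 / (real n + 1))" 0 "cmod (a s)"] by auto
  then show ?thesis by simp
qed

section \<open>Moments of bounded symbols\<close>

text \<open>For radial \<open>f\<close> this is \<open>2 \<integral>\<^sub>0\<^sup>1 f(r) r\<^sup>2\<^sup>s\<^sup>+\<^sup>1 dr\<close>, twice the Mellin transform of \<open>f\<close> at \<open>2 s + 2\<close>.\<close>

definition moment :: "(complex \<Rightarrow> complex) \<Rightarrow> complex \<Rightarrow> complex" where
  "moment f s = (LINT z|dA. f z * cpower ((cmod z)\<^sup>2) s)"

lemma measurable_cpower_norm [measurable]: "(\<lambda>z. cpower ((cmod z)\<^sup>2) s) \<in> borel_measurable dA"
  unfolding cpower_def by measurable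

lemma norm_square_le_1: "z \<in> unit_disk \<Longrightarrow> (cmod z)\<^sup>2 \<le> 1"
  by (simp add: in_disk_iff power_le_one)

lemma bounded_symbolE:
  assumes "bounded_symbol f"
  obtains C where "C \<ge> 0" "\<And>z. z \<in> unit_disk \<Longrightarrow> cmod (f z) \<le> C"
proof -
  obtain C where "\<And>z. z \<in> unit_disk \<Longrightarrow> cmod (f z) \<le> C"
    using assms by (auto simp: bounded_symbol_def bounded_iff)
  then show ?thesis by (intro that[of "max C 0"]) (auto simp: le_max_iff_disj)
qed

lemma bounded_symbolI:
  assumes "f \<in> borel_measurable dA" "\<And>z. z \<in> unit_disk \<Longrightarrow> cmod (f z) \<le> C"
  shows "bounded_symbol f"
  using assms by (auto simp: bounded_symbol_def bounded_iff)

lemma bounded_symbol_measurable: "bounded_symbol f \<Longrightarrow> f \<in> borel_measurable dA"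
  by (simp add: bounded_symbol_def)

lemma integrable_moment:
  assumes f: "bounded_symbol f" and s: "Re s \<ge> 0"
  shows "integrable dA (\<lambda>z. f z * cpower ((cmod z)\<^sup>2) s)"
proof -
  obtain C where C: "C \<ge> 0" "\<And>z. z \<in> unit_disk \<Longrightarrow> cmod (f z) \<le> C" using bounded_symbolE[OF f] by blast
  show ?thesis
  proof (rule integrable_dA_bounded[of _ "C * 1"])
    show "(\<lambda>z. f z * cpower ((cmod z)\<^sup>2) s) \<in> borel_measurable dA"
      by (intro borel_measurable_times measurable_cpower_norm bounded_symbol_measurable f)
    show "cmod (f z * cpower ((cmod z)\<^sup>2) s) \<le> C * 1" if "z \<in> unit_disk" for z
      unfolding norm_mult using that C s by (intro mult_mono norm_cpower_le norm_square_le_1) auto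
  qed
qed

lemma moment_of_nat:
  assumes "bounded_symbol f"
  shows "moment f (of_nat k) = (LINT z|dA. f z * of_real (cmod z ^ (2 * k)))"
  unfolding moment_def
proof (rule integral_cong_AE)
  show "(\<lambda>z. f z * cpower ((cmod z)\<^sup>2) (of_nat k)) \<in> borel_measurable dA"
    "(\<lambda>z. f z * of_real (cmod z ^ (2 * k))) \<in> borel_measurable dA"
    using bounded_symbol_measurable[OF assms] by measurable
  \<comment> \<open>Equality can fail at 0, where \<open>cpower\<close> has its default value 1
    while \<open>0 ^ (2 * k)\<close> is 0 for \<open>k > 0\<close>.\<close>
  show "AE z in dA. f z * cpower ((cmod z)\<^sup>2) (of_nat k) = f z * of_real (cmod z ^ (2 * k))"
    using AE_dA_nonzero by eventually_elim (simp add: cpower_of_nat power_mult)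
qed

lemma moment_function_moment:
  assumes f: "bounded_symbol f"
  shows "moment_function (moment f)"
proof -
  obtain C where C: "C \<ge> 0" "\<And>z. z \<in> unit_disk \<Longrightarrow> cmod (f z) \<le> C" using bounded_symbolE[OF f] by blast
  show ?thesis
    unfolding moment_function_def
  proof (intro exI[of _ C] conjI allI impI C; (elim conjE)?)
    fix n c s K
    assume s: "\<forall>i<(n::nat). 0 \<le> Re (s i)"
      and K: "\<forall>t. 0 < t \<and> t \<le> 1 \<longrightarrow> cmod (\<Sum>i<n. c i * cpower t (s i)) \<le> K"
    have i: "integrable dA (\<lambda>z. \<Sum>i<n. c i * (f z * cpower ((cmod z)\<^sup>2) (s i)))"
      using s by (intro Bochner_Integration.integrable_sum integrable_mult_right integrable_moment[OF f]) auto
    have "(\<Sum>i<n. c i * moment f (s i)) = (LINT z|dA. (\<Sum>i<n. c i * (f z * cpower ((cmod z)\<^sup>2) (s i))))"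
      unfolding moment_def using s integrable_moment[OF f]
      by (subst Bochner_Integration.integral_sum) auto
    also have "cmod \<dots> \<le> (LINT z|dA. cmod (\<Sum>i<n. c i * (f z * cpower ((cmod z)\<^sup>2) (s i))))"
      by (rule integral_norm_bound)
    also have "\<dots> \<le> (LINT z|dA. C * K)"
    proof (rule integral_mono_AE)
      show "AE z in dA. cmod (\<Sum>i<n. c i * (f z * cpower ((cmod z)\<^sup>2) (s i))) \<le> C * K"
      proof (use AE_dA_nonzero AE_space in eventually_elim)
        fix z assume z: "z \<noteq> 0" "z \<in> space dA"
        have "(\<Sum>i<n. c i * (f z * cpower ((cmod z)\<^sup>2) (s i))) = f z * (\<Sum>i<n. c i * cpower ((cmod z)\<^sup>2) (s i))"
          by (simp add: sum_distrib_left mult_ac)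
        also have "cmod \<dots> \<le> C * K"
          unfolding norm_mult using z C K norm_square_le_1[of z] by (intro mult_mono) auto
        finally show "cmod (\<Sum>i<n. c i * (f z * cpower ((cmod z)\<^sup>2) (s i))) \<le> C * K" .
      qed
    qed (use i in auto)
    also have "\<dots> = C * K" by simp
    finally show "cmod (\<Sum>i<n. c i * moment f (s i)) \<le> C * K" .
  qed
qed

text \<open>The derivative \<open>l * exp (w * l)\<close> is bounded by \<open>1 / d\<close> on
  \<open>Re w \<ge> d\<close>, because \<open>x * exp (- x) \<le> 1\<close> at
  \<open>x = - d * l\<close>. The bound is uniform in \<open>l\<close>, so it dominates the
  difference quotients in \<open>holomorphic_moment\<close>.\<close>

lemma norm_exp_diff_le:
  fixes l d :: real and w w0 :: complex
  assumes "d > 0" "l \<le> 0" "d \<le> Re w" "d \<le> Re w0"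
  shows "cmod (exp (w * of_real l) - exp (w0 * of_real l)) \<le> (1 / d) * cmod (w - w0)"
proof (rule field_differentiable_bound[of "{z. d \<le> Re z}" _ "\<lambda>z. exp (z * of_real l) * of_real l"])
  show "convex {z. d \<le> Re z}"
    by (rule convex_halfspace_Re_ge)
  show "((\<lambda>w. exp (w * of_real l)) has_field_derivative exp (z * of_real l) * of_real l) (at z within {z. d \<le> Re z})" for z
    by (auto intro!: derivative_eq_intros)
  show "cmod (exp (z * of_real l) * of_real l) \<le> 1 / d" if "z \<in> {z. d \<le> Re z}" for z
  proof -
    have "exp (Re z * l) \<le> exp (d * l)" using that assms by (simp add: mult_right_mono_neg)
    then have "cmod (exp (z * of_real l) * of_real l) \<le> exp (d * l) * - l"
      using assms mult_right_mono[of "exp (Re z * l)" "exp (d * l)" "- l"] by (simp add: norm_mult)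
    also have "\<dots> \<le> 1 / d"
    proof -
      have "- (d * l) \<le> exp (- (d * l))"
        using exp_ge_add_one_self[of "- (d * l)"] by linarith
      then have "exp (d * l) * (- (d * l)) \<le> exp (d * l) * exp (- (d * l))"
        by (rule mult_left_mono) simp
      then show ?thesis using assms(1) by (simp add: field_simps flip: exp_add)
    qed
    finally show ?thesis .
  qed
qed (use assms in auto)

text \<open>Differentiation under the integral sign, by dominated convergence along arbitrary
  sequences.\<close>

lemma holomorphic_moment:
  assumes f: "bounded_symbol f"
  shows "moment f holomorphic_on {s. Re s > 0}"
  unfolding holomorphic_on_def field_differentiable_def
proof (intro ballI exI)
  fix s0 assume "s0 \<in> {s. Re s > 0}"
  then have s0: "Re s0 > 0" by simp
  obtain C where C: "C \<ge> 0" "\<And>z. z \<in> unit_disk \<Longrightarrow> cmod (f z) \<le> C" using bounded_symbolE[OF f] by blast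
  have [measurable]: "f \<in> borel_measurable dA" by (rule bounded_symbol_measurable[OF f])
  define l where "l = (\<lambda>z. ln ((cmod z)\<^sup>2))"
  have [measurable]: "l \<in> borel_measurable dA" unfolding l_def by measurable
  define D where "D = (LINT z|dA. f z * (exp (s0 * of_real (l z)) * of_real (l z)))"
  have "((\<lambda>h. (moment f (s0 + h) - moment f s0) / h) \<longlongrightarrow> D) (at 0)"
    unfolding tendsto_at_iff_sequentially
  proof (intro allI impI)
    fix X assume X: "\<forall>i. X i \<in> UNIV - {0}" "X \<longlonglongrightarrow> (0::complex)"
    have "eventually (\<lambda>i. dist (X i) 0 < Re s0 / 2) sequentially"
      using X(2) s0 by (intro tendstoD) auto
    then obtain M where M: "\<And>i. i \<ge> M \<Longrightarrow> cmod (X i) < Re s0 / 2"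
      by (auto simp: eventually_sequentially)
    \<comment> \<open>Dropping the first \<open>M\<close> terms keeps \<open>s0 + Y i\<close> in the
      half plane \<open>Re w \<ge> Re s0 / 2\<close>, where the difference quotients of the
      exponentials have the common bound \<open>2 / Re s0\<close>.\<close>
    define Y where "Y = (\<lambda>i. X (i + M))"
    have Y: "\<And>i. Y i \<noteq> 0" "\<And>i. cmod (Y i) < Re s0 / 2" "Y \<longlonglongrightarrow> 0"
      using X M LIMSEQ_ignore_initial_segment[OF X(2), of M] by (auto simp: Y_def)
    have ReY: "Re s0 / 2 \<le> Re (s0 + Y i)" for i
      using Y(2)[of i] abs_Re_le_cmod[of "Y i"] by simp
    have "(\<lambda>i. LINT z|dA. f z * ((exp ((s0 + Y i) * of_real (l z)) - exp (s0 * of_real (l z))) / Y i)) \<longlonglongrightarrow> D"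
      unfolding D_def
    proof (rule integral_dominated_convergence[where w="\<lambda>_. C * (1 / (Re s0 / 2))"])
      show "AE z in dA. (\<lambda>i. f z * ((exp ((s0 + Y i) * of_real (l z)) - exp (s0 * of_real (l z))) / Y i))
          \<longlonglongrightarrow> f z * (exp (s0 * of_real (l z)) * of_real (l z))"
      proof (intro AE_I2 tendsto_mult tendsto_const)
        fix z
        have "((\<lambda>w. exp (w * of_real (l z))) has_field_derivative exp (s0 * of_real (l z)) * of_real (l z)) (at s0)"
          by (auto intro!: derivative_eq_intros)
        then have "((\<lambda>h. (exp ((s0 + h) * of_real (l z)) - exp (s0 * of_real (l z))) / h) \<longlongrightarrow>
            exp (s0 * of_real (l z)) * of_real (l z)) (at 0)"
          by (simp add: DERIV_def)
        then have "((\<lambda>h. (exp ((s0 + h) * of_real (l z)) - exp (s0 * of_real (l z))) / h) \<circ> Y) \<longlonglongrightarrow>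
            exp (s0 * of_real (l z)) * of_real (l z)"
          using Y unfolding tendsto_at_iff_sequentially by auto
        then show "(\<lambda>i. (exp ((s0 + Y i) * of_real (l z)) - exp (s0 * of_real (l z))) / Y i) \<longlonglongrightarrow>
            exp (s0 * of_real (l z)) * of_real (l z)" by (simp add: o_def)
      qed
      show "AE z in dA. cmod (f z * ((exp ((s0 + Y i) * of_real (l z)) - exp (s0 * of_real (l z))) / Y i))
          \<le> C * (1 / (Re s0 / 2))" for i
      proof (rule AE_I2)
        fix z assume z: "z \<in> space dA"
        have lz: "l z \<le> 0"
          using z norm_square_le_1[of z] by (cases "z = 0") (auto simp: l_def)
        have "cmod (exp ((s0 + Y i) * of_real (l z)) - exp (s0 * of_real (l z))) \<le> (1 / (Re s0 / 2)) * cmod (s0 + Y i - s0)"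
          by (rule norm_exp_diff_le) (use s0 lz ReY[of i] in auto)
        then have "cmod ((exp ((s0 + Y i) * of_real (l z)) - exp (s0 * of_real (l z))) / Y i) \<le> 1 / (Re s0 / 2)"
          using Y(1)[of i] by (simp add: norm_divide divide_le_eq)
        then show "cmod (f z * ((exp ((s0 + Y i) * of_real (l z)) - exp (s0 * of_real (l z))) / Y i))
          \<le> C * (1 / (Re s0 / 2))"
          unfolding norm_mult using z C by (intro mult_mono) auto
      qed
    qed measurable
    moreover have "(LINT z|dA. f z * ((exp ((s0 + Y i) * of_real (l z)) - exp (s0 * of_real (l z))) / Y i))
        = (moment f (s0 + Y i) - moment f s0) / Y i" for i
    proof -
      have "moment f (s0 + Y i) - moment f s0 =
          (LINT z|dA. f z * cpower ((cmod z)\<^sup>2) (s0 + Y i) - f z * cpower ((cmod z)\<^sup>2) s0)"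
        unfolding moment_def using ReY[of i] s0
        by (intro Bochner_Integration.integral_diff[symmetric] integrable_moment f) auto
      then have "(moment f (s0 + Y i) - moment f s0) / Y i =
          (LINT z|dA. (f z * cpower ((cmod z)\<^sup>2) (s0 + Y i) - f z * cpower ((cmod z)\<^sup>2) s0) / Y i)"
        by simp
      also have "\<dots> = (LINT z|dA. f z * ((exp ((s0 + Y i) * of_real (l z)) - exp (s0 * of_real (l z))) / Y i))"
        by (rule Bochner_Integration.integral_cong) (simp_all add: cpower_def l_def right_diff_distrib)
      finally show ?thesis ..
    qed
    ultimately have "(\<lambda>i. (moment f (s0 + Y i) - moment f s0) / Y i) \<longlonglongrightarrow> D" by (simp only:)
    then have "(\<lambda>i. (moment f (s0 + X (i + M)) - moment f s0) / X (i + M)) \<longlonglongrightarrow> D"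
      by (simp add: Y_def)
    from LIMSEQ_offset[OF this]
    show "((\<lambda>h. (moment f (s0 + h) - moment f s0) / h) \<circ> X) \<longlonglongrightarrow> D" by (simp add: o_def)
  qed
  then show "(moment f has_field_derivative D) (at s0 within {s. Re s > 0})"
    unfolding DERIV_def[symmetric] by (rule has_field_derivative_at_within)
qed

text \<open>The identity theorem: if \<open>g\<close> is nonzero somewhere, it is nonzero on a
  nonempty open set, and there \<open>f\<close> must vanish.\<close>

lemma holomorphic_mult_eq_0:
  assumes S: "open S" "connected S" and f: "f holomorphic_on S" and g: "g holomorphic_on S"
    and fg: "\<And>z. z \<in> S \<Longrightarrow> f z * g z = 0"
  shows "(\<forall>z\<in>S. f z = 0) \<or> (\<forall>z\<in>S. g z = 0)"
proof (rule disjCI, rule ccontr)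
  assume "\<not> (\<forall>z\<in>S. g z = 0)" and nf: "\<not> (\<forall>z\<in>S. f z = 0)"
  then obtain z0 where z0: "z0 \<in> S" "g z0 \<noteq> 0" by auto
  have "continuous_on S g" using g by (rule holomorphic_on_imp_continuous_on)
  then have "open {z \<in> S. g z \<noteq> 0}"
    using continuous_open_preimage[OF _ S(1), of g "- {0}"] by (simp add: vimage_def Int_def open_Compl)
  then have "f z = 0" if "z \<in> S" for z
  proof (intro analytic_continuation_open[OF _ S(1) _ S(2) _ f _ _ that, where g="\<lambda>_. 0"])
    show "{z \<in> S. g z \<noteq> 0} \<noteq> {}" using z0 by auto
  qed (use fg in \<open>force\<close>)+
  with nf show False by auto
qed

section \<open>Radial functions are determined by their moments\<close>

lemma bounded_symbol_mult:
  assumes "bounded_symbol f" "bounded_symbol g"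
  shows "bounded_symbol (\<lambda>z. f z * g z)"
proof -
  obtain C where C: "C \<ge> 0" "\<And>z. z \<in> unit_disk \<Longrightarrow> cmod (f z) \<le> C" using bounded_symbolE[OF assms(1)] by blast
  obtain D where D: "D \<ge> 0" "\<And>z. z \<in> unit_disk \<Longrightarrow> cmod (g z) \<le> D" using bounded_symbolE[OF assms(2)] by blast
  show ?thesis
  proof (rule bounded_symbolI)
    show "(\<lambda>z. f z * g z) \<in> borel_measurable dA"
      by (intro borel_measurable_times bounded_symbol_measurable assms)
    show "cmod (f z * g z) \<le> C * D" if "z \<in> unit_disk" for z
      unfolding norm_mult using C D that by (intro mult_mono) auto
  qed
qed

lemma bounded_symbol_add:
  assumes "bounded_symbol f" "bounded_symbol g"
  shows "bounded_symbol (\<lambda>z. f z + g z)"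
proof -
  obtain C where C: "C \<ge> 0" "\<And>z. z \<in> unit_disk \<Longrightarrow> cmod (f z) \<le> C" using bounded_symbolE[OF assms(1)] by blast
  obtain D where D: "D \<ge> 0" "\<And>z. z \<in> unit_disk \<Longrightarrow> cmod (g z) \<le> D" using bounded_symbolE[OF assms(2)] by blast
  show ?thesis
  proof (rule bounded_symbolI)
    show "(\<lambda>z. f z + g z) \<in> borel_measurable dA"
      by (intro borel_measurable_add bounded_symbol_measurable assms)
    show "cmod (f z + g z) \<le> C + D" if "z \<in> unit_disk" for z
      using norm_triangle_ineq[of "f z" "g z"] C(2)[OF that] D(2)[OF that] by linarith
  qed
qed

lemma bounded_symbol_const: "bounded_symbol (\<lambda>z. c)"
  by (rule bounded_symbolI[of _ "cmod c"]) auto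

lemma bounded_symbol_continuous:
  assumes "continuous_on (cball 0 1) f"
  shows "bounded_symbol f"
proof -
  have sub: "unit_disk \<subseteq> cball 0 1" by (auto simp: in_disk_iff)
  have "f \<in> borel_measurable dA"
    by (rule continuous_measurable_dA) (rule continuous_on_subset[OF assms sub])
  moreover have "bounded (f ` unit_disk)"
    by (rule bounded_subset[OF compact_imp_bounded[OF compact_continuous_image[OF assms]] image_mono[OF sub]]) simp
  ultimately show ?thesis by (simp add: bounded_symbol_def)
qed

lemma bounded_symbol_integrable: "bounded_symbol f \<Longrightarrow> integrable dA f"
  using integrable_moment[of f 0] by (simp add: cpower_def)

lemma radial_rotate:
  assumes "radial f" "cmod w = 1" "z \<in> unit_disk"
  shows "f (w * z) = f z"
proof -
  have n: "cmod (w * z) = cmod z" using assms(2) by (simp add: norm_mult)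
  then have "w * z \<in> unit_disk" using assms(3) by (simp add: in_disk_iff)
  with n show ?thesis using assms(1,3) unfolding radial_def by blast
qed

text \<open>For \<open>a = b\<close> the monomial is \<open>|z|^(2 a)\<close> and the hypothesis
  applies; otherwise a rotation multiplies it by the nontrivial factor \<open>w powi (a - b)\<close>
  while \<open>f\<close> is invariant.\<close>

lemma radial_orthogonal_monomials:
  assumes f: "bounded_symbol f" "radial f"
    and z: "\<And>k. (LINT z|dA. f z * of_real (cmod z ^ (2 * k))) = 0"
  shows "(LINT z|dA. f z * (z ^ a * cnj z ^ b)) = 0"
proof (cases "a = b")
  case True
  have "z ^ a * cnj z ^ a = of_real (cmod z ^ (2 * a))" for z
    by (metis complex_norm_square of_real_power power_mult power_mult_distrib)
  with True z show ?thesis by simp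
next
  case False
  have "bounded_symbol (\<lambda>z. z ^ a * cnj z ^ b)"
    by (intro bounded_symbol_continuous continuous_intros)
  from bounded_symbol_mult[OF f(1) this]
  have m: "(\<lambda>z. f z * (z ^ a * cnj z ^ b)) \<in> borel_measurable dA" by (rule bounded_symbol_measurable)
  show ?thesis
  proof (rule integral_dA_eq_0_rotation[OF m, of "int a - int b"])
    fix w z assume w: "cmod w = 1" and "z \<in> unit_disk"
    then have "f (w * z) = f z" by (rule radial_rotate[OF f(2)])
    moreover have "cnj w = inverse w"
      using w by (metis complex_norm_square inverse_unique of_real_1 one_power2)
    moreover have "w \<noteq> 0" using w by auto
    ultimately show "f (w * z) * ((w * z) ^ a * cnj (w * z) ^ b) = w powi (int a - int b) * (f z * (z ^ a * cnj z ^ b))"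
      by (simp add: power_mult_distrib power_int_diff power_inverse divide_inverse)
  qed (use False in simp)
qed

text \<open>The factor \<open>G\<close> carries the product case of the induction: the hypothesis
  for \<open>P\<close> is applied to \<open>Q * G\<close>. The quantification over all monomials
  absorbs the degree that the linear case adds.\<close>

lemma orthogonal_polynomial:
  assumes f: "bounded_symbol f"
    and P: "real_polynomial_function P"
    and G: "bounded_symbol G" "\<And>a b. (LINT z|dA. f z * G z * (z ^ a * cnj z ^ b)) = 0"
  shows "bounded_symbol (\<lambda>z. of_real (P z) * G z) \<and>
    (\<forall>a b. (LINT z|dA. f z * (of_real (P z) * G z) * (z ^ a * cnj z ^ b)) = 0)"
  using P G
proof (induction P arbitrary: G rule: real_polynomial_function.induct)
  case (linear P)
  \<comment> \<open>A real-linear real-valued map has the form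
    \<open>\<alpha> * z + cnj (\<alpha> * z)\<close>; its values at 1 and \<open>\<i>\<close>
    determine \<open>\<alpha>\<close>.\<close>
  define \<alpha> where "\<alpha> = (of_real (P 1) - \<i> * of_real (P \<i>)) / 2"
  have P: "of_real (P z) = \<alpha> * z + cnj \<alpha> * cnj z" for z
  proof -
    have "P z = P (Re z *\<^sub>R 1 + Im z *\<^sub>R \<i>)"
      by (rule arg_cong[where f=P]) (simp add: complex_eq_iff)
    also have "\<dots> = Re z * P 1 + Im z * P \<i>"
      using bounded_linear.linear[OF linear(1)] by (simp only: linear_add linear_cmul real_scaleR_def)
    finally have "P z = Re z * P 1 + Im z * P \<i>" .
    then show ?thesis by (simp add: \<alpha>_def complex_eq_iff diff_divide_distrib)
  qed
  have bP: "bounded_symbol (\<lambda>z. of_real (P z))"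
    unfolding P by (intro bounded_symbol_continuous continuous_intros)
  have bm: "bounded_symbol (\<lambda>z. z ^ a * cnj z ^ b)" for a b
    by (intro bounded_symbol_continuous continuous_intros)
  have int: "integrable dA (\<lambda>z. f z * G z * (z ^ a * cnj z ^ b))" for a b
    by (intro bounded_symbol_integrable bounded_symbol_mult f linear bm)
  have "(LINT z|dA. f z * (of_real (P z) * G z) * (z ^ a * cnj z ^ b)) = 0" for a b
  proof -
    have "(LINT z|dA. f z * (of_real (P z) * G z) * (z ^ a * cnj z ^ b)) =
      (LINT z|dA. \<alpha> * (f z * G z * (z ^ Suc a * cnj z ^ b)) + cnj \<alpha> * (f z * G z * (z ^ a * cnj z ^ Suc b)))"
      unfolding P by (rule arg_cong[where f="integral\<^sup>L dA"]) (auto simp: algebra_simps)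
    also have "\<dots> = \<alpha> * (LINT z|dA. f z * G z * (z ^ Suc a * cnj z ^ b)) + cnj \<alpha> * (LINT z|dA. f z * G z * (z ^ a * cnj z ^ Suc b))"
      by (subst Bochner_Integration.integral_add) (intro integrable_mult_right int, intro integrable_mult_right int, simp)
    also have "\<dots> = 0" by (simp only: linear.prems(2)) simp
    finally show ?thesis .
  qed
  with bounded_symbol_mult[OF bP linear.prems(1)] show ?case by simp
next
  case (const c)
  have "(LINT z|dA. f z * (of_real c * G z) * (z ^ a * cnj z ^ b)) = of_real c * (LINT z|dA. f z * G z * (z ^ a * cnj z ^ b))" for a b
    by (subst integral_mult_right_zero[symmetric]) (simp add: mult_ac)
  then show ?case
    using bounded_symbol_mult[OF bounded_symbol_const const(1)] const by simp
next
  case (add P Q)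
  note P = add.IH(1)[OF add.prems] and Q = add.IH(2)[OF add.prems]
  have bm: "bounded_symbol (\<lambda>z. z ^ a * cnj z ^ b)" for a b
    by (intro bounded_symbol_continuous continuous_intros)
  have "(LINT z|dA. f z * (of_real (P z + Q z) * G z) * (z ^ a * cnj z ^ b)) = 0" for a b
  proof -
    have "(LINT z|dA. f z * (of_real (P z + Q z) * G z) * (z ^ a * cnj z ^ b)) =
      (LINT z|dA. f z * (of_real (P z) * G z) * (z ^ a * cnj z ^ b) + f z * (of_real (Q z) * G z) * (z ^ a * cnj z ^ b))"
      by (simp add: algebra_simps)
    also have "\<dots> = 0"
      using P Q by (subst Bochner_Integration.integral_add)
        (auto intro!: bounded_symbol_integrable bounded_symbol_mult f bm)
    finally show ?thesis .
  qed
  moreover have "bounded_symbol (\<lambda>z. of_real (P z + Q z) * G z)"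
    using bounded_symbol_add[of "\<lambda>z. of_real (P z) * G z" "\<lambda>z. of_real (Q z) * G z"] P Q
    by (simp add: algebra_simps)
  ultimately show ?case by simp
next
  case (mult P Q)
  note Q = mult.IH(2)[OF mult.prems]
  have "bounded_symbol (\<lambda>z. of_real (P z) * (of_real (Q z) * G z)) \<and>
    (\<forall>a b. (LINT z|dA. f z * (of_real (P z) * (of_real (Q z) * G z)) * (z ^ a * cnj z ^ b)) = 0)"
    by (rule mult.IH(1)) (use Q in auto)
  then show ?case by (simp add: mult.assoc)
qed

lemma orthogonal_continuous_real:
  fixes G :: "complex \<Rightarrow> real"
  assumes f: "bounded_symbol f" and z: "\<And>a b. (LINT z|dA. f z * (z ^ a * cnj z ^ b)) = 0"
    and G: "continuous_on (cball 0 1) G"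
  shows "(LINT z|dA. f z * of_real (G z)) = 0"
proof -
  obtain C where C: "C \<ge> 0" "\<And>z. z \<in> unit_disk \<Longrightarrow> cmod (f z) \<le> C" using bounded_symbolE[OF f] by blast
  have bG: "bounded_symbol (\<lambda>z. of_real (G z))"
    by (intro bounded_symbol_continuous continuous_intros G)
  have "cmod (LINT z|dA. f z * of_real (G z)) \<le> 0 + e" if e: "e > 0" for e
  proof -
    \<comment> \<open>The tolerance is divided by \<open>C + 1\<close> rather than \<open>C\<close>
      because \<open>C\<close> may be 0.\<close>
    obtain P where P: "real_polynomial_function P" "\<And>z. z \<in> cball 0 1 \<Longrightarrow> \<bar>G z - P z\<bar> < e / (C + 1)"
      using Stone_Weierstrass_real_polynomial_function[of "cball 0 1 :: complex set" G "e / (C + 1)"] G e C(1)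
      by auto
    have "bounded_symbol (\<lambda>z. of_real (P z) * 1) \<and>
      (\<forall>a b. (LINT z|dA. f z * (of_real (P z) * 1) * (z ^ a * cnj z ^ b)) = 0)"
      by (rule orthogonal_polynomial[OF f P(1)]) (auto intro: bounded_symbol_const simp: z)
    then have bP: "bounded_symbol (\<lambda>z. of_real (P z))"
      and P0: "(LINT z|dA. f z * of_real (P z)) = 0"
      by (auto dest!: spec[of _ 0])
    have "(LINT z|dA. f z * of_real (G z)) = (LINT z|dA. f z * of_real (G z) - f z * of_real (P z))"
      using P0 by (subst Bochner_Integration.integral_diff)
        (auto intro!: bounded_symbol_integrable bounded_symbol_mult f bG bP)
    also have "cmod \<dots> \<le> (LINT z|dA. cmod (f z * of_real (G z) - f z * of_real (P z)))"
      by (rule integral_norm_bound)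
    also have "\<dots> \<le> (LINT z|dA. e)"
    proof (rule integral_mono)
      show "integrable dA (\<lambda>z. cmod (f z * of_real (G z) - f z * of_real (P z)))"
        by (intro integrable_norm Bochner_Integration.integrable_diff bounded_symbol_integrable bounded_symbol_mult f bG bP)
      show "cmod (f z * of_real (G z) - f z * of_real (P z)) \<le> e" if "z \<in> space dA" for z
      proof -
        have "z \<in> cball 0 1" using that by (simp add: in_disk_iff)
        have "cmod (f z * of_real (G z) - f z * of_real (P z)) = cmod (f z) * \<bar>G z - P z\<bar>"
          by (simp flip: right_diff_distrib of_real_diff add: norm_mult)
        also have "\<dots> \<le> C * (e / (C + 1))"
          using C(2)[of z] P(2)[OF \<open>z \<in> cball 0 1\<close>] that C(1) by (intro mult_mono) auto
        also have "\<dots> \<le> e" using C(1) e by (simp add: field_simps)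
        finally show ?thesis .
      qed
    qed simp
    finally show ?thesis by simp
  qed
  then have "cmod (LINT z|dA. f z * of_real (G z)) \<le> 0" by (rule field_le_epsilon)
  then show ?thesis by simp
qed

lemma orthogonal_continuous:
  assumes f: "bounded_symbol f" and z: "\<And>a b. (LINT z|dA. f z * (z ^ a * cnj z ^ b)) = 0"
    and G: "continuous_on (cball 0 1) G"
  shows "(LINT z|dA. f z * G z) = 0"
proof -
  have c: "continuous_on (cball 0 1) (\<lambda>z. Re (G z))" "continuous_on (cball 0 1) (\<lambda>z. Im (G z))"
    using G by (auto intro!: continuous_intros)
  have "(LINT z|dA. f z * G z) = (LINT z|dA. f z * of_real (Re (G z)) + \<i> * (f z * of_real (Im (G z))))"
    by (rule Bochner_Integration.integral_cong) (auto simp: complex_eq_iff algebra_simps)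
  also have "\<dots> = 0"
    using orthogonal_continuous_real[OF f z c(1)] orthogonal_continuous_real[OF f z c(2)]
    by (subst Bochner_Integration.integral_add)
      (auto intro!: bounded_symbol_integrable bounded_symbol_mult f bounded_symbol_continuous[of "\<lambda>z. of_real (_ z)"] c continuous_on_of_real integrable_mult_right)
  finally show ?thesis .
qed

text \<open>A measurable function is an almost everywhere limit of continuous ones. Once these are
  truncated to a bound of \<open>f\<close>, dominated convergence allows \<open>f\<close> to be
  tested against its own conjugate, so the integral of \<open>|f|^2\<close> is 0.\<close>

lemma AE_eq_0_if_orthogonal_continuous:
  assumes f: "bounded_symbol f" and z: "\<And>G. continuous_on (cball 0 1) G \<Longrightarrow> (LINT z|dA. f z * G z) = 0"
  shows "AE z in dA. f z = 0"
proof -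
  obtain C0 where C0: "C0 \<ge> 0" "\<And>z. z \<in> unit_disk \<Longrightarrow> cmod (f z) \<le> C0" using bounded_symbolE[OF f] by blast
  define C where "C = C0 + 1"
  have C: "C > 0" "\<And>z. z \<in> unit_disk \<Longrightarrow> cmod (f z) \<le> C" using C0 by (auto simp: C_def add_increasing2)
  have fm: "f \<in> borel_measurable dA" by (rule bounded_symbol_measurable[OF f])
  then have "f measurable_on unit_disk"
    by (simp add: measurable_on_iff_borel_measurable borel_measurable_dA_iff)
  then obtain N g where N: "negligible N" and g: "\<And>n. continuous_on UNIV (g n)"
    and lim: "\<And>z. z \<notin> N \<Longrightarrow> (\<lambda>n. g n z) \<longlonglongrightarrow> (if z \<in> unit_disk then f z else 0)"
    unfolding measurable_on_def by metis
  have "AE z in lebesgue. z \<notin> N"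
    using N by (auto simp: negligible_iff_null_sets intro: AE_not_in)
  then have "AE z in lebesgue_on unit_disk. z \<notin> N"
    by (subst AE_restrict_space_iff) auto
  then have AEN: "AE z in dA. z \<notin> N"
    unfolding dA_def by (auto simp: eventually_ae_filter null_sets_def space_scale_measure)
  \<comment> \<open>Radial truncation of \<open>g n\<close> to modulus at most \<open>C\<close>,
    followed by conjugation. Truncation fixes the values of modulus at most \<open>C\<close>, so the
    limit is still \<open>cnj (f z)\<close>.\<close>
  define h where "h = (\<lambda>n z. cnj (of_real (C / max C (cmod (g n z))) * g n z))"
  have hc: "continuous_on (cball 0 1) (h n)" for n
    unfolding h_def using C(1) continuous_on_subset[OF g[of n]]
    by (intro continuous_intros) (auto simp: max_def)
  have hb: "cmod (h n z) \<le> C" for n z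
  proof -
    have "C * cmod (g n z) \<le> C * max C (cmod (g n z))" using C(1) by (intro mult_left_mono) auto
    moreover have "max C (cmod (g n z)) > 0" using C(1) by simp
    ultimately show ?thesis
      unfolding h_def complex_mod_cnj norm_mult norm_of_real using C(1) by (simp add: divide_le_eq)
  qed
  have "(\<lambda>n. LINT z|dA. f z * h n z) \<longlonglongrightarrow> (LINT z|dA. f z * cnj (f z))"
  proof (rule integral_dominated_convergence[where w="\<lambda>_. C * C"])
    show "(\<lambda>z. f z * cnj (f z)) \<in> borel_measurable dA" by (intro measurable_mult_cnj fm)
    show "(\<lambda>z. f z * h n z) \<in> borel_measurable dA" for n
      by (intro bounded_symbol_measurable bounded_symbol_mult f bounded_symbol_continuous hc)
    show "AE z in dA. cmod (f z * h n z) \<le> C * C" for n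
      using C hb unfolding norm_mult by (intro AE_I2 mult_mono) auto
    show "AE z in dA. (\<lambda>n. f z * h n z) \<longlonglongrightarrow> f z * cnj (f z)"
    proof (use AEN AE_space in eventually_elim)
      fix z assume z: "z \<notin> N" "z \<in> space dA"
      then have l: "(\<lambda>n. g n z) \<longlonglongrightarrow> f z" using lim[of z] by simp
      have "(\<lambda>n. h n z) \<longlonglongrightarrow> cnj (of_real (C / max C (cmod (f z))) * f z)"
        unfolding h_def using C(1) by (intro tendsto_intros l) (auto simp: max_def)
      moreover have "max C (cmod (f z)) = C" using C(2)[of z] z by (simp add: max_def)
      ultimately show "(\<lambda>n. f z * h n z) \<longlonglongrightarrow> f z * cnj (f z)"
        using C(1) by (intro tendsto_intros) simp
    qed
  qed auto
  then have "L2_inner f f = 0"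
    unfolding L2_inner_def using z[OF hc] by (simp add: LIMSEQ_const_iff)
  then have "(LINT z|dA. (cmod (f z))\<^sup>2) = 0" by (simp add: L2_inner_self)
  moreover have "f \<in> L2" by (rule L2_bounded[OF fm C(2)])
  ultimately have "AE z in dA. (cmod (f z))\<^sup>2 = 0"
    using integral_nonneg_eq_0_iff_AE[OF L2_integrable_square] by auto
  then show ?thesis by simp
qed

lemma radial_AE_eq_0:
  assumes f: "bounded_symbol f" "radial f" and z: "\<And>k. moment f (of_nat k) = 0"
  shows "AE z in dA. f z = 0"
proof (rule AE_eq_0_if_orthogonal_continuous[OF f(1)], rule orthogonal_continuous[OF f(1)])
  show "(LINT z|dA. f z * (z ^ a * cnj z ^ b)) = 0" for a b
    by (rule radial_orthogonal_monomials[OF f]) (simp only: z flip: moment_of_nat[OF f(1)])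
qed

section \<open>Harmonic functions and the projection onto \<open>L\<^sup>2\<^sub>h\<close>\<close>

text \<open>The second difference over a square is symmetric in the two variables. The mean value
  theorem in \<open>x\<close> and then in \<open>y\<close> turns it into one mixed derivative;
  exchanging the arguments of \<open>W\<close> yields the other.\<close>

lemma mixed_difference_MVT:
  fixes W :: "real \<Rightarrow> real \<Rightarrow> real"
  assumes h: "h > 0"
    and d1: "\<And>x y. x \<in> {a..a+h} \<Longrightarrow> y \<in> {b..b+h} \<Longrightarrow> ((\<lambda>x. W x y) has_real_derivative Wx x y) (at x)"
    and d2: "\<And>x y. x \<in> {a..a+h} \<Longrightarrow> y \<in> {b..b+h} \<Longrightarrow> ((\<lambda>y. Wx x y) has_real_derivative Wxy x y) (at y)"
  obtains \<xi> \<eta> where "\<xi> \<in> {a..a+h}" "\<eta> \<in> {b..b+h}"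
    "W (a+h) (b+h) - W (a+h) b - W a (b+h) + W a b = h * h * Wxy \<xi> \<eta>"
proof -
  have "\<exists>\<xi>>a. \<xi> < a + h \<and> (W (a+h) (b+h) - W (a+h) b) - (W a (b+h) - W a b) = (a + h - a) * (Wx \<xi> (b+h) - Wx \<xi> b)"
    by (rule MVT2) (use h in \<open>auto intro!: derivative_intros d1\<close>)
  then obtain \<xi> where x: "\<xi> > a" "\<xi> < a + h"
    "(W (a+h) (b+h) - W (a+h) b) - (W a (b+h) - W a b) = h * (Wx \<xi> (b+h) - Wx \<xi> b)" by auto
  have "\<exists>\<eta>>b. \<eta> < b + h \<and> Wx \<xi> (b+h) - Wx \<xi> b = (b + h - b) * Wxy \<xi> \<eta>"
    by (rule MVT2) (use h x in \<open>auto intro!: d2\<close>)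
  then obtain \<eta> where y: "\<eta> > b" "\<eta> < b + h" "Wx \<xi> (b+h) - Wx \<xi> b = h * Wxy \<xi> \<eta>" by auto
  show ?thesis
    by (rule that[of \<xi> \<eta>]) (use x y in auto)
qed

text \<open>The mean value theorem is about real functions, hence the functional \<open>L\<close>,
  which is later \<open>Re\<close> or \<open>Im\<close>.\<close>

lemma has_partials_on_line:
  assumes L: "bounded_linear (L :: complex \<Rightarrow> real)" and u: "has_partials_on u ux uy S" and z: "Complex x y \<in> S"
  shows "((\<lambda>x. L (u (Complex x y))) has_real_derivative L (ux (Complex x y))) (at x)"
    and "((\<lambda>y. L (u (Complex x y))) has_real_derivative L (uy (Complex x y))) (at y)"
proof -
  have d: "(u has_derivative (\<lambda>h. Re h *\<^sub>R ux (Complex x y) + Im h *\<^sub>R uy (Complex x y))) (at (Complex x y))"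
    using u z by (simp add: has_partials_on_def)
  have X: "((\<lambda>x. Complex x y) has_derivative (\<lambda>t. of_real t)) (at x)"
    unfolding Complex_eq by (auto intro!: derivative_eq_intros)
  have Y: "((\<lambda>y. Complex x y) has_derivative (\<lambda>t. \<i> * of_real t)) (at y)"
    unfolding Complex_eq by (auto intro!: derivative_eq_intros)
  have "((\<lambda>x. u (Complex x y)) has_derivative (\<lambda>t. t *\<^sub>R ux (Complex x y))) (at x)"
    using has_derivative_compose[OF X d] by simp
  from bounded_linear.has_derivative[OF L this]
  show "((\<lambda>x. L (u (Complex x y))) has_real_derivative L (ux (Complex x y))) (at x)"
    unfolding has_field_derivative_def
    by (rule has_derivative_eq_rhs) (simp add: fun_eq_iff linear_cmul[OF bounded_linear.linear[OF L]])
  have "((\<lambda>y. u (Complex x y)) has_derivative (\<lambda>t. t *\<^sub>R uy (Complex x y))) (at y)"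
    using has_derivative_compose[OF Y d] by simp
  from bounded_linear.has_derivative[OF L this]
  show "((\<lambda>y. L (u (Complex x y))) has_real_derivative L (uy (Complex x y))) (at y)"
    unfolding has_field_derivative_def
    by (rule has_derivative_eq_rhs) (simp add: fun_eq_iff linear_cmul[OF bounded_linear.linear[OF L]])
qed

text \<open>Schwarz's theorem. Both orders of differentiation evaluate the same second difference,
  so every small square with corner \<open>z\<close> contains a point for \<open>uxy\<close> and a
  point for \<open>uyx\<close> where \<open>L\<close> takes equal values; continuity carries the
  equality to \<open>z\<close>.\<close>

lemma mixed_partials_linear_eq:
  assumes L: "bounded_linear (L :: complex \<Rightarrow> real)" and S: "open S" "z \<in> S"
    and u: "has_partials_on u ux uy S" "has_partials_on ux uxx uxy S" "has_partials_on uy uyx uyy S"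
    and c: "continuous_on S uxy" "continuous_on S uyx"
  shows "L (uxy z) = L (uyx z)"
proof (rule ccontr)
  assume "L (uxy z) \<noteq> L (uyx z)"
  then have e: "\<bar>L (uxy z) - L (uyx z)\<bar> / 2 > 0" (is "?e > 0") by simp
  have cL: "isCont (\<lambda>w. L (uxy w)) z" "isCont (\<lambda>w. L (uyx w)) z"
    using c S by (auto intro!: bounded_linear.isCont[OF L] continuous_on_interior simp: interior_open)
  obtain d1 where d1: "d1 > 0" "\<And>w. dist w z < d1 \<Longrightarrow> \<bar>L (uxy w) - L (uxy z)\<bar> < ?e"
    using cL(1)[unfolded continuous_at_eps_delta, rule_format, OF e] by (auto simp: dist_norm)
  obtain d2 where d2: "d2 > 0" "\<And>w. dist w z < d2 \<Longrightarrow> \<bar>L (uyx w) - L (uyx z)\<bar> < ?e"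
    using cL(2)[unfolded continuous_at_eps_delta, rule_format, OF e] by (auto simp: dist_norm)
  obtain r where r: "r > 0" "ball z r \<subseteq> S" using S by (auto elim: openE)
  \<comment> \<open>Points of the square with side \<open>h\<close> and corner \<open>z\<close> are
    at distance at most \<open>2 * h\<close> from \<open>z\<close>, so a third of the smallest
    radius keeps them strictly inside.\<close>
  define h where "h = min r (min d1 d2) / 3"
  have h: "h > 0" "3 * h \<le> r" "3 * h \<le> d1" "3 * h \<le> d2" using r d1 d2 by (auto simp: h_def)
  have sq: "dist (Complex x y) z < 3 * h" if "x \<in> {Re z..Re z + h}" "y \<in> {Im z..Im z + h}" for x y
  proof -
    have "dist (Complex x y) z \<le> \<bar>x - Re z\<bar> + \<bar>y - Im z\<bar>"
      using cmod_le[of "Complex x y - z"] by (simp add: dist_norm)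
    then show ?thesis using that h(1) by auto
  qed
  have inS: "Complex x y \<in> S" if "x \<in> {Re z..Re z + h}" "y \<in> {Im z..Im z + h}" for x y
    using sq[OF that] h r by (auto simp: dist_commute)
  define W where "W = (\<lambda>x y. L (u (Complex x y)))"
  obtain \<xi> \<eta> where 1: "\<xi> \<in> {Re z..Re z+h}" "\<eta> \<in> {Im z..Im z+h}"
    "W (Re z+h) (Im z+h) - W (Re z+h) (Im z) - W (Re z) (Im z+h) + W (Re z) (Im z) = h * h * L (uxy (Complex \<xi> \<eta>))"
    by (rule mixed_difference_MVT[OF h(1), of "Re z" "Im z" W "\<lambda>x y. L (ux (Complex x y))" "\<lambda>x y. L (uxy (Complex x y))"])
      (use has_partials_on_line[OF L u(1) inS] has_partials_on_line[OF L u(2) inS] in \<open>auto simp: W_def\<close>)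
  obtain \<eta>' \<xi>' where 2: "\<eta>' \<in> {Im z..Im z+h}" "\<xi>' \<in> {Re z..Re z+h}"
    "W (Re z+h) (Im z+h) - W (Re z) (Im z+h) - W (Re z+h) (Im z) + W (Re z) (Im z) = h * h * L (uyx (Complex \<xi>' \<eta>'))"
    by (rule mixed_difference_MVT[OF h(1), of "Im z" "Re z" "\<lambda>y x. W x y" "\<lambda>y x. L (uy (Complex x y))" "\<lambda>y x. L (uyx (Complex x y))"])
      (use has_partials_on_line[OF L u(1) inS] has_partials_on_line[OF L u(3) inS] in \<open>auto simp: W_def\<close>)
  have "h * h * L (uxy (Complex \<xi> \<eta>)) = h * h * L (uyx (Complex \<xi>' \<eta>'))"
    using 1(3) 2(3) by linarith
  then have "L (uxy (Complex \<xi> \<eta>)) = L (uyx (Complex \<xi>' \<eta>'))" using h(1) by simp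
  moreover have "\<bar>L (uxy (Complex \<xi> \<eta>)) - L (uxy z)\<bar> < ?e"
    by (rule d1(2)) (use sq[OF 1(1,2)] h in linarith)
  moreover have "\<bar>L (uyx (Complex \<xi>' \<eta>')) - L (uyx z)\<bar> < ?e"
    by (rule d2(2)) (use sq[OF 2(2,1)] h in linarith)
  ultimately show False by (simp add: abs_if split: if_splits)
qed

lemma mixed_partials_eq:
  assumes "open S" "z \<in> S"
    and "has_partials_on u ux uy S" "has_partials_on ux uxx uxy S" "has_partials_on uy uyx uyy S"
    and "continuous_on S uxy" "continuous_on S uyx"
  shows "uxy z = uyx z"
  using mixed_partials_linear_eq[OF bounded_linear_Re assms] mixed_partials_linear_eq[OF bounded_linear_Im assms]
  by (simp add: complex_eq_iff)

section \<open>Closure properties of harmonic functions\<close>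

lemma has_partials_on_lincomb:
  assumes "has_partials_on u ux uy S" "has_partials_on v vx vy S"
  shows "has_partials_on (\<lambda>z. u z + c * v z) (\<lambda>z. ux z + c * vx z) (\<lambda>z. uy z + c * vy z) S"
  unfolding has_partials_on_def
proof
  fix z assume "z \<in> S"
  then have "(u has_derivative (\<lambda>h. Re h *\<^sub>R ux z + Im h *\<^sub>R uy z)) (at z)"
    "(v has_derivative (\<lambda>h. Re h *\<^sub>R vx z + Im h *\<^sub>R vy z)) (at z)"
    using assms by (auto simp: has_partials_on_def)
  then have "((\<lambda>z. u z + c * v z) has_derivative
     (\<lambda>h. (Re h *\<^sub>R ux z + Im h *\<^sub>R uy z) + c * (Re h *\<^sub>R vx z + Im h *\<^sub>R vy z))) (at z)"
    by (intro has_derivative_add has_derivative_mult_right)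
  then show "((\<lambda>z. u z + c * v z) has_derivative (\<lambda>h. Re h *\<^sub>R (ux z + c * vx z) + Im h *\<^sub>R (uy z + c * vy z))) (at z)"
    by (rule has_derivative_eq_rhs) (auto simp: algebra_simps)
qed

lemma has_partials_on_cnj:
  assumes "has_partials_on u ux uy S"
  shows "has_partials_on (\<lambda>z. cnj (u z)) (\<lambda>z. cnj (ux z)) (\<lambda>z. cnj (uy z)) S"
  unfolding has_partials_on_def
proof
  fix z assume "z \<in> S"
  then have "(u has_derivative (\<lambda>h. Re h *\<^sub>R ux z + Im h *\<^sub>R uy z)) (at z)"
    using assms by (auto simp: has_partials_on_def)
  from bounded_linear.has_derivative[OF bounded_linear_cnj this]
  show "((\<lambda>z. cnj (u z)) has_derivative (\<lambda>h. Re h *\<^sub>R cnj (ux z) + Im h *\<^sub>R cnj (uy z))) (at z)"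
    by (rule has_derivative_eq_rhs) auto
qed

lemma has_partials_on_cong:
  assumes "open S" "\<And>z. z \<in> S \<Longrightarrow> u z = v z"
  shows "has_partials_on u ux uy S \<longleftrightarrow> has_partials_on v ux uy S"
proof -
  have "(u has_derivative D) (at z) \<longleftrightarrow> (v has_derivative D) (at z)" if "z \<in> S" for D z
    using has_derivative_transform_within_open[OF _ assms(1) that] assms(2) by metis
  then show ?thesis unfolding has_partials_on_def by auto
qed

lemma harmonic_on_cong:
  assumes "\<And>z. z \<in> S \<Longrightarrow> u z = v z"
  shows "harmonic_on u S \<longleftrightarrow> harmonic_on v S"
proof (cases "open S")
  case True
  have "has_partials_on u ux uy S \<longleftrightarrow> has_partials_on v ux uy S" for ux uy
    by (rule has_partials_on_cong[OF True assms])
  then show ?thesis by (simp add: harmonic_on_def)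
qed (simp add: harmonic_on_def)

lemma harmonic_onI:
  assumes "open S" "has_partials_on u ux uy S" "has_partials_on ux uxx uxy S" "has_partials_on uy uyx uyy S"
    "continuous_on S uxx" "continuous_on S uxy" "continuous_on S uyx" "continuous_on S uyy"
    "\<And>z. z \<in> S \<Longrightarrow> uxx z + uyy z = 0"
  shows "harmonic_on u S"
  unfolding harmonic_on_def using assms by blast

lemma harmonic_on_lincomb:
  assumes "harmonic_on u S" "harmonic_on v S"
  shows "harmonic_on (\<lambda>z. u z + c * v z) S"
proof -
  obtain ux uy uxx uxy uyx uyy where u: "open S" "has_partials_on u ux uy S" "has_partials_on ux uxx uxy S"
    "has_partials_on uy uyx uyy S" "continuous_on S uxx" "continuous_on S uxy" "continuous_on S uyx" "continuous_on S uyy"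
    "\<forall>z\<in>S. uxx z + uyy z = 0"
    using assms(1) unfolding harmonic_on_def by blast
  obtain vx vy vxx vxy vyx vyy where v: "has_partials_on v vx vy S" "has_partials_on vx vxx vxy S"
    "has_partials_on vy vyx vyy S" "continuous_on S vxx" "continuous_on S vxy" "continuous_on S vyx" "continuous_on S vyy"
    "\<forall>z\<in>S. vxx z + vyy z = 0"
    using assms(2) unfolding harmonic_on_def by blast
  have "(uxx z + c * vxx z) + (uyy z + c * vyy z) = 0" if "z \<in> S" for z
  proof -
    have "(uxx z + c * vxx z) + (uyy z + c * vyy z) = (uxx z + uyy z) + c * (vxx z + vyy z)"
      by (simp add: algebra_simps)
    then show ?thesis using u(9) v(8) that by simp
  qed
  then show ?thesis
    by (intro harmonic_onI[OF u(1) has_partials_on_lincomb[OF u(2) v(1)]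
        has_partials_on_lincomb[OF u(3) v(2)] has_partials_on_lincomb[OF u(4) v(3)]]
        continuous_on_add continuous_on_mult_left u v)
qed

lemma harmonic_on_cnj:
  assumes "harmonic_on u S"
  shows "harmonic_on (\<lambda>z. cnj (u z)) S"
proof -
  obtain ux uy uxx uxy uyx uyy where u: "open S" "has_partials_on u ux uy S" "has_partials_on ux uxx uxy S"
    "has_partials_on uy uyx uyy S" "continuous_on S uxx" "continuous_on S uxy" "continuous_on S uyx" "continuous_on S uyy"
    "\<forall>z\<in>S. uxx z + uyy z = 0"
    using assms unfolding harmonic_on_def by blast
  have "cnj (uxx z) + cnj (uyy z) = 0" if "z \<in> S" for z
    using u(9) that by (metis complex_cnj_add complex_cnj_zero)
  then show ?thesis
    by (intro harmonic_onI[OF u(1) has_partials_on_cnj[OF u(2)] has_partials_on_cnj[OF u(3)]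
        has_partials_on_cnj[OF u(4)]] continuous_on_cnj u)
qed

lemma has_partials_on_holomorphic:
  assumes "open S" "f holomorphic_on S"
  shows "has_partials_on f (deriv f) (\<lambda>z. \<i> * deriv f z) S"
  unfolding has_partials_on_def
proof
  fix z assume "z \<in> S"
  then have "(f has_field_derivative deriv f z) (at z)"
    using assms holomorphic_derivI by blast
  then show "(f has_derivative (\<lambda>h. Re h *\<^sub>R deriv f z + Im h *\<^sub>R (\<i> * deriv f z))) (at z)"
    unfolding has_field_derivative_def
    by (rule has_derivative_eq_rhs) (auto simp: complex_eq_iff algebra_simps)
qed

lemma harmonic_on_holomorphic:
  assumes S: "open S" and f: "f holomorphic_on S"
  shows "harmonic_on f S"
proof -
  have d: "deriv f holomorphic_on S" "deriv (deriv f) holomorphic_on S"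
    by (intro holomorphic_deriv f S)+
  have p1: "has_partials_on f (deriv f) (\<lambda>z. \<i> * deriv f z) S"
    by (rule has_partials_on_holomorphic[OF S f])
  have p2: "has_partials_on (deriv f) (deriv (deriv f)) (\<lambda>z. \<i> * deriv (deriv f) z) S"
    by (rule has_partials_on_holomorphic[OF S d(1)])
  have zero: "has_partials_on (\<lambda>z. 0) (\<lambda>z. 0) (\<lambda>z. 0) S"
    by (simp add: has_partials_on_def)
  have p3: "has_partials_on (\<lambda>z. \<i> * deriv f z) (\<lambda>z. \<i> * deriv (deriv f) z) (\<lambda>z. - deriv (deriv f) z) S"
    using has_partials_on_lincomb[OF zero p2, of \<i>] by (simp flip: mult.assoc)
  have c: "continuous_on S (deriv (deriv f))"
    by (rule holomorphic_on_imp_continuous_on[OF d(2)])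
  show ?thesis
    by (intro harmonic_onI[OF S p1 p2 p3] continuous_on_minus continuous_on_mult_left c) simp
qed

section \<open>Decomposition and power series expansion of harmonic functions\<close>

text \<open>For harmonic \<open>u\<close> the function \<open>u\<^sub>x - i u\<^sub>y\<close> (twice the Wirtinger derivative) is holomorphic.\<close>

lemma harmonic_Wirtinger_holomorphic:
  assumes u: "harmonic_on u S"
  obtains ux uy where "has_partials_on u ux uy S" "(\<lambda>z. ux z - \<i> * uy z) holomorphic_on S"
    "(\<lambda>z. cnj (ux z) - \<i> * cnj (uy z)) holomorphic_on S"
proof -
  \<comment> \<open>Stated for arbitrary functions because it is applied both to \<open>u\<close>
    and to its conjugate. Equality of the mixed derivatives together with \<open>uyy = - uxx\<close>
    gives the Cauchy-Riemann equations for \<open>ux - \<i> * uy\<close>.\<close>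
  have *: "(\<lambda>z. ux z + (- \<i>) * uy z) holomorphic_on S"
    if S: "open S" and u: "has_partials_on u ux uy S" "has_partials_on ux uxx uxy S" "has_partials_on uy uyx uyy S"
    and c: "continuous_on S uxy" "continuous_on S uyx" and L: "\<forall>z\<in>S. uxx z + uyy z = 0"
    for u ux uy uxx uxy uyx uyy
    unfolding holomorphic_on_def field_differentiable_def
  proof (intro ballI exI)
    fix z assume z: "z \<in> S"
    have xy: "uxy z = uyx z" by (rule mixed_partials_eq[OF S z u c])
    have yy: "uyy z = - uxx z" using L z by (simp add: eq_neg_iff_add_eq_0 add.commute)
    have "has_partials_on (\<lambda>z. ux z + (- \<i>) * uy z) (\<lambda>z. uxx z + (- \<i>) * uyx z) (\<lambda>z. uxy z + (- \<i>) * uyy z) S"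
      by (rule has_partials_on_lincomb[OF u(2,3)])
    then have "((\<lambda>z. ux z + (- \<i>) * uy z) has_derivative
        (\<lambda>h. Re h *\<^sub>R (uxx z + (- \<i>) * uyx z) + Im h *\<^sub>R (uxy z + (- \<i>) * uyy z))) (at z)"
      using z by (simp add: has_partials_on_def)
    then have "((\<lambda>z. ux z + (- \<i>) * uy z) has_derivative (*) (uxx z + (- \<i>) * uyx z)) (at z)"
      by (rule has_derivative_eq_rhs) (auto simp: xy yy complex_eq_iff algebra_simps)
    then show "((\<lambda>z. ux z + (- \<i>) * uy z) has_field_derivative (uxx z + (- \<i>) * uyx z)) (at z within S)"
      unfolding has_field_derivative_def by (rule has_derivative_at_withinI)
  qed
  obtain ux uy uxx uxy uyx uyy where u: "open S" "has_partials_on u ux uy S" "has_partials_on ux uxx uxy S"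
    "has_partials_on uy uyx uyy S" "continuous_on S uxx" "continuous_on S uxy" "continuous_on S uyx" "continuous_on S uyy"
    "\<forall>z\<in>S. uxx z + uyy z = 0"
    using assms unfolding harmonic_on_def by blast
  have "cnj (uxx z) + cnj (uyy z) = 0" if "z \<in> S" for z
    using u(9) that by (metis complex_cnj_add complex_cnj_zero)
  then have "(\<lambda>z. cnj (ux z) + (- \<i>) * cnj (uy z)) holomorphic_on S"
    by (intro *[OF u(1) has_partials_on_cnj[OF u(2)] has_partials_on_cnj[OF u(3)] has_partials_on_cnj[OF u(4)]]
      continuous_on_cnj u) auto
  moreover have "(\<lambda>z. ux z + (- \<i>) * uy z) holomorphic_on S"
    by (rule *[OF u(1-4,6,7,9)])
  ultimately show ?thesis using that[OF u(2)] by simp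
qed

text \<open>Primitives \<open>F\<close> and \<open>G\<close> of twice the Wirtinger derivatives of
  \<open>u\<close> and \<open>cnj u\<close> exist on the convex set. Then
  \<open>(F + cnj G) / 2\<close> has the same differential as \<open>u\<close>, so the two differ by
  a constant.\<close>

lemma harmonic_decomposition:
  assumes u: "harmonic_on u S" and S: "convex S" "open S" "0 \<in> S"
  obtains F G where "F holomorphic_on S" "G holomorphic_on S" "G 0 = 0"
    "\<And>z. z \<in> S \<Longrightarrow> u z = F z + cnj (G z)"
proof -
  obtain ux uy where p: "has_partials_on u ux uy S" and f: "(\<lambda>z. ux z - \<i> * uy z) holomorphic_on S"
    and g: "(\<lambda>z. cnj (ux z) - \<i> * cnj (uy z)) holomorphic_on S"
    using harmonic_Wirtinger_holomorphic[OF u] by blast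
  obtain F where F: "\<And>z. z \<in> S \<Longrightarrow> (F has_field_derivative (ux z - \<i> * uy z)) (at z within S)"
    using holomorphic_convex_primitive'[OF S(1,2) f] by blast
  obtain G where G: "\<And>z. z \<in> S \<Longrightarrow> (G has_field_derivative (cnj (ux z) - \<i> * cnj (uy z))) (at z within S)"
    using holomorphic_convex_primitive'[OF S(1,2) g] by blast
  have "\<exists>c. \<forall>z\<in>S. u z - (1 / 2) * (F z + cnj (G z)) = c"
  proof (rule has_derivative_zero_constant[OF S(1)])
    fix z assume z: "z \<in> S"
    have "(u has_derivative (\<lambda>h. Re h *\<^sub>R ux z + Im h *\<^sub>R uy z)) (at z within S)"
      using p z by (auto simp: has_partials_on_def intro: has_derivative_at_withinI)
    moreover have "(F has_derivative (\<lambda>h. (ux z - \<i> * uy z) * h)) (at z within S)"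
      using F[OF z] by (simp add: has_field_derivative_def)
    moreover have "((\<lambda>z. cnj (G z)) has_derivative (\<lambda>h. cnj ((cnj (ux z) - \<i> * cnj (uy z)) * h))) (at z within S)"
      using G[OF z] by (intro bounded_linear.has_derivative[OF bounded_linear_cnj]) (simp add: has_field_derivative_def)
    ultimately have "((\<lambda>z. u z - (1 / 2) * (F z + cnj (G z))) has_derivative
      (\<lambda>h. (Re h *\<^sub>R ux z + Im h *\<^sub>R uy z) - (1 / 2) * ((ux z - \<i> * uy z) * h + cnj ((cnj (ux z) - \<i> * cnj (uy z)) * h)))) (at z within S)"
      by (intro has_derivative_diff has_derivative_mult_right has_derivative_add)
    then show "((\<lambda>z. u z - (1 / 2) * (F z + cnj (G z))) has_derivative (\<lambda>h. 0)) (at z within S)"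
      by (rule has_derivative_eq_rhs) (auto simp: complex_eq_iff field_simps)
  qed
  then obtain c where c: "\<And>z. z \<in> S \<Longrightarrow> u z = (1 / 2) * (F z + cnj (G z)) + c" by (auto simp: algebra_simps)
  show ?thesis
  \<comment> \<open>The normalisation at 0 moves \<open>cnj (G 0) / 2\<close> into the holomorphic
    part, so that the constant term is counted once in the expansion.\<close>
  proof (rule that[of "\<lambda>z. (1 / 2) * F z + (c + cnj (G 0) / 2)" "\<lambda>z. (1 / 2) * (G z - G 0)"])
    have "F holomorphic_on S" "G holomorphic_on S"
      using F G unfolding holomorphic_on_def field_differentiable_def by blast+
    then show "(\<lambda>z. (1 / 2) * F z + (c + cnj (G 0) / 2)) holomorphic_on S" "(\<lambda>z. (1 / 2) * (G z - G 0)) holomorphic_on S"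
      by (auto intro!: holomorphic_intros)
    show "u z = (1 / 2) * F z + (c + cnj (G 0) / 2) + cnj ((1 / 2) * (G z - G 0))" if "z \<in> S" for z
      using c[OF that] by (simp add: algebra_simps diff_divide_distrib)
  qed simp
qed

lemma hpartial_symmetric:
  "hpartial c {- int N..int N} z =
    (\<Sum>i\<le>N. c (int i) * z ^ i) + (\<Sum>i<N. c (- int (Suc i)) * cnj z ^ Suc i)"
proof (induction N)
  case 0
  show ?case by (simp add: hpartial_def hmono_def)
next
  case (Suc N)
  have "{- int (Suc N)..int (Suc N)} = insert (int (Suc N)) (insert (- int (Suc N)) {- int N..int N})"
    by auto
  then have "hpartial c {- int (Suc N)..int (Suc N)} z =
    c (int (Suc N)) * hmono (int (Suc N)) z + (c (- int (Suc N)) * hmono (- int (Suc N)) z + hpartial c {- int N..int N} z)"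
    unfolding hpartial_def by simp
  then show ?case
    unfolding Suc.IH by (simp add: hmono_def nat_add_distrib)
qed

lemma sums_cnj_tail:
  assumes "(\<lambda>i. b (Suc i) * z ^ Suc i) sums s"
  shows "(\<lambda>i. cnj (b (Suc i)) * cnj z ^ Suc i) sums cnj s"
  using bounded_linear.sums[OF bounded_linear_cnj assms] by simp

lemma hpartial_tendsto:
  assumes A: "(\<lambda>i. c (int i) * z ^ i) sums F"
    and B: "(\<lambda>i. c (- int (Suc i)) * cnj z ^ Suc i) sums G"
  shows "(\<lambda>N. hpartial c {- int N..int N} z) \<longlonglongrightarrow> F + G"
  unfolding hpartial_symmetric
  using A[unfolded sums_def_le] B[unfolded sums_def] by (intro tendsto_add)

text \<open>The two parts of \<open>harmonic_decomposition\<close> have power series on the disk.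
  The second conclusion is their absolute convergence on smaller circles; it provides the constant
  that dominates the dilates in \<open>L2h_expansion\<close>.\<close>

lemma harmonic_expansion:
  assumes u: "harmonic_on u unit_disk"
  obtains c where
    "\<And>z. z \<in> unit_disk \<Longrightarrow> (\<lambda>N. hpartial c {- int N..int N} z) \<longlonglongrightarrow> u z"
    "\<And>\<rho>. 0 < \<rho> \<Longrightarrow> \<rho> < 1 \<Longrightarrow> \<exists>B. \<forall>N. (\<Sum>n\<in>{- int N..int N}. cmod (c n) * \<rho> ^ nat \<bar>n\<bar>) \<le> B"
proof -
  obtain F G where F: "F holomorphic_on unit_disk" and G: "G holomorphic_on unit_disk" and G0: "G 0 = 0"
    and FG: "\<And>z. z \<in> unit_disk \<Longrightarrow> u z = F z + cnj (G z)"
    using harmonic_decomposition[OF u] by (auto simp: unit_disk_def)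
  define a where "a = (\<lambda>n. (deriv ^^ n) F 0 / fact n)"
  define b where "b = (\<lambda>n. (deriv ^^ n) G 0 / fact n)"
  have a: "(\<lambda>n. a n * z ^ n) sums F z" if "z \<in> unit_disk" for z
    using holomorphic_power_series[of F 0 1 z] F that by (simp add: a_def unit_disk_def)
  have b: "(\<lambda>n. b n * z ^ n) sums G z" if "z \<in> unit_disk" for z
    using holomorphic_power_series[of G 0 1 z] G that by (simp add: b_def unit_disk_def)
  have b0: "b 0 = 0" by (simp add: b_def G0)
  have b': "(\<lambda>n. b (Suc n) * z ^ Suc n) sums G z" if "z \<in> unit_disk" for z
    using b[OF that] by (subst sums_Suc_iff) (simp add: b0)
  define c where "c = (\<lambda>n::int. if n \<ge> 0 then a (nat n) else cnj (b (nat (- n))))"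
  have c: "c (int i) = a i" "c (- int (Suc i)) = cnj (b (Suc i))" for i
    by (auto simp: c_def nat_add_distrib)
  show ?thesis
  proof (rule that[of c])
    show "(\<lambda>N. hpartial c {- int N..int N} z) \<longlonglongrightarrow> u z" if "z \<in> unit_disk" for z
      unfolding FG[OF that]
      by (rule hpartial_tendsto) (simp_all only: c a[OF that] sums_cnj_tail[OF b'[OF that]])
  next
    fix \<rho> :: real assume r: "0 < \<rho>" "\<rho> < 1"
    \<comment> \<open>A point strictly between \<open>\<rho>\<close> and 1: convergence there gives
      absolute convergence at \<open>\<rho>\<close>.\<close>
    define r' where "r' = complex_of_real ((\<rho> + 1) / 2)"
    have r': "r' \<in> unit_disk" "cmod (of_real \<rho>) < cmod r'"
      using r by (auto simp: r'_def in_disk_iff simp flip: of_real_add)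
    have sa: "summable (\<lambda>i. cmod (a i * of_real \<rho> ^ i))"
      by (rule powser_insidea[OF sums_summable[OF a[OF r'(1)]] r'(2)])
    have sb: "summable (\<lambda>i. cmod (b i * of_real \<rho> ^ i))"
      by (rule powser_insidea[OF sums_summable[OF b[OF r'(1)]] r'(2)])
    \<comment> \<open>With moduli as coefficients and \<open>\<rho>\<close> as argument the sum
      becomes an instance of \<open>hpartial\<close>, which \<open>hpartial_symmetric\<close>
      splits.\<close>
    define s where "s = (\<lambda>n::int. complex_of_real (cmod (c n)))"
    have "(\<Sum>n\<in>{- int N..int N}. cmod (c n) * \<rho> ^ nat \<bar>n\<bar>)
        \<le> (\<Sum>i. cmod (a i * of_real \<rho> ^ i)) + (\<Sum>i. cmod (b i * of_real \<rho> ^ i))" for N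
    proof -
      have "complex_of_real (\<Sum>n\<in>{- int N..int N}. cmod (c n) * \<rho> ^ nat \<bar>n\<bar>) = hpartial s {- int N..int N} (of_real \<rho>)"
        unfolding hpartial_def s_def of_real_sum by (rule sum.cong) (auto simp: hmono_def)
      also have "\<dots> = of_real ((\<Sum>i\<le>N. cmod (a i * of_real \<rho> ^ i)) + (\<Sum>i<N. cmod (b (Suc i) * of_real \<rho> ^ Suc i)))"
        unfolding hpartial_symmetric s_def c using r by (simp add: norm_mult norm_power)
      finally have "(\<Sum>n\<in>{- int N..int N}. cmod (c n) * \<rho> ^ nat \<bar>n\<bar>) =
          (\<Sum>i\<le>N. cmod (a i * of_real \<rho> ^ i)) + (\<Sum>i<N. cmod (b (Suc i) * of_real \<rho> ^ Suc i))"
        by (simp only: of_real_eq_iff)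
      also have "(\<Sum>i<N. cmod (b (Suc i) * of_real \<rho> ^ Suc i)) = (\<Sum>i<Suc N. cmod (b i * of_real \<rho> ^ i))"
        by (subst sum.lessThan_Suc_shift) (simp add: b0)
      also have "\<dots> \<le> (\<Sum>i. cmod (b i * of_real \<rho> ^ i))"
        by (rule sum_le_suminf[OF sb]) auto
      also have "(\<Sum>i\<le>N. cmod (a i * of_real \<rho> ^ i)) \<le> (\<Sum>i. cmod (a i * of_real \<rho> ^ i))"
        by (rule sum_le_suminf[OF sa]) auto
      finally show ?thesis by simp
    qed
    then show "\<exists>B. \<forall>N. (\<Sum>n\<in>{- int N..int N}. cmod (c n) * \<rho> ^ nat \<bar>n\<bar>) \<le> B" by blast
  qed
qed

section \<open>Norm convergent expansions in \<open>L2h\<close> and existence of the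
  projection\<close>

lemma has_partials_on_continuous: "has_partials_on u ux uy S \<Longrightarrow> continuous_on S u"
  unfolding has_partials_on_def
  by (meson continuous_at_imp_continuous_on has_derivative_continuous)

lemma harmonic_on_continuous: "harmonic_on u S \<Longrightarrow> continuous_on S u"
  unfolding harmonic_on_def using has_partials_on_continuous by blast

lemma L2h_L2: "u \<in> L2h \<Longrightarrow> u \<in> L2"
  and L2h_harmonic: "u \<in> L2h \<Longrightarrow> harmonic_on u unit_disk"
  and L2h_outside: "u \<in> L2h \<Longrightarrow> z \<notin> unit_disk \<Longrightarrow> u z = 0"
  by (auto simp: L2h_def)

lemma nn_integral_dA:
  assumes "f \<in> borel_measurable borel"
  shows "(\<integral>\<^sup>+z. f z \<partial>dA) = ennreal (1 / pi) * (\<integral>\<^sup>+z. f z * indicator unit_disk z \<partial>lborel)"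
proof -
  have "f \<in> borel_measurable (lebesgue_on unit_disk)"
    by (intro measurable_restrict_space1 measurable_completion) (use assms in simp)
  then have "(\<integral>\<^sup>+z. f z \<partial>dA) = ennreal (1 / pi) * (\<integral>\<^sup>+z. f z \<partial>lebesgue_on unit_disk)"
    unfolding dA_def by (rule nn_integral_scale_measure)
  also have "(\<integral>\<^sup>+z. f z \<partial>lebesgue_on unit_disk) = (\<integral>\<^sup>+z. f z * indicator unit_disk z \<partial>lebesgue)"
    by (subst nn_integral_restrict_space) auto
  finally show ?thesis by (simp add: nn_integral_completion)
qed

text \<open>The substitution \<open>z -> \<rho> z\<close> has Jacobian \<open>\<rho>^2\<close> and
  maps the disk into itself. As \<open>u\<close> vanishes off the disk, the comparison can be made
  over the whole plane, where \<open>lborel\<close> has a scaling law.\<close>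

lemma L2h_dilate:
  assumes u: "u \<in> L2h" and \<rho>: "0 < \<rho>" "\<rho> < 1"
  shows "\<rho>\<^sup>2 * (LINT z|dA. (cmod (u (of_real \<rho> * z)))\<^sup>2) \<le> (LINT z|dA. (cmod (u z))\<^sup>2)"
    and "(\<lambda>z. u (of_real \<rho> * z)) \<in> L2"
proof -
  have cont: "continuous_on unit_disk u" by (rule harmonic_on_continuous[OF L2h_harmonic[OF u]])
  have cc: "continuous_on (cball 0 1) (\<lambda>z. u (of_real \<rho> * z))"
  proof (rule continuous_on_compose2[OF cont])
    show "(\<lambda>z. complex_of_real \<rho> * z) ` cball 0 1 \<subseteq> unit_disk"
    proof safe
      fix z :: complex assume "z \<in> cball 0 1"
      then have "\<rho> * cmod z \<le> \<rho> * 1" using \<rho> by (intro mult_left_mono) auto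
      also have "\<dots> < 1" using \<rho> by simp
      finally show "of_real \<rho> * z \<in> unit_disk" using \<rho> by (simp add: in_disk_iff norm_mult)
    qed
  qed (intro continuous_intros)
  have bs: "bounded_symbol (\<lambda>z. u (of_real \<rho> * z))"
    by (rule bounded_symbol_continuous[OF cc])
  then obtain C where "\<And>z. z \<in> unit_disk \<Longrightarrow> cmod (u (of_real \<rho> * z)) \<le> C" using bounded_symbolE by blast
  then show L2: "(\<lambda>z. u (of_real \<rho> * z)) \<in> L2"
    by (intro L2_bounded[OF bounded_symbol_measurable[OF bs]])
  have "(\<lambda>z. if z \<in> unit_disk then u z else 0) \<in> borel_measurable borel"
    by (intro borel_measurable_continuous_on_if cont continuous_on_const) (simp add: unit_disk_def)
  moreover have "(\<lambda>z. if z \<in> unit_disk then u z else 0) = u" using L2h_outside[OF u] by auto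
  ultimately have ub[measurable]: "u \<in> borel_measurable borel" by simp
  define g where "g = (\<lambda>z. ennreal ((cmod (u z))\<^sup>2))"
  have gb[measurable]: "g \<in> borel_measurable borel" unfolding g_def by measurable
  have g0: "g z * indicator unit_disk z = g z" for z
    using L2h_outside[OF u] by (auto simp: g_def split: split_indicator)
  have [measurable]: "(\<lambda>z. g (of_real \<rho> * z)) \<in> borel_measurable borel" by measurable
  have "(\<integral>\<^sup>+z. g z \<partial>lborel) = (\<integral>\<^sup>+z. g z \<partial>density (distr lborel borel (\<lambda>x. 0 + \<rho> *\<^sub>R x)) (\<lambda>_. \<bar>\<rho>\<bar> ^ DIM(complex)))"
    using lborel_affine[of \<rho> "0::complex"] \<rho> by simp
  also have "\<dots> = (\<integral>\<^sup>+z. ennreal (\<rho>\<^sup>2) * g z \<partial>distr lborel borel (\<lambda>x::complex. \<rho> *\<^sub>R x))"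
    by (subst nn_integral_density) (auto simp: \<rho> )
  also have "\<dots> = ennreal (\<rho>\<^sup>2) * (\<integral>\<^sup>+z. g (of_real \<rho> * z) \<partial>lborel)"
    by (subst nn_integral_cmult, simp, subst nn_integral_distr) (auto simp: scaleR_conv_of_real)
  finally have scale: "(\<integral>\<^sup>+z. g z \<partial>lborel) = ennreal (\<rho>\<^sup>2) * (\<integral>\<^sup>+z. g (of_real \<rho> * z) \<partial>lborel)" .
  have "ennreal (\<rho>\<^sup>2) * (\<integral>\<^sup>+z. g (of_real \<rho> * z) \<partial>dA)
      = ennreal (1 / pi) * (ennreal (\<rho>\<^sup>2) * (\<integral>\<^sup>+z. g (of_real \<rho> * z) * indicator unit_disk z \<partial>lborel))"
    by (subst nn_integral_dA) (auto simp: mult_ac)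
  also have "\<dots> \<le> ennreal (1 / pi) * (ennreal (\<rho>\<^sup>2) * (\<integral>\<^sup>+z. g (of_real \<rho> * z) \<partial>lborel))"
    by (intro mult_left_mono nn_integral_mono) (auto split: split_indicator)
  also have "\<dots> = (\<integral>\<^sup>+z. g z \<partial>dA)"
    by (subst nn_integral_dA) (auto simp: g0 scale)
  finally have "ennreal (\<rho>\<^sup>2) * (\<integral>\<^sup>+z. g (of_real \<rho> * z) \<partial>dA) \<le> (\<integral>\<^sup>+z. g z \<partial>dA)" .
  moreover have "(\<integral>\<^sup>+z. g (of_real \<rho> * z) \<partial>dA) = ennreal (LINT z|dA. (cmod (u (of_real \<rho> * z)))\<^sup>2)"
    unfolding g_def by (rule nn_integral_eq_integral[OF L2_integrable_square[OF L2]]) simp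
  moreover have "(\<integral>\<^sup>+z. g z \<partial>dA) = ennreal (LINT z|dA. (cmod (u z))\<^sup>2)"
    unfolding g_def by (rule nn_integral_eq_integral[OF L2_integrable_square[OF L2h_L2[OF u]]]) simp
  ultimately have "ennreal (\<rho>\<^sup>2 * (LINT z|dA. (cmod (u (of_real \<rho> * z)))\<^sup>2)) \<le> ennreal (LINT z|dA. (cmod (u z))\<^sup>2)"
    by (simp add: ennreal_mult)
  then show "\<rho>\<^sup>2 * (LINT z|dA. (cmod (u (of_real \<rho> * z)))\<^sup>2) \<le> (LINT z|dA. (cmod (u z))\<^sup>2)"
    by (subst (asm) ennreal_le_iff) (auto intro!: integral_nonneg_AE)
qed

lemma hmono_scale: "hmono n (of_real \<rho> * z) = of_real (\<rho> ^ nat \<bar>n\<bar>) * hmono n z"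
  by (auto simp: hmono_def power_mult_distrib)

text \<open>Square summability of the coefficients comes from Bessel's inequality for the dilates
  \<open>z \<mapsto> u (\<rho> z)\<close>, whose expansion converges boundedly on the whole disk, by letting \<open>\<rho> \<rightarrow> 1\<close>.\<close>

lemma L2h_expansion:
  assumes u: "u \<in> L2h"
  obtains c where
    "\<And>z. z \<in> unit_disk \<Longrightarrow> (\<lambda>N. hpartial c {- int N..int N} z) \<longlonglongrightarrow> u z"
    "(\<lambda>N. LINT z|dA. (cmod (u z - hpartial c {- int N..int N} z))\<^sup>2) \<longlonglongrightarrow> 0"
proof -
  obtain c where lim: "\<And>z. z \<in> unit_disk \<Longrightarrow> (\<lambda>N. hpartial c {- int N..int N} z) \<longlonglongrightarrow> u z"
    and abs: "\<And>\<rho>. 0 < \<rho> \<Longrightarrow> \<rho> < 1 \<Longrightarrow> \<exists>B. \<forall>N. (\<Sum>n\<in>{- int N..int N}. cmod (c n) * \<rho> ^ nat \<bar>n\<bar>) \<le> B"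
    using harmonic_expansion[OF L2h_harmonic[OF u]] by blast
  define L where "L = (LINT z|dA. (cmod (u z))\<^sup>2)"
  have dil: "\<rho>\<^sup>2 * (\<Sum>n\<in>{- int N..int N}. (cmod (of_real (\<rho> ^ nat \<bar>n\<bar>) * c n))\<^sup>2 / hweight n) \<le> L"
    if \<rho>: "0 < \<rho>" "\<rho> < 1" for \<rho> N
  proof -
    define c' where "c' = (\<lambda>n. of_real (\<rho> ^ nat \<bar>n\<bar>) * c n)"
    define v where "v = (\<lambda>z. u (of_real \<rho> * z))"
    have v: "v \<in> L2" unfolding v_def by (rule L2h_dilate(2)[OF u \<rho>])
    have hp: "hpartial c' I z = hpartial c I (of_real \<rho> * z)" for I z
      unfolding hpartial_def c'_def hmono_scale by (simp only: mult_ac)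
    obtain B where B: "\<And>N. (\<Sum>n\<in>{- int N..int N}. cmod (c n) * \<rho> ^ nat \<bar>n\<bar>) \<le> B" using abs[OF \<rho>] by blast
    have hpB: "cmod (hpartial c' {- int M..int M} z) \<le> B" if "z \<in> unit_disk" for M z
    proof -
      have "cmod (hpartial c' {- int M..int M} z) \<le> (\<Sum>n\<in>{- int M..int M}. cmod (c' n * hmono n z))"
        unfolding hpartial_def by (rule norm_sum)
      also have "\<dots> \<le> (\<Sum>n\<in>{- int M..int M}. cmod (c n) * \<rho> ^ nat \<bar>n\<bar>)"
      proof (rule sum_mono)
        fix n
        have "cmod (c' n) * cmod (hmono n z) \<le> cmod (c' n) * 1"
          by (intro mult_left_mono norm_hmono_le that) simp
        then show "cmod (c' n * hmono n z) \<le> cmod (c n) * \<rho> ^ nat \<bar>n\<bar>"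
          using \<rho> by (simp add: norm_mult c'_def mult.commute norm_power)
      qed
      also have "\<dots> \<le> B" by (rule B)
      finally show ?thesis .
    qed
    \<comment> \<open>The partial sums of the dilate are bounded by \<open>B\<close> on the whole
      disk, so inner products pass to the limit; for \<open>u\<close> itself there may be no such
      bound.\<close>
    have coeff: "L2_inner v (hmono n) = c' n / of_real (hweight n)" for n
    proof -
      have "(\<lambda>M. L2_inner (hpartial c' {- int M..int M}) (hmono n)) \<longlonglongrightarrow> L2_inner v (hmono n)"
        unfolding L2_inner_def
      proof (rule integral_dominated_convergence[where w="\<lambda>_. B"])
        show "(\<lambda>z. v z * cnj (hmono n z)) \<in> borel_measurable dA"
          by (intro measurable_mult_cnj L2_measurable v measurable_hmono)
        show "(\<lambda>z. hpartial c' {- int M..int M} z * cnj (hmono n z)) \<in> borel_measurable dA" for M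
          by (intro measurable_mult_cnj measurable_hpartial measurable_hmono)
        show "AE z in dA. (\<lambda>M. hpartial c' {- int M..int M} z * cnj (hmono n z)) \<longlonglongrightarrow> v z * cnj (hmono n z)"
        proof (rule AE_I2)
          fix z assume z: "z \<in> space dA"
          have "\<rho> * cmod z < 1 * 1" using z \<rho> by (intro mult_strict_mono') (auto simp: in_disk_iff)
          then have "(\<lambda>M. hpartial c {- int M..int M} (of_real \<rho> * z)) \<longlonglongrightarrow> u (of_real \<rho> * z)"
            using \<rho> by (intro lim) (simp add: in_disk_iff norm_mult)
          then show "(\<lambda>M. hpartial c' {- int M..int M} z * cnj (hmono n z)) \<longlonglongrightarrow> v z * cnj (hmono n z)"
            unfolding hp v_def by (intro tendsto_intros)
        qed
        show "AE z in dA. cmod (hpartial c' {- int M..int M} z * cnj (hmono n z)) \<le> B" for M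
        proof (rule AE_I2)
          fix z assume z: "z \<in> space dA"
          have "cmod (hpartial c' {- int M..int M} z) * cmod (hmono n z) \<le> B * 1"
            using z hpB[of z M] norm_hmono_le[of z n] by (intro mult_mono) (auto intro: order_trans[OF norm_ge_zero])
          then show "cmod (hpartial c' {- int M..int M} z * cnj (hmono n z)) \<le> B" by (simp add: norm_mult)
        qed
      qed auto
      moreover have "(\<lambda>M. L2_inner (hpartial c' {- int M..int M}) (hmono n)) \<longlonglongrightarrow> c' n / of_real (hweight n)"
        by (rule tendsto_eventually, unfold eventually_sequentially, intro exI[of _ "nat \<bar>n\<bar>"])
          (auto simp: L2_inner_hpartial_hmono)
      ultimately show ?thesis by (rule LIMSEQ_unique)
    qed
    have "(\<Sum>n\<in>{- int N..int N}. (cmod (c' n))\<^sup>2 / hweight n) \<le> (LINT z|dA. (cmod (v z))\<^sup>2)"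
      by (rule Bessel_hmono[OF v]) (auto simp: coeff)
    then have "\<rho>\<^sup>2 * (\<Sum>n\<in>{- int N..int N}. (cmod (c' n))\<^sup>2 / hweight n) \<le> \<rho>\<^sup>2 * (LINT z|dA. (cmod (v z))\<^sup>2)"
      by (rule mult_left_mono) simp
    also have "\<dots> \<le> L" unfolding v_def L_def by (rule L2h_dilate(1)[OF u \<rho>])
    finally show ?thesis unfolding c'_def .
  qed
  have bound: "(\<Sum>n\<in>{- int N..int N}. (cmod (c n))\<^sup>2 / hweight n) \<le> L" for N
  proof -
    \<comment> \<open>The shift by 2 keeps \<open>\<rho> k\<close> strictly positive already at
      \<open>k = 0\<close>, as \<open>dil\<close> requires.\<close>
    define \<rho> where "\<rho> = (\<lambda>k. 1 - 1 / real (Suc (Suc k)))"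
    have \<rho>lim: "\<rho> \<longlonglongrightarrow> 1"
      unfolding \<rho>_def using tendsto_diff[OF tendsto_const LIMSEQ_Suc[OF LIMSEQ_Suc[OF lim_1_over_n]], of 1] by simp
    have "(\<lambda>k. (\<rho> k)\<^sup>2 * (\<Sum>n\<in>{- int N..int N}. (cmod (of_real (\<rho> k ^ nat \<bar>n\<bar>) * c n))\<^sup>2 / hweight n))
      \<longlonglongrightarrow> 1\<^sup>2 * (\<Sum>n\<in>{- int N..int N}. (cmod (of_real (1 ^ nat \<bar>n\<bar>) * c n))\<^sup>2 / hweight n)"
      by (intro tendsto_intros \<rho>lim) simp
    moreover have "(\<rho> k)\<^sup>2 * (\<Sum>n\<in>{- int N..int N}. (cmod (of_real (\<rho> k ^ nat \<bar>n\<bar>) * c n))\<^sup>2 / hweight n) \<le> L" for k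
      by (rule dil) (auto simp: \<rho>_def)
    ultimately have "1\<^sup>2 * (\<Sum>n\<in>{- int N..int N}. (cmod (of_real (1 ^ nat \<bar>n\<bar>) * c n))\<^sup>2 / hweight n) \<le> L"
      by (intro LIMSEQ_le_const2) auto
    then show ?thesis by simp
  qed
  show ?thesis
    by (rule that[of c, OF lim hpartial_limit_L2(2)[OF bound lim]])
qed

text \<open>Totality of the monomials in \<open>L2h\<close>: the partial sums of \<open>v\<close>
  converge to it in norm.\<close>

lemma L2h_orthogonal:
  assumes F: "F \<in> L2" and z: "\<And>n. L2_inner F (hmono n) = 0" and v: "v \<in> L2h"
  shows "L2_inner F v = 0"
proof -
  obtain c where "(\<lambda>N. LINT z|dA. (cmod (v z - hpartial c {- int N..int N} z))\<^sup>2) \<longlonglongrightarrow> 0"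
    using L2h_expansion[OF v] by blast
  then have "(\<lambda>N. L2_inner F (hpartial c {- int N..int N})) \<longlonglongrightarrow> L2_inner F v"
    by (intro L2_inner_limit F L2_hpartial L2h_L2[OF v]) auto
  then show ?thesis
    by (simp add: L2_inner_hpartial F z LIMSEQ_const_iff)
qed

text \<open>Linear growth is what the factor \<open>hweight n\<close> causes in the coefficients of
  a projection; the comparison series is the derivative of the geometric one.\<close>

lemma summable_linear_growth:
  fixes c :: "nat \<Rightarrow> complex"
  assumes "\<And>i. cmod (c i) \<le> K * real (Suc i)" "cmod z < 1"
  shows "summable (\<lambda>i. c i * z ^ i)"
proof (rule summable_comparison_test)
  show "\<exists>N. \<forall>i\<ge>N. cmod (c i * z ^ i) \<le> K * (of_nat (Suc i) * cmod z ^ i)"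
    using mult_right_mono[OF assms(1), of "cmod z ^ _"] by (auto simp: norm_mult norm_power mult.assoc)
  show "summable (\<lambda>i. K * (of_nat (Suc i) * cmod z ^ i))"
    by (intro summable_mult sums_summable[OF geometric_deriv_sums]) (use assms in simp)
qed

text \<open>The candidate is the series with coefficients
  \<open>hweight n * L2_inner f (hmono n)\<close>. Linear growth makes it converge on the disk to a
  harmonic function, and Bessel's inequality for \<open>f\<close> bounds the sums from which
  \<open>hpartial_limit_L2\<close> deduces membership in \<open>L2\<close>.\<close>

lemma L2h_projection_exists:
  assumes f: "f \<in> L2"
  obtains w where "w \<in> L2h" "\<And>n. L2_inner w (hmono n) = L2_inner f (hmono n)"
proof -
  define c where "c = (\<lambda>n. of_real (hweight n) * L2_inner f (hmono n))"
  \<comment> \<open>As \<open>cmod (hmono n z) \<le> 1\<close> on the disk, the \<open>L1\<close>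
    norm of \<open>f\<close> bounds all its inner products with the monomials.\<close>
  define K where "K = (LINT z|dA. cmod (f z))"
  have K: "cmod (L2_inner f (hmono n)) \<le> K" for n
  proof -
    have "cmod (L2_inner f (hmono n)) \<le> (LINT z|dA. cmod (f z * cnj (hmono n z)))"
      unfolding L2_inner_def by (rule integral_norm_bound)
    also have "\<dots> \<le> K"
      unfolding K_def
    proof (rule integral_mono)
      show "cmod (f z * cnj (hmono n z)) \<le> cmod (f z)" if "z \<in> space dA" for z
        using mult_left_mono[OF norm_hmono_le[of z n], of "cmod (f z)"] that by (simp add: norm_mult)
    qed (intro integrable_norm L2_mult_integrable L2_integrable f L2_hmono)+
    finally show ?thesis .
  qed
  have cK: "cmod (c (int i)) \<le> K * real (Suc i)" "cmod (cnj (c (- int i))) \<le> K * real (Suc i)" for i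
  proof -
    have "cmod (c n) = hweight n * cmod (L2_inner f (hmono n))" for n
      by (simp add: c_def norm_mult)
    moreover have "hweight (int i) = real i + 1" "hweight (- int i) = real i + 1"
      by (simp_all add: hweight_def)
    ultimately show "cmod (c (int i)) \<le> K * real (Suc i)" "cmod (cnj (c (- int i))) \<le> K * real (Suc i)"
      using mult_left_mono[OF K[of "int i"], of "real i + 1"] mult_left_mono[OF K[of "- int i"], of "real i + 1"]
      by (simp_all add: mult.commute add.commute)
  qed
  define F where "F = (\<lambda>z. \<Sum>i. c (int i) * z ^ i)"
  \<comment> \<open>The coefficient at 0 is removed because \<open>F\<close> carries the constant
    term.\<close>
  define G where "G = (\<lambda>z. \<Sum>i. (if i = 0 then 0 else cnj (c (- int i))) * z ^ i)"
  have F: "(\<lambda>i. c (int i) * z ^ i) sums F z" if "z \<in> unit_disk" for z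
    unfolding F_def using that by (intro summable_sums summable_linear_growth[of _ K] cK) (auto simp: in_disk_iff)
  have K0: "0 \<le> K" unfolding K_def by (rule integral_nonneg_AE) simp
  have G: "(\<lambda>i. (if i = 0 then 0 else cnj (c (- int i))) * z ^ i) sums G z" if "z \<in> unit_disk" for z
    unfolding G_def
  proof (intro summable_sums summable_linear_growth[of _ K])
    show "cmod (if i = 0 then 0 else cnj (c (- int i))) \<le> K * real (Suc i)" for i
      using cK(2)[of i] K0 by auto
  qed (use that in \<open>simp add: in_disk_iff\<close>)
  have Fh: "F holomorphic_on unit_disk" "G holomorphic_on unit_disk"
    unfolding unit_disk_def
    by (rule power_series_holomorphic[where a="\<lambda>i. c (int i)"], use F in \<open>simp add: unit_disk_def\<close>)
      (rule power_series_holomorphic[where a="\<lambda>i. if i = 0 then 0 else cnj (c (- int i))"],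
        use G in \<open>simp add: unit_disk_def\<close>)
  define w where "w = (\<lambda>z. if z \<in> unit_disk then F z + cnj (G z) else 0)"
  have od: "open unit_disk" by (simp add: unit_disk_def)
  have "harmonic_on (\<lambda>z. F z + 1 * cnj (G z)) unit_disk"
    by (intro harmonic_on_lincomb harmonic_on_cnj harmonic_on_holomorphic Fh od)
  then have harm: "harmonic_on w unit_disk"
    by (subst harmonic_on_cong[of _ _ "\<lambda>z. F z + 1 * cnj (G z)"]) (auto simp: w_def)
  have lim: "(\<lambda>N. hpartial c {- int N..int N} z) \<longlonglongrightarrow> w z" if z: "z \<in> unit_disk" for z
  proof -
    have "(\<lambda>i. cnj (c (- int (Suc i))) * z ^ Suc i) sums G z"
      using G[OF z] sums_Suc_iff[of "\<lambda>i. (if i = 0 then 0 else cnj (c (- int i))) * z ^ i" "G z"]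
      by (simp del: of_nat_Suc power_Suc)
    from bounded_linear.sums[OF bounded_linear_cnj this]
    have "(\<lambda>i. c (- int (Suc i)) * cnj z ^ Suc i) sums cnj (G z)" by (simp del: of_nat_Suc)
    from hpartial_tendsto[OF F[OF z] this] show ?thesis using z by (simp add: w_def)
  qed
  have bound: "(\<Sum>n\<in>{- int N..int N}. (cmod (c n))\<^sup>2 / hweight n) \<le> (LINT z|dA. (cmod (f z))\<^sup>2)" for N
    by (rule Bessel_hmono[OF f]) (auto simp: c_def)
  have w: "w \<in> L2" and wlim: "(\<lambda>N. LINT z|dA. (cmod (w z - hpartial c {- int N..int N} z))\<^sup>2) \<longlonglongrightarrow> 0"
    using hpartial_limit_L2[OF bound lim] by auto
  have "w \<in> L2h" using w harm by (simp add: L2h_def w_def)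
  moreover have "L2_inner w (hmono n) = L2_inner f (hmono n)" for n
  proof -
    have "(\<lambda>N. L2_inner (hmono n) (hpartial c {- int N..int N})) \<longlonglongrightarrow> L2_inner (hmono n) w"
      by (intro L2_inner_limit L2_hmono L2_hpartial w wlim) auto
    from tendsto_cnj[OF this]
    have "(\<lambda>N. L2_inner (hpartial c {- int N..int N}) (hmono n)) \<longlonglongrightarrow> L2_inner w (hmono n)"
      by (simp flip: L2_inner_cnj)
    moreover have "(\<lambda>N. L2_inner (hpartial c {- int N..int N}) (hmono n)) \<longlonglongrightarrow> c n / of_real (hweight n)"
      by (rule tendsto_eventually, unfold eventually_sequentially, intro exI[of _ "nat \<bar>n\<bar>"])
        (auto simp: L2_inner_hpartial_hmono)
    ultimately have "L2_inner w (hmono n) = c n / of_real (hweight n)" by (rule LIMSEQ_unique)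
    then show ?thesis by (simp add: c_def)
  qed
  ultimately show ?thesis by (rule that)
qed

section \<open>Toeplitz operators\<close>

text \<open>Members of \<open>L2h\<close> vanish off the disk, so the monomials belong to it only
  after being cut off.\<close>

definition hbasis :: "int \<Rightarrow> complex \<Rightarrow> complex" where
  "hbasis n z = (if z \<in> unit_disk then hmono n z else 0)"

lemma L2_cong:
  assumes "f \<in> L2" "\<And>z. z \<in> unit_disk \<Longrightarrow> f z = g z"
  shows "g \<in> L2"
proof -
  have "g \<in> borel_measurable dA"
    using measurable_cong[of dA f g borel] assms by (simp add: L2_measurable)
  moreover have "integrable dA (\<lambda>z. (cmod (g z))\<^sup>2)"
    using Bochner_Integration.integrable_cong[of dA dA "\<lambda>z. (cmod (f z))\<^sup>2" "\<lambda>z. (cmod (g z))\<^sup>2"] assms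
    by (simp add: L2_integrable_square)
  ultimately show ?thesis by (simp add: L2_def)
qed

lemma harmonic_hmono: "harmonic_on (hmono n) unit_disk"
proof -
  have o: "open unit_disk" by (simp add: unit_disk_def)
  have h: "harmonic_on (\<lambda>z. z ^ k) unit_disk" for k
    by (intro harmonic_on_holomorphic o holomorphic_intros)
  show ?thesis
    using h[of "nat n"] harmonic_on_cnj[OF h[of "nat (- n)"]]
    by (cases "n \<ge> 0") (simp_all add: hmono_def[abs_def])
qed

lemma hbasis_L2h: "hbasis n \<in> L2h"
  unfolding L2h_def using harmonic_on_cong[of unit_disk "hbasis n" "hmono n"] harmonic_hmono[of n]
    L2_cong[OF L2_hmono[of n], of "hbasis n"]
  by (simp add: hbasis_def)

lemma L2h_cmult:
  assumes "u \<in> L2h" shows "(\<lambda>z. c * u z) \<in> L2h"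
proof -
  have "harmonic_on (\<lambda>z. 0) unit_disk"
    by (intro harmonic_on_holomorphic) (auto simp: unit_disk_def)
  from harmonic_on_lincomb[OF this L2h_harmonic[OF assms], of c]
  show ?thesis using L2_cmult[OF L2h_L2[OF assms]] L2h_outside[OF assms] by (simp add: L2h_def)
qed

lemma L2_inner_hbasis: "L2_inner f (hbasis n) = L2_inner f (hmono n)"
  by (rule L2_inner_cong) (simp add: hbasis_def)

lemma continuous_AE_eq_0:
  assumes c: "continuous_on unit_disk d" and ae: "AE z in dA. d z = 0" and z: "z \<in> unit_disk"
  shows "d z = (0::complex)"
proof (rule ccontr)
  assume nz: "d z \<noteq> 0"
  define A where "A = {z \<in> unit_disk. d z \<noteq> 0}"
  have "open unit_disk" by (simp add: unit_disk_def)
  then have o: "open A"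
    using continuous_open_preimage[OF c, of "- {0}"] by (simp add: A_def vimage_def Int_def open_Compl)
  have sub: "A \<subseteq> unit_disk" by (auto simp: A_def)
  have l: "A \<in> sets lebesgue" using o by auto
  have "A \<in> null_sets dA"
    using ae AE_iff_null[of dA "\<lambda>z. d z = 0"] sub l by (simp add: A_def sets_dA_iff)
  then have "emeasure lebesgue A = 0"
    using emeasure_dA[OF sub l] by (auto simp: null_sets_def)
  then have "negligible A" using l by (simp add: negligible_iff_null_sets null_sets_def)
  moreover have "A \<noteq> {}" using nz z by (auto simp: A_def)
  ultimately show False using open_not_negligible[OF o] by simp
qed

text \<open>The difference is orthogonal to all monomials, hence to \<open>u\<close> and to
  \<open>v\<close>, hence to itself; continuity turns equality almost everywhere into equality
  everywhere.\<close>

lemma L2h_eqI: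
  assumes u: "u \<in> L2h" and v: "v \<in> L2h" and eq: "\<And>n. L2_inner u (hmono n) = L2_inner v (hmono n)"
  shows "u = v"
proof
  fix z
  note uL = L2h_L2[OF u] and vL = L2h_L2[OF v]
  define d where "d = (\<lambda>z. u z - v z)"
  have d: "d \<in> L2" unfolding d_def by (rule L2_diff[OF uL vL])
  have "L2_inner d (hmono n) = 0" for n
    unfolding d_def by (simp add: L2_inner_diff uL vL L2_hmono eq)
  then have "L2_inner d u = 0" "L2_inner d v = 0"
    using L2h_orthogonal[OF d] u v by auto
  then have "L2_inner d d = 0"
    using L2_inner_diff_right[OF uL vL d] by (simp add: d_def)
  then have "(LINT z|dA. (cmod (d z))\<^sup>2) = 0" by (simp add: L2_inner_self)
  then have "AE z in dA. (cmod (d z))\<^sup>2 = 0"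
    using integral_nonneg_eq_0_iff_AE[OF L2_integrable_square[OF d]] by auto
  then have ae: "AE z in dA. d z = 0" by simp
  have c: "continuous_on unit_disk d"
    unfolding d_def using u v by (intro continuous_on_diff harmonic_on_continuous L2h_harmonic)
  show "u z = v z"
  proof (cases "z \<in> unit_disk")
    case True
    then show ?thesis using continuous_AE_eq_0[OF c ae] by (simp add: d_def)
  next
    case False
    then show ?thesis using u v by (simp add: L2h_outside)
  qed
qed

text \<open>This makes the definite description meaningful. Orthogonality to \<open>L2h\<close>
  prescribes all inner products with the monomials, so \<open>L2h_eqI\<close> gives uniqueness and
  \<open>L2h_projection_exists\<close> existence.\<close>

lemma proj_L2h:
  assumes f: "f \<in> L2"
  shows "proj_L2h f \<in> L2h" "L2_inner (proj_L2h f) (hmono n) = L2_inner f (hmono n)"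
proof -
  let ?P = "\<lambda>u. u \<in> L2h \<and> (\<forall>v\<in>L2h. L2_inner (\<lambda>z. f z - u z) v = 0)"
  have coeff: "L2_inner u (hmono n) = L2_inner f (hmono n)" if "?P u" for u n
  proof -
    have "L2_inner (\<lambda>z. f z - u z) (hmono n) = 0"
      using that hbasis_L2h[of n] by (simp flip: L2_inner_hbasis)
    then show ?thesis using that f by (simp add: L2_inner_diff L2_hmono L2h_L2)
  qed
  obtain w where w: "w \<in> L2h" "\<And>n. L2_inner w (hmono n) = L2_inner f (hmono n)"
    using L2h_projection_exists[OF f] by blast
  have "L2_inner (\<lambda>z. f z - w z) (hmono n) = 0" for n
    using w f by (simp add: L2_inner_diff L2_hmono L2h_L2)
  then have "?P w"
    using w(1) L2h_orthogonal[OF L2_diff[OF f L2h_L2[OF w(1)]]] by blast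
  then have "?P (proj_L2h f)"
    unfolding proj_L2h_def
  proof (rule theI[of ?P])
    show "u = w" if "?P u" for u
      using that w coeff[OF that] by (intro L2h_eqI) auto
  qed
  then show "proj_L2h f \<in> L2h" "L2_inner (proj_L2h f) (hmono n) = L2_inner f (hmono n)"
    using coeff by auto
qed

lemma toeplitz_L2h:
  assumes "bounded_symbol f" "u \<in> L2h"
  shows "toeplitz f u \<in> L2h"
    and "L2_inner (toeplitz f u) (hmono n) = L2_inner (\<lambda>z. f z * u z) (hmono n)"
  unfolding toeplitz_def using proj_L2h[OF L2_bounded_mult[OF assms(1) L2h_L2[OF assms(2)]]] by auto

lemma radial_mult_hmono_orthogonal:
  assumes f: "bounded_symbol f" "radial f" and nm: "n \<noteq> m"
  shows "L2_inner (\<lambda>z. f z * hmono n z) (hmono m) = 0"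
  unfolding L2_inner_def
proof (rule integral_dA_eq_0_rotation[of _ "n - m"])
  show "(\<lambda>z. f z * hmono n z * cnj (hmono m z)) \<in> borel_measurable dA"
    by (intro measurable_mult_cnj borel_measurable_times measurable_hmono bounded_symbol_measurable f)
  show "f (w * z) * hmono n (w * z) * cnj (hmono m (w * z)) = w powi (n - m) * (f z * hmono n z * cnj (hmono m z))"
    if "cmod w = 1" "z \<in> unit_disk" for w z
  proof -
    have "w \<noteq> 0" using that by auto
    then have "w powi (n - m) = w powi n * w powi (- m)"
      using power_int_add[of w n "- m"] by simp
    then show ?thesis
      unfolding cnj_hmono radial_rotate[OF f(2) that] by (simp only: hmono_rotate[OF that(1)] mult_ac)
  qed
qed (use nm in simp)

text \<open>Multiplication by a radial symbol keeps the frequency, so only the inner product with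
  \<open>hmono n\<close> survives. It is a moment of \<open>\<psi>\<close>, and
  \<open>hweight n\<close> compensates for the norm of \<open>hmono n\<close>.\<close>

lemma toeplitz_radial_hbasis:
  assumes \<psi>: "bounded_symbol \<psi>" "radial \<psi>"
  shows "toeplitz \<psi> (hbasis n) = (\<lambda>z. of_real (hweight n) * moment \<psi> (of_nat (nat \<bar>n\<bar>)) * hbasis n z)"
proof (rule L2h_eqI)
  show "toeplitz \<psi> (hbasis n) \<in> L2h" by (rule toeplitz_L2h(1)[OF \<psi>(1) hbasis_L2h])
  show "(\<lambda>z. of_real (hweight n) * moment \<psi> (of_nat (nat \<bar>n\<bar>)) * hbasis n z) \<in> L2h"
    by (rule L2h_cmult[OF hbasis_L2h])
  fix m
  have l: "L2_inner (toeplitz \<psi> (hbasis n)) (hmono m) = L2_inner (\<lambda>z. \<psi> z * hmono n z) (hmono m)"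
    unfolding toeplitz_L2h(2)[OF \<psi>(1) hbasis_L2h] by (rule L2_inner_cong) (simp add: hbasis_def)
  have r: "L2_inner (\<lambda>z. of_real (hweight n) * moment \<psi> (of_nat (nat \<bar>n\<bar>)) * hbasis n z) (hmono m)
      = of_real (hweight n) * moment \<psi> (of_nat (nat \<bar>n\<bar>)) * L2_inner (hmono n) (hmono m)"
    unfolding L2_inner_cmult[symmetric] by (rule L2_inner_cong) (simp add: hbasis_def)
  show "L2_inner (toeplitz \<psi> (hbasis n)) (hmono m) =
      L2_inner (\<lambda>z. of_real (hweight n) * moment \<psi> (of_nat (nat \<bar>n\<bar>)) * hbasis n z) (hmono m)"
  proof (cases "n = m")
    case False
    then show ?thesis unfolding l r by (simp add: radial_mult_hmono_orthogonal[OF \<psi>] L2_inner_hmono)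
  next
    case True
    have "L2_inner (\<lambda>z. \<psi> z * hmono n z) (hmono n) = moment \<psi> (of_nat (nat \<bar>n\<bar>))"
      unfolding L2_inner_def moment_of_nat[OF \<psi>(1)] by (simp only: mult.assoc hmono_mult_cnj)
    then show ?thesis unfolding l r using True by (simp add: L2_inner_hmono)
  qed
qed

lemma hmono_polar: "hmono n z = of_real (cmod z ^ nat \<bar>n\<bar>) * cis (of_int n * Arg z)"
proof -
  have "hmono n z = hmono n (cis (Arg z) * of_real (cmod z))"
    by (metis rcis_cmod_Arg rcis_def mult.commute)
  also have "\<dots> = cis (Arg z) powi n * hmono n (of_real (cmod z))"
    by (rule hmono_rotate) simp
  finally show ?thesis by (simp add: cis_power_int hmono_def)
qed

text \<open>\<open>Arg\<close> jumps on the negative axis, but off 0 the function agrees with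
  \<open>sgn z powi p\<close>, which is continuous there. At 0 the convention
  \<open>Arg 0 = 0\<close> gives the value 1.\<close>

lemma cis_Arg_measurable: "(\<lambda>z. cis (of_int p * Arg z)) \<in> borel_measurable borel"
proof -
  have "(\<lambda>z. if z \<in> - {0} then sgn z powi p else (1::complex)) \<in> borel_measurable borel"
    by (intro borel_measurable_continuous_on_if continuous_intros) (auto simp: sgn_zero_iff)
  moreover have "(\<lambda>z. if z \<in> - {0} then sgn z powi p else 1) = (\<lambda>z. cis (of_int p * Arg z))"
    by (auto simp: fun_eq_iff cis_power_int simp flip: cis_Arg) (simp add: Arg_zero)
  ultimately show ?thesis by simp
qed

lemma bounded_symbol_quasihomogeneous:
  assumes "bounded_symbol \<phi>"
  shows "bounded_symbol (quasihomogeneous p \<phi>)"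
proof -
  have "bounded_symbol (\<lambda>z. cis (of_int p * Arg z))"
    by (rule bounded_symbolI[of _ 1]) (auto intro: borel_imp_measurable_dA cis_Arg_measurable)
  from bounded_symbol_mult[OF this assms] show ?thesis unfolding quasihomogeneous_def .
qed

section \<open>Shifted moments and moments along arithmetic progressions\<close>

lemma bounded_symbol_norm_power: "bounded_symbol (\<lambda>z. of_real (cmod z ^ k))"
  by (intro bounded_symbol_continuous continuous_intros)

lemma radialD: "radial f \<Longrightarrow> z \<in> unit_disk \<Longrightarrow> w \<in> unit_disk \<Longrightarrow> cmod z = cmod w \<Longrightarrow> f z = f w"
  unfolding radial_def by blast

lemma radial_mult_norm_power:
  assumes "radial f"
  shows "radial (\<lambda>z. f z * of_real (cmod z ^ k))"
  unfolding radial_def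
proof (intro ballI impI)
  fix z w assume "z \<in> unit_disk" "w \<in> unit_disk" and n: "cmod z = cmod w"
  then have "f z = f w" by (rule radialD[OF assms])
  then show "f z * of_real (cmod z ^ k) = f w * of_real (cmod w ^ k)" unfolding n by (rule arg_cong)
qed

lemma radial_diff_const:
  assumes "radial f"
  shows "radial (\<lambda>z. f z - c)"
  unfolding radial_def
proof (intro ballI impI)
  fix z w assume "z \<in> unit_disk" "w \<in> unit_disk" "cmod z = cmod w"
  then have "f z = f w" by (rule radialD[OF assms])
  then show "f z - c = f w - c" by (rule arg_cong)
qed

lemma moment_shift:
  assumes "bounded_symbol f"
  shows "moment (\<lambda>z. f z * of_real (cmod z ^ (2 * j))) (of_nat k) = moment f (of_nat (k + j))"
  unfolding moment_of_nat[OF assms] moment_of_nat[OF bounded_symbol_mult[OF assms bounded_symbol_norm_power]]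
  by (simp add: distrib_left power_add mult_ac)

lemma of_nat_plus_1_neq_0: "of_nat k + 1 \<noteq> (0::complex)"
  by (metis of_nat_Suc of_nat_neq_0 add.commute)

lemma moment_one: "moment (\<lambda>z. 1) (of_nat k) = 1 / (of_nat k + 1)"
proof -
  have "moment (\<lambda>z. 1) (of_nat k) = of_real (LINT z|dA. cmod z ^ (2 * k))"
    unfolding moment_of_nat[OF bounded_symbol_const] by (simp only: mult_1_left integral_complex_of_real)
  then show ?thesis by (simp add: integral_norm_power)
qed

lemma moment_diff_const:
  assumes "bounded_symbol f"
  shows "moment (\<lambda>z. f z - c) (of_nat k) = moment f (of_nat k) - c / (of_nat k + 1)"
proof -
  have "moment (\<lambda>z. f z - c) (of_nat k) =
      (LINT z|dA. f z * cpower ((cmod z)\<^sup>2) (of_nat k) - c * (1 * cpower ((cmod z)\<^sup>2) (of_nat k)))"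
    unfolding moment_def by (simp add: left_diff_distrib)
  also have "\<dots> = moment f (of_nat k) - c * moment (\<lambda>z. 1) (of_nat k)"
  proof -
    have i1: "integrable dA (\<lambda>z. f z * cpower ((cmod z)\<^sup>2) (of_nat k))"
      by (rule integrable_moment[OF assms]) simp
    have "integrable dA (\<lambda>z. 1 * cpower ((cmod z)\<^sup>2) (of_nat k))"
      by (rule integrable_moment[OF bounded_symbol_const]) simp
    then have i2: "integrable dA (\<lambda>z. c * (1 * cpower ((cmod z)\<^sup>2) (of_nat k)))"
      by (rule integrable_mult_right)
    show ?thesis
      unfolding moment_def Bochner_Integration.integral_diff[OF i1 i2] integral_mult_right_zero ..
  qed
  finally show ?thesis by (simp add: moment_one)
qed

text \<open>The functional is composed with the substitution \<open>t -> t^q\<close>, which maps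
  (0,1] into itself.\<close>

lemma moment_function_scale:
  assumes "moment_function a"
  shows "moment_function (\<lambda>s. a (of_nat q * s))"
proof -
  obtain C where C: "C \<ge> 0" "\<And>n c s K. (\<forall>i<(n::nat). 0 \<le> Re (s i)) \<Longrightarrow>
     (\<forall>t. 0 < t \<and> t \<le> 1 \<longrightarrow> cmod (\<Sum>i<n. c i * cpower t (s i)) \<le> K) \<Longrightarrow> cmod (\<Sum>i<n. c i * a (s i)) \<le> C * K"
    using assms unfolding moment_function_def by metis
  show ?thesis
    unfolding moment_function_def
  proof (intro exI[of _ C] conjI allI impI C(1); (elim conjE)?)
    fix n c s K
    assume s: "\<forall>i<(n::nat). 0 \<le> Re (s i)"
      and K: "\<forall>t. 0 < t \<and> t \<le> 1 \<longrightarrow> cmod (\<Sum>i<n. c i * cpower t (s i)) \<le> K"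
    show "cmod (\<Sum>i<n. c i * a (of_nat q * s i)) \<le> C * K"
    proof (rule C(2); intro allI impI)
      show "0 \<le> Re (of_nat q * s i)" if "i < n" for i using s that by simp
      fix t :: real assume t: "0 < t \<and> t \<le> 1"
      then have "cpower t (of_nat q * s i) = cpower (t ^ q) (s i)" for i
        by (simp add: cpower_def ln_realpow mult_ac)
      moreover have "0 < t ^ q \<and> t ^ q \<le> 1" using t by (simp add: power_le_one)
      ultimately show "cmod (\<Sum>i<n. c i * cpower t (of_nat q * s i)) \<le> K" using K by simp
    qed
  qed
qed

text \<open>With a suitable weight, \<open>s -> moment E (q * s)\<close> is a moment function
  vanishing at all naturals, hence on the half plane. Thus every integer moment of \<open>E\<close>
  of positive order vanishes, including those off the progression.\<close>

lemma radial_AE_eq_0_progression: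
  assumes f: "bounded_symbol f" "radial f" and q: "q > 0"
    and z: "\<And>j. j > 0 \<Longrightarrow> moment f (of_nat (q * j)) = 0"
  shows "AE z in dA. f z = 0"
proof -
  \<comment> \<open>The weight turns the moment at \<open>q * j\<close> into the one at
    \<open>q * (j + 1)\<close>, so that \<open>j = 0\<close> is covered.\<close>
  define E where "E = (\<lambda>z. f z * of_real (cmod z ^ (2 * q)))"
  have E: "bounded_symbol E" "radial E"
    unfolding E_def by (intro bounded_symbol_mult f bounded_symbol_norm_power, intro radial_mult_norm_power f)
  have "moment E (of_nat q * of_nat j) = 0" for j
    using moment_shift[OF f(1), of q "q * j"] z[of "Suc j"] by (simp add: E_def add.commute)
  then have Es: "moment E (of_nat q * s) = 0" if "Re s > 0" for s
    using moment_function_zero[OF moment_function_scale[OF moment_function_moment[OF E(1)]] _ that] by blast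
  have Ek: "moment E (of_nat k) = 0" if "k > 0" for k
    using Es[of "of_nat k / of_nat q"] q that by simp
  \<comment> \<open>One more factor \<open>|z|^2\<close> takes care of order 0, because vanishing is
    known only for \<open>Re s > 0\<close>. Both weights are nonzero off the origin and can be
    divided out at the end.\<close>
  define E' where "E' = (\<lambda>z. E z * of_real (cmod z ^ (2 * 1)))"
  have E': "bounded_symbol E'" "radial E'"
    unfolding E'_def by (intro bounded_symbol_mult E bounded_symbol_norm_power, intro radial_mult_norm_power E)
  have "moment E' (of_nat k) = 0" for k
    unfolding E'_def moment_shift[OF E(1)] by (rule Ek) simp
  from radial_AE_eq_0[OF E' this]
  show ?thesis
    using AE_dA_nonzero by eventually_elim (simp add: E'_def E_def)
qed

text \<open>The factors \<open>of_nat k + 1\<close> and \<open>of_nat (k + q) + 1\<close> are values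
  of \<open>hweight\<close>, so the bracket is a difference of eigenvalues. The power
  \<open>cmod z ^ q\<close> stays inside the symbol, since for odd \<open>q\<close> it would shift
  the moment of \<open>\<phi>\<close> by a half-integer.\<close>

lemma product_moment_identity:
  assumes p: "p \<noteq> (0::int)" and \<phi>: "bounded_symbol \<phi>" and \<psi>: "bounded_symbol \<psi>" "radial \<psi>" and g: "bounded_symbol g"
    and eq: "\<And>u. u \<in> L2h \<Longrightarrow> toeplitz (quasihomogeneous p \<phi>) (toeplitz \<psi> u) = toeplitz g u"
    and q: "q = nat \<bar>p\<bar>"
  shows "moment (\<lambda>z. \<phi> z * of_real (cmod z ^ q)) (of_nat k) *
    ((of_nat k + 1) * moment \<psi> (of_nat k) - (of_nat (k + q) + 1) * moment \<psi> (of_nat (k + q))) = 0"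
proof -
  define \<Phi> where "\<Phi> = quasihomogeneous p \<phi>"
  have \<Phi>: "bounded_symbol \<Phi>" unfolding \<Phi>_def by (rule bounded_symbol_quasihomogeneous[OF \<phi>])
  define l where "l = (\<lambda>n. of_real (hweight n) * moment \<psi> (of_nat (nat \<bar>n\<bar>)))"
  \<comment> \<open>The inner product of \<open>f * hmono n\<close> with
    \<open>hmono (n + p)\<close>, written with \<open>hmono (- n - p)\<close> for the conjugate so
    that the symmetry between \<open>n\<close> and \<open>- n - p\<close> is visible.\<close>
  define A where "A = (\<lambda>f n. LINT z|dA. f z * (hmono n z * hmono (- n - p) z))"
  have inner: "L2_inner (\<lambda>z. f z * hmono n z) (hmono (n + p)) = A f n" for f n
    unfolding L2_inner_def A_def cnj_hmono by (simp add: mult.assoc)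
  have rel: "l n * A \<Phi> n = A g n" for n
  proof -
    have "A g n = L2_inner (toeplitz g (hbasis n)) (hmono (n + p))"
      unfolding toeplitz_L2h(2)[OF g hbasis_L2h] inner[symmetric]
      by (rule L2_inner_cong) (simp add: hbasis_def)
    also have "toeplitz g (hbasis n) = toeplitz \<Phi> (\<lambda>z. l n * hbasis n z)"
      unfolding \<Phi>_def eq[OF hbasis_L2h, symmetric] toeplitz_radial_hbasis[OF \<psi>] l_def ..
    also have "L2_inner (toeplitz \<Phi> (\<lambda>z. l n * hbasis n z)) (hmono (n + p))
        = L2_inner (\<lambda>z. l n * (\<Phi> z * hmono n z)) (hmono (n + p))"
      unfolding toeplitz_L2h(2)[OF \<Phi> L2h_cmult[OF hbasis_L2h]]
      by (rule L2_inner_cong) (simp add: hbasis_def)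
    also have "\<dots> = l n * A \<Phi> n" by (simp add: L2_inner_cmult inner)
    finally show ?thesis ..
  qed
  have Asym: "A f (- n - p) = A f n" for f n
    unfolding A_def by (simp add: mult.commute)
  have lsym: "l (- n - p) = l (n + p)" for n
  proof -
    have m: "- n - p = - (n + p)" by simp
    show ?thesis unfolding m l_def by (simp only: hweight_pos(4) abs_minus_cancel)
  qed
  have key: "(l n - l (n + p)) * A \<Phi> n = 0" for n
    using rel[of n] rel[of "- n - p"] by (simp add: Asym lsym left_diff_distrib)
  \<comment> \<open>An index with the sign of \<open>p\<close>, so that moduli add and
    \<open>|n + p| = k + q\<close> for either sign.\<close>
  define n where "n = sgn p * int k"
  have n: "nat \<bar>n\<bar> = k" "nat \<bar>n + p\<bar> = k + q" "nat \<bar>- n - p\<bar> = k + q"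
    using p by (auto simp: n_def q sgn_if)
  have hw: "hweight n = real k + 1" "hweight (n + p) = real (k + q) + 1"
    using n unfolding hweight_def by linarith+
  have "A \<Phi> n = (LINT z|dA. (\<phi> z * of_real (cmod z ^ q)) * of_real (cmod z ^ (2 * k)))"
    unfolding A_def
  proof (rule Bochner_Integration.integral_cong[OF refl])
    fix z
    \<comment> \<open>The frequencies \<open>p\<close>, \<open>n\<close> and \<open>- n - p\<close>
      add up to 0: the phases cancel and \<open>\<phi>\<close> is left with
      \<open>cmod z ^ (2 * k + q)\<close>.\<close>
    have "cis (of_int p * Arg z) * (cis (of_int n * Arg z) * cis (of_int (- n - p) * Arg z)) = 1"
      by (simp add: cis_mult algebra_simps)
    moreover have "cmod z ^ k * cmod z ^ (k + q) = cmod z ^ q * cmod z ^ (2 * k)"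
      unfolding power_add[symmetric] by (rule arg_cong[where f="(^) (cmod z)"]) simp
    moreover have "\<Phi> z * (hmono n z * hmono (- n - p) z) = \<phi> z * of_real (cmod z ^ k * cmod z ^ (k + q)) *
        (cis (of_int p * Arg z) * (cis (of_int n * Arg z) * cis (of_int (- n - p) * Arg z)))"
      unfolding hmono_polar n \<Phi>_def quasihomogeneous_def of_real_mult by (simp only: mult_ac)
    ultimately show "\<Phi> z * (hmono n z * hmono (- n - p) z) = (\<phi> z * of_real (cmod z ^ q)) * of_real (cmod z ^ (2 * k))"
      by simp
  qed
  then have "A \<Phi> n = moment (\<lambda>z. \<phi> z * of_real (cmod z ^ q)) (of_nat k)"
    by (simp only: moment_of_nat[OF bounded_symbol_mult[OF \<phi> bounded_symbol_norm_power]])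
  moreover have "l n = (of_nat k + 1) * moment \<psi> (of_nat k)"
    "l (n + p) = (of_nat (k + q) + 1) * moment \<psi> (of_nat (k + q))"
    unfolding l_def n hw by simp_all
  ultimately show ?thesis using key[of n] by (simp only: mult.commute)
qed

theorem theorem2:
  fixes p :: int and \<phi> \<psi> :: "complex \<Rightarrow> complex"
  assumes "p \<noteq> 0"
    and "bounded_symbol \<phi>" and "radial \<phi>" and "\<not> (AE z in dA. \<phi> z = 0)"
    and "bounded_symbol \<psi>" and "radial \<psi>"
    and "\<exists>g. bounded_symbol g \<and>
           (\<forall>u\<in>L2h. toeplitz (quasihomogeneous p \<phi>) (toeplitz \<psi> u) = toeplitz g u)"
  shows "\<exists>c. AE z in dA. \<psi> z = c"
proof -
  note \<phi> = assms(2,3) and \<psi> = assms(5,6)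
  obtain g where g: "bounded_symbol g"
    "\<And>u. u \<in> L2h \<Longrightarrow> toeplitz (quasihomogeneous p \<phi>) (toeplitz \<psi> u) = toeplitz g u"
    using assms(7) by auto
  define q where "q = nat \<bar>p\<bar>"
  have q: "q > 0" using assms(1) by (simp add: q_def)
  define \<Phi> where "\<Phi> = (\<lambda>z. \<phi> z * of_real (cmod z ^ q))"
  \<comment> \<open>Its moment at \<open>k\<close> is that of \<open>\<psi>\<close> at
    \<open>k + q\<close>, so the shifted moment is again a moment function of the unshifted
    variable.\<close>
  define \<Psi> where "\<Psi> = (\<lambda>z. \<psi> z * of_real (cmod z ^ (2 * q)))"
  have \<Phi>: "bounded_symbol \<Phi>" "radial \<Phi>"
    unfolding \<Phi>_def by (intro bounded_symbol_mult \<phi> bounded_symbol_norm_power, intro radial_mult_norm_power \<phi>)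
  have \<Psi>: "bounded_symbol \<Psi>"
    unfolding \<Psi>_def by (intro bounded_symbol_mult \<psi> bounded_symbol_norm_power)
  \<comment> \<open>The difference of eigenvalues divided by \<open>s + 1\<close>, using
    \<open>(s + q + 1) / (s + 1) = 1 + q / (s + 1)\<close> and the fact that
    \<open>1 / (s + 1)\<close> is the moment of the constant 1 at integers. Only sums and products
    of moments occur, so \<open>H\<close> is both a moment function and holomorphic.\<close>
  define H where "H = (\<lambda>s. moment \<psi> s - moment \<Psi> s - of_nat q * (moment (\<lambda>z. 1) s * moment \<Psi> s))"
  have H_nat: "(of_nat k + 1) * H (of_nat k) =
      (of_nat k + 1) * moment \<psi> (of_nat k) - (of_nat (k + q) + 1) * moment \<psi> (of_nat (k + q))" for k
  proof -
    have "of_nat k + 1 \<noteq> (0::complex)" by (rule of_nat_plus_1_neq_0)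
    then have "(of_nat k + 1) * H (of_nat k) =
      (of_nat k + 1) * moment \<psi> (of_nat k) - (of_nat (k + q) + 1) * moment \<Psi> (of_nat k)"
      unfolding H_def moment_one by (simp add: field_simps)
    then show ?thesis unfolding \<Psi>_def moment_shift[OF \<psi>(1)] .
  qed
  have nat0: "moment \<Phi> (of_nat k) * H (of_nat k) = 0" for k
  proof -
    have "of_nat k + 1 \<noteq> (0::complex)" by (rule of_nat_plus_1_neq_0)
    moreover have "moment \<Phi> (of_nat k) * ((of_nat k + 1) * H (of_nat k)) = 0"
      unfolding H_nat \<Phi>_def
      by (rule product_moment_identity[OF assms(1) \<phi>(1) \<psi> g q_def])
    ultimately show ?thesis by auto
  qed
  have mf: "moment_function (\<lambda>s. moment \<Phi> s * H s)"
    unfolding H_def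
    by (intro moment_function_mult moment_function_diff moment_function_cmult moment_function_moment
        \<Phi> \<psi> \<Psi> bounded_symbol_const)
  have "(\<forall>s\<in>{s. Re s > 0}. moment \<Phi> s = 0) \<or> (\<forall>s\<in>{s. Re s > 0}. H s = 0)"
  proof (rule holomorphic_mult_eq_0)
    show "open {s. Re s > 0}" by (rule open_halfspace_Re_gt)
    show "connected {s. Re s > 0}" by (intro convex_connected convex_halfspace_Re_gt)
    show "moment \<Phi> holomorphic_on {s. Re s > 0}" by (rule holomorphic_moment[OF \<Phi>(1)])
    show "H holomorphic_on {s. Re s > 0}"
      unfolding H_def by (intro holomorphic_intros holomorphic_moment \<psi> \<Psi> bounded_symbol_const)
    show "moment \<Phi> s * H s = 0" if "s \<in> {s. Re s > 0}" for s
      using moment_function_zero[OF mf nat0] that by simp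
  qed
  then show ?thesis
  proof
    assume "\<forall>s\<in>{s. Re s > 0}. moment \<Phi> s = 0"
    \<comment> \<open>A progression of step 1 rather than \<open>radial_AE_eq_0\<close>, because the
      moment of order 0 lies on the boundary of the half plane.\<close>
    then have "AE z in dA. \<Phi> z = 0"
      by (intro radial_AE_eq_0_progression[OF \<Phi>, of 1]) auto
    then have "AE z in dA. \<phi> z = 0"
      using AE_dA_nonzero by eventually_elim (simp add: \<Phi>_def)
    with assms(4) show ?thesis by simp
  next
    assume H0: "\<forall>s\<in>{s. Re s > 0}. H s = 0"
    define m where "m = (\<lambda>k. (of_nat k + 1) * moment \<psi> (of_nat k))"
    \<comment> \<open>\<open>H\<close> is known to vanish only for \<open>Re s > 0\<close>, so
      \<open>k = 0\<close> is excluded and the progression starts at \<open>q\<close>. This is why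
      the constant is the eigenvalue \<open>m q\<close>.\<close>
    have step: "m (k + q) = m k" if "k > 0" for k
      using H_nat[of k] H0 that by (simp add: m_def)
    have "m (q * Suc j) = m q" for j
    proof (induction j)
      case (Suc j)
      have "m (q * Suc j + q) = m (q * Suc j)" by (rule step) (use q in simp)
      then show ?case using Suc.IH by (simp add: add.commute add.left_commute)
    qed simp
    then have mj: "m (q * j) = m q" if "j > 0" for j
      using that gr0_conv_Suc by auto
    have "AE z in dA. \<psi> z - m q = 0"
    proof (rule radial_AE_eq_0_progression[OF _ _ q])
      show "bounded_symbol (\<lambda>z. \<psi> z - m q)"
        using bounded_symbol_add[OF \<psi>(1) bounded_symbol_const[of "- m q"]] by simp
      show "radial (\<lambda>z. \<psi> z - m q)" by (rule radial_diff_const[OF \<psi>(2)])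
      \<comment> \<open>This moment is \<open>(m (q * j) - m q) / (q * j + 1)\<close>, and
        \<open>m\<close> is constant on the progression.\<close>
      show "moment (\<lambda>z. \<psi> z - m q) (of_nat (q * j)) = 0" if "j > 0" for j
      proof -
        have "of_nat (q * j) + 1 \<noteq> (0::complex)" by (rule of_nat_plus_1_neq_0)
        then show ?thesis
          unfolding moment_diff_const[OF \<psi>(1)] mj[OF that, symmetric] by (simp only: m_def) simp
      qed
    qed
    then show ?thesis by (intro exI[of _ "m q"]) simp
  qed
qed

end
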